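(* Let $p\in\{\infty,\omega\}$ and $\sigma\in\{1,\dots,\tau\}$. If $f=\mathcal I(F)\in\mathcal S_T^p(\Omega_D,A)$, then there exists $g=\mathcal I(G)\in\mathcal S^p_T(\Omega_D,A)$ such that $\Delta_{T_\sigma}f=\Delta_Tf+g$, so in particular $\Delta_{T_\sigma}f\in\mathcal S^p_T(\Omega_D,A)$. For every $K\subseteq\{1,\dots,\tau\}$, the $K$-component of $G\in\mathrm{Stem}^p_T(D,A\otimes\mathbb R^{2^\tau})$ satisfies \[G_K(\alpha,\beta)=\sum_{v\in\{1,\dots,\sigma\}}\frac{t_v-t_{v-1}-1}{\beta_v}(\partial_{\beta_v}F_K)(\alpha,\beta)+\sum_{v\in\{1,\dots,\sigma\}\cap K}\frac{1+t_{v-1}-t_v}{\beta_v^2}F_K(\alpha,\beta)\] for all $(\alpha,\beta)\in D'=\{(\alpha,\beta_1,\dots,\beta_\tau)\in D:\beta_1\cdots\beta_\sigma\ne0\}$.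
   Context: $A$ is a finite-dimensional associative real algebra with unit and a $*$-involution $x\mapsto x^c$; $\mathbb S_A=\{x:x+x^c=0,xx^c=1\}\ne\emptyset$. $V\subseteq A$ has basis $(v_0=1,v_1,\dots,v_N)$, $N\ge1$, $v_s\in\mathbb S_A$ pairwise anticommuting for $s\ge1$, $V\subseteq\bigcup_{J\in\mathbb S_A}(\mathbb R+J\mathbb R)$; $A$ carries the Euclidean norm making a completion of this basis orthonormal. $\mathbb R_{\ell,m}=\mathrm{Span}_{\mathbb R}(v_\ell,\dots,v_m)$, $\mathbb S_{\ell,m}$ its unit sphere. A list of steps $T=(t_0,\dots,t_\tau)$, $0\le t_0<\dots<t_\tau=N$, has torus $\mathbb T=\mathbb S_{t_0+1,t_1}\times\cdots\times\mathbb S_{t_{\tau-1}+1,t_\tau}$ (for $0$ steps: single index $J=\emptyset$, $\beta J=0$); $x=x^0+\dots+x^\tau$, $x^h=\sum_{s=t_{h-1}+1}^{t_h}x_sv_s$ ($t_{-1}=-1$). For $J\in\mathbb T$, $\beta\in\mathbb R^\tau$: $\beta J=\sum\beta_hJ_h$; $J_\emptyset=1$, $J_K=J_{k_1}\cdots J_{k_p}$; $\overline\beta^h$ flips the sign of $\beta_h$. $D\subseteq\mathbb R_{0,t_0}\times\mathbb R^\tau$ open, reflection invariant, $\Omega_D=\{\alpha+\beta J\}$ open. $T$-stem functions $F=\sum_KE_KF_K:D\to A\otimes\mathbb R^{2^\tau}$ ($F_K(\alpha,\overline\beta^h)=F_K$ if $h\notin K$, $-F_K$ if $h\in K$) induce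 $\mathcal I(F)(\alpha+\beta J)=\sum_KJ_KF_K(\alpha,\beta)$ ($\mathcal I$ injective); $\mathrm{Stem}^p_T$, $\mathcal S^p_T$ their $C^p$ versions. Laplacian: writing $\alpha=\sum_{s\le t_0}x_sv_s$, $(\Delta_TF)_K=\sum_{s=0}^{t_0}\partial^2_{x_s}F_K+\sum_{h}\partial^2_{\beta_h}F_K$ and $\Delta_T\mathcal I(F)=\mathcal I(\Delta_TF)$; the same for any list of steps. For $1\le\sigma\le\tau$, $T_\sigma=(t_\sigma,\dots,t_\tau)$ (mirror $\mathbb R_{0,t_\sigma}$), and $\Omega_D=\Omega_{D^\sigma}$ for $T_\sigma$ with $D^\sigma=\{(\alpha+x^1+\dots+x^\sigma,\beta_{\sigma+1},\dots,\beta_\tau):x^v\in\mathbb R_{t_{v-1}+1,t_v},(\alpha,\|x^1\|,\dots,\|x^\sigma\|,\beta_{\sigma+1},\dots)\in D\}$; every element of $\mathcal S^p_T(\Omega_D,A)$, $p\in\{\infty,\omega\}$, is also an element of $\mathcal S^p_{T_\sigma}(\Omega_D,A)$, and $\Delta_{T_\sigma}f$ is computed in that sense. *)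

theory Defs
  imports "HOL-Analysis.Analysis"
begin

text \<open>Points of \<open>\<real>^n\<close> are encoded as functions \<open>y :: nat \<Rightarrow> real\<close> vanishing from index n on.
  For a list of steps given by \<open>t :: nat \<Rightarrow> nat\<close> (entries t 0 < ... < t tau) and tau,
  a point \<open>(alpha, beta) \<in> \<real>_{0,t_0} \<times> \<real>^tau\<close> is encoded by
  \<open>y s = x_s\<close> for \<open>s \<le> t 0\<close> (alpha = sum of x_s v_s) and \<open>y (t 0 + h) = beta_h\<close> for \<open>1 \<le> h \<le> tau\<close>;
  hence the dimension is \<open>t 0 + 1 + tau\<close>.\<close>

definition cspace :: "nat \<Rightarrow> (nat \<Rightarrow> real) set" where
  "cspace n = {y. \<forall>i\<ge>n. y i = 0}"

definition sdim :: "(nat \<Rightarrow> nat) \<Rightarrow> nat \<Rightarrow> nat" where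
  "sdim t \<tau> = t 0 + 1 + \<tau>"

definition pd :: "nat \<Rightarrow> ((nat \<Rightarrow> real) \<Rightarrow> 'a::real_normed_vector) \<Rightarrow> (nat \<Rightarrow> real) \<Rightarrow> 'a" where
  "pd i G y = vector_derivative (\<lambda>s. G (y(i := s))) (at (y i))"

fun hpd :: "nat list \<Rightarrow> ((nat \<Rightarrow> real) \<Rightarrow> 'a::real_normed_vector) \<Rightarrow> (nat \<Rightarrow> real) \<Rightarrow> 'a" where
  "hpd [] G = G"
| "hpd (i # is) G = pd i (hpd is G)"

definition smooth_on_c :: "nat \<Rightarrow> (nat \<Rightarrow> real) set \<Rightarrow> ((nat \<Rightarrow> real) \<Rightarrow> 'a::real_normed_vector) \<Rightarrow> bool" where
  "smooth_on_c n D G \<longleftrightarrow>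
     (\<forall>is. set is \<subseteq> {..<n} \<longrightarrow>
        continuous_on D (hpd is G) \<and>
        (\<forall>y\<in>D. \<forall>i<n. \<exists>d. ((\<lambda>s. hpd is G (y(i := s))) has_vector_derivative d) (at (y i))))"

definition ranalytic_on_c :: "nat \<Rightarrow> (nat \<Rightarrow> real) set \<Rightarrow> ((nat \<Rightarrow> real) \<Rightarrow> 'a::real_normed_vector) \<Rightarrow> bool" where
  "ranalytic_on_c n D G \<longleftrightarrow>
     (\<forall>c\<in>D. \<exists>r>0. \<exists>a :: (nat \<Rightarrow> nat) \<Rightarrow> 'a.
        \<forall>y\<in>D. (\<forall>i<n. \<bar>y i - c i\<bar> < r) \<longrightarrow>
          ((\<lambda>m. (\<Prod>i<n. (y i - c i) ^ m i) *\<^sub>R a m) has_sum G y) {m. \<forall>i\<ge>n. m i = 0})"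

datatype regularity = C_infinity | C_omega

definition reg_on :: "regularity \<Rightarrow> nat \<Rightarrow> (nat \<Rightarrow> real) set \<Rightarrow> ((nat \<Rightarrow> real) \<Rightarrow> 'a::real_normed_vector) \<Rightarrow> bool" where
  "reg_on p n D G = (case p of C_infinity \<Rightarrow> smooth_on_c n D G | C_omega \<Rightarrow> ranalytic_on_c n D G)"

definition lapl :: "nat \<Rightarrow> ((nat \<Rightarrow> real) \<Rightarrow> 'a::real_normed_vector) \<Rightarrow> (nat \<Rightarrow> real) \<Rightarrow> 'a" where
  "lapl n G y = (\<Sum>i<n. pd i (pd i G) y)"

definition sph :: "(nat \<Rightarrow> 'a::real_normed_vector) \<Rightarrow> nat \<Rightarrow> nat \<Rightarrow> 'a set" where
  "sph v l m = {x \<in> span (v ` {l..m}). norm x = 1}"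

definition torus :: "(nat \<Rightarrow> nat) \<Rightarrow> nat \<Rightarrow> (nat \<Rightarrow> 'a::real_normed_vector) \<Rightarrow> (nat \<Rightarrow> 'a) set" where
  "torus t \<tau> v = {J. (\<forall>h\<in>{1..\<tau>}. J h \<in> sph v (t (h - 1) + 1) (t h)) \<and> (\<forall>h. h \<notin> {1..\<tau>} \<longrightarrow> J h = 0)}"

definition spt :: "(nat \<Rightarrow> nat) \<Rightarrow> nat \<Rightarrow> (nat \<Rightarrow> 'a::real_vector) \<Rightarrow> (nat \<Rightarrow> real) \<Rightarrow> (nat \<Rightarrow> 'a) \<Rightarrow> 'a" where
  "spt t \<tau> v y J = (\<Sum>s\<le>t 0. y s *\<^sub>R v s) + (\<Sum>h\<in>{1..\<tau>}. y (t 0 + h) *\<^sub>R J h)"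

definition Omega :: "(nat \<Rightarrow> nat) \<Rightarrow> nat \<Rightarrow> (nat \<Rightarrow> 'a::real_normed_vector) \<Rightarrow> (nat \<Rightarrow> real) set \<Rightarrow> 'a set" where
  "Omega t \<tau> v D = {spt t \<tau> v y J | y J. y \<in> D \<and> J \<in> torus t \<tau> v}"

definition Jprod :: "(nat \<Rightarrow> 'a::monoid_mult) \<Rightarrow> nat set \<Rightarrow> 'a" where
  "Jprod J K = foldr (*) (map J (sorted_list_of_set K)) 1"

definition bflip :: "(nat \<Rightarrow> nat) \<Rightarrow> nat \<Rightarrow> (nat \<Rightarrow> real) \<Rightarrow> nat \<Rightarrow> real" where
  "bflip t h y = y(t 0 + h := - y (t 0 + h))"

definition admissible_dom :: "(nat \<Rightarrow> nat) \<Rightarrow> nat \<Rightarrow> (nat \<Rightarrow> real) set \<Rightarrow> bool" where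
  "admissible_dom t \<tau> D \<longleftrightarrow> D \<subseteq> cspace (sdim t \<tau>) \<and> openin (top_of_set (cspace (sdim t \<tau>))) D
     \<and> (\<forall>y\<in>D. \<forall>h\<in>{1..\<tau>}. bflip t h y \<in> D)"

text \<open>A T-stem function \<open>F = \<Sum>_K E_K F_K\<close> is encoded by its components \<open>F K\<close>, \<open>K \<subseteq> {1..tau}\<close>.\<close>
definition is_stem :: "(nat \<Rightarrow> nat) \<Rightarrow> nat \<Rightarrow> (nat \<Rightarrow> real) set \<Rightarrow> (nat set \<Rightarrow> (nat \<Rightarrow> real) \<Rightarrow> 'a::real_vector) \<Rightarrow> bool" where
  "is_stem t \<tau> D F \<longleftrightarrow> (\<forall>K. K \<subseteq> {1..\<tau>} \<longrightarrow> (\<forall>y\<in>D. \<forall>h\<in>{1..\<tau>}.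
      F K (bflip t h y) = (if h \<in> K then - F K y else F K y)))"

definition stem_reg :: "regularity \<Rightarrow> (nat \<Rightarrow> nat) \<Rightarrow> nat \<Rightarrow> (nat \<Rightarrow> real) set \<Rightarrow> (nat set \<Rightarrow> (nat \<Rightarrow> real) \<Rightarrow> 'a::real_normed_vector) \<Rightarrow> bool" where
  "stem_reg p t \<tau> D F \<longleftrightarrow> is_stem t \<tau> D F \<and> (\<forall>K. K \<subseteq> {1..\<tau>} \<longrightarrow> reg_on p (sdim t \<tau>) D (F K))"

definition induces :: "(nat \<Rightarrow> nat) \<Rightarrow> nat \<Rightarrow> (nat \<Rightarrow> 'a::{real_normed_vector, real_algebra_1}) \<Rightarrow> (nat \<Rightarrow> real) set
     \<Rightarrow> (nat set \<Rightarrow> (nat \<Rightarrow> real) \<Rightarrow> 'a) \<Rightarrow> ('a \<Rightarrow> 'a) \<Rightarrow> bool" where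
  "induces t \<tau> v D F f \<longleftrightarrow> (\<forall>y\<in>D. \<forall>J\<in>torus t \<tau> v. f (spt t \<tau> v y J) = (\<Sum>K\<in>Pow {1..\<tau>}. Jprod J K * F K y))"

definition slice_reg :: "regularity \<Rightarrow> (nat \<Rightarrow> nat) \<Rightarrow> nat \<Rightarrow> (nat \<Rightarrow> 'a::{real_normed_vector, real_algebra_1}) \<Rightarrow> (nat \<Rightarrow> real) set
     \<Rightarrow> ('a \<Rightarrow> 'a) \<Rightarrow> bool" where
  "slice_reg p t \<tau> v D f \<longleftrightarrow> (\<exists>F. stem_reg p t \<tau> D F \<and> induces t \<tau> v D F f)"

text \<open>\<open>\<Delta>_T f = \<I>(\<Delta>_T F)\<close> where \<open>f = \<I>(F)\<close> with F a T-stem of class p on D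
  (well defined on Omega_D since \<open>\<I>\<close> is injective).\<close>
definition slap :: "regularity \<Rightarrow> (nat \<Rightarrow> nat) \<Rightarrow> nat \<Rightarrow> (nat \<Rightarrow> 'a::{real_normed_vector, real_algebra_1}) \<Rightarrow> (nat \<Rightarrow> real) set
     \<Rightarrow> ('a \<Rightarrow> 'a) \<Rightarrow> 'a \<Rightarrow> 'a" where
  "slap p t \<tau> v D f x = (SOME w. \<exists>F. stem_reg p t \<tau> D F \<and> induces t \<tau> v D F f \<and>
      (\<exists>y\<in>D. \<exists>J\<in>torus t \<tau> v. x = spt t \<tau> v y J \<and>
         w = (\<Sum>K\<in>Pow {1..\<tau>}. Jprod J K * lapl (sdim t \<tau>) (F K) y)))"

text \<open>\<open>T_sigma = (t_sigma, ..., t_tau)\<close> is encoded by \<open>(\<lambda>h. t (\<sigma> + h), \<tau> - \<sigma>)\<close>.\<close>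
definition tsig :: "(nat \<Rightarrow> nat) \<Rightarrow> nat \<Rightarrow> nat \<Rightarrow> nat" where
  "tsig t \<sigma> = (\<lambda>h. t (\<sigma> + h))"

text \<open>\<open>\<parallel>x^u\<parallel>\<close> for the block \<open>t_{u-1}+1 .. t_u\<close> (orthonormal basis).\<close>
definition blocknorm :: "(nat \<Rightarrow> nat) \<Rightarrow> nat \<Rightarrow> (nat \<Rightarrow> real) \<Rightarrow> real" where
  "blocknorm t u y = sqrt (\<Sum>s\<in>{t (u - 1) + 1..t u}. (y s)\<^sup>2)"

definition Dsig :: "(nat \<Rightarrow> nat) \<Rightarrow> nat \<Rightarrow> nat \<Rightarrow> (nat \<Rightarrow> real) set \<Rightarrow> (nat \<Rightarrow> real) set" where
  "Dsig t \<tau> \<sigma> D = {y \<in> cspace (sdim (tsig t \<sigma>) (\<tau> - \<sigma>)).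
     (\<lambda>i. if i \<le> t 0 then y i
          else if i \<le> t 0 + \<sigma> then blocknorm t (i - t 0) y
          else if i < sdim t \<tau> then y (t \<sigma> + (i - t 0 - \<sigma>))
          else 0) \<in> D}"

definition SA :: "('a \<Rightarrow> 'a) \<Rightarrow> 'a::real_algebra_1 set" where
  "SA cj = {x. x + cj x = 0 \<and> x * cj x = 1}"

end

theory Submission
  imports Defs
begin

text \<open>
  For every \<open>K\<close>, the component \<open>F\<^sub>K\<close> is odd in each \<open>\<beta>\<^sub>h\<close> with \<open>h \<in> K\<close>, so that
  \<open>F\<^sub>K = (\<Prod>h\<in>K, h\<le>\<sigma>. \<beta>\<^sub>h) H\<^sub>K\<close> with \<open>H\<^sub>K\<close> of the same class and even in \<open>\<beta>\<^sub>1, \<dots>, \<beta>\<^sub>\<sigma>\<close>.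
  As \<open>\<beta>\<^sub>h J\<^sub>h = x^h\<close> and an even function of \<open>\<beta>\<^sub>h\<close> becomes a regular function of \<open>x^h\<close> when evaluated at
  \<open>\<beta>\<^sub>h = \<parallel>x^h\<parallel>\<close>, the products \<open>x^{h\<^sub>1} \<cdots> x^{h\<^sub>p} H\<^sub>K\<close> are, up to sign, the contributions of \<open>F\<^sub>K\<close> to the
  \<open>T\<^sub>\<sigma>\<close>-stem function of \<open>f\<close>. Put \<open>E\<^sub>u = \<beta>\<^sub>u\<inverse> \<partial>\<^sub>u H\<^sub>K\<close>, again regular and even. In polar coordinates of the
  \<open>u\<close>-th block, of dimension \<open>d\<close>, the Laplacian of \<open>H\<^sub>K\<close> is \<open>\<partial>\<^sub>u\<^sup>2 H\<^sub>K + (d - 1) E\<^sub>u\<close> and that of \<open>x^u H\<^sub>K\<close> is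
  \<open>x^u (\<partial>\<^sub>u\<^sup>2 H\<^sub>K + (d + 1) E\<^sub>u)\<close>, while \<open>\<partial>\<^sub>u\<^sup>2 (\<beta>\<^sub>u H\<^sub>K) = \<beta>\<^sub>u (\<partial>\<^sub>u\<^sup>2 H\<^sub>K + 2 E\<^sub>u)\<close>. In both cases the difference
  of the two Laplacians contributes \<open>(d - 1) E\<^sub>u\<close>, and
  \<open>G\<^sub>K = (\<Prod>h\<in>K, h\<le>\<sigma>. \<beta>\<^sub>h) \<Sum>\<^sub>u (t\<^sub>u - t\<^bsub>u-1\<^esub> - 1) E\<^sub>u\<close>.
\<close>

section \<open>Smooth functions of finitely many coordinates\<close>

text \<open>The formula for \<open>G\<^sub>K\<close> has poles on the hyperplanes
  \<open>\<beta>\<^sub>u = 0\<close>, where \<open>G\<^sub>K\<close> must nevertheless be regular;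
  the quotients \<open>H\<^sub>K\<close> and \<open>E\<^sub>u\<close> are therefore constructed on
  all of D, and the formula is read off outside the hyperplanes. The same hyperplanes obstruct the
  passage to \<open>T\<^sub>\<sigma>\<close>: the norm of \<open>x^u\<close> is not differentiable
  at 0. In the smooth case the identity
  \<open>\<partial>\<^sub>s (H o nu) = x\<^sub>s (E\<^sub>u o nu)\<close> replaces the chain rule
  and can be iterated; in the analytic case an even series at such a point contains only squares of
  the norm, which are polynomials. As smoothness is formulated with iterated partial derivatives, it
  is mostly proved by exhibiting a family of continuous functions closed under differentiation.
  Finally, the Laplacian of a slice function is defined by a choice among all its stem functions and
  all representations of a point. Its value is known only after two uniqueness proofs, needed for
  \<open>T\<close> and for \<open>T\<^sub>\<sigma>\<close>; both lists are instances of one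
  locale.\<close>

definition cnb :: "nat \<Rightarrow> (nat \<Rightarrow> real) \<Rightarrow> real \<Rightarrow> (nat \<Rightarrow> real) set" where
  "cnb n c r = {z \<in> cspace n. \<forall>i<n. \<bar>z i - c i\<bar> < r}"

text \<open>Openness relative to \<open>cspace n\<close> in the product topology, rephrased with
  cubes (see \<open>copen_iff_openin\<close>). Cubes are what differentiation along a coordinate and
  convergence of power series both ask for.\<close>

definition copen :: "nat \<Rightarrow> (nat \<Rightarrow> real) set \<Rightarrow> bool" where
  "copen n D \<longleftrightarrow> D \<subseteq> cspace n \<and> (\<forall>c\<in>D. \<exists>r>0. cnb n c r \<subseteq> D)"

definition has_pd :: "nat \<Rightarrow> ((nat \<Rightarrow> real) \<Rightarrow> 'a::real_normed_vector) \<Rightarrow> 'a \<Rightarrow> (nat \<Rightarrow> real) \<Rightarrow> bool" where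
  "has_pd i G d y \<longleftrightarrow> ((\<lambda>s. G (y(i := s))) has_vector_derivative d) (at (y i))"

lemma openin_cnb: "openin (top_of_set (cspace n)) (cnb n c r)"
proof -
  have "open (\<Inter>i\<in>{..<n}. {z::nat \<Rightarrow> real. \<bar>z i - c i\<bar> < r})"
    by (intro open_INT open_Collect_less continuous_intros continuous_on_product_coordinates ballI) auto
  moreover have "cnb n c r = cspace n \<inter> (\<Inter>i\<in>{..<n}. {z. \<bar>z i - c i\<bar> < r})"
    by (auto simp: cnb_def)
  ultimately show ?thesis by (simp add: openin_open_Int)
qed

lemma self_in_cnb: "c \<in> cspace n \<Longrightarrow> 0 < r \<Longrightarrow> c \<in> cnb n c r"
  by (simp add: cnb_def)

lemma uniform_radius:
  fixes n :: nat and X :: "nat \<Rightarrow> real set"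
  assumes "\<And>i. open (X i)" "\<And>i. c i \<in> X i"
  shows "\<exists>r>0. \<forall>i<n. \<forall>x. \<bar>x - c i\<bar> < r \<longrightarrow> x \<in> X i"
proof (induction n)
  case 0
  show ?case by (auto intro: exI[of _ 1])
next
  case (Suc n)
  then obtain r where r: "r > 0" "\<forall>i<n. \<forall>x. \<bar>x - c i\<bar> < r \<longrightarrow> x \<in> X i" by blast
  obtain e where e: "e > 0" "\<forall>x. \<bar>x - c n\<bar> < e \<longrightarrow> x \<in> X n"
    using assms[of n] by (auto simp: open_real)
  show ?case
    by (rule exI[of _ "min r e"]) (use r e in \<open>auto simp: less_Suc_eq\<close>)
qed

lemma copen_iff_openin:
  "copen n D \<longleftrightarrow> D \<subseteq> cspace n \<and> openin (top_of_set (cspace n)) D"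
proof (intro iffI conjI)
  assume L: "copen n D"
  then show "D \<subseteq> cspace n" by (simp add: copen_def)
  show "openin (top_of_set (cspace n)) D"
  proof (subst openin_subopen, intro ballI)
    fix c assume c: "c \<in> D"
    then obtain r where "r > 0" "cnb n c r \<subseteq> D" using L by (auto simp: copen_def)
    then show "\<exists>T. openin (top_of_set (cspace n)) T \<and> c \<in> T \<and> T \<subseteq> D"
      using openin_cnb[of n c r] self_in_cnb[of c n r] L c unfolding copen_def
      by (intro exI[of _ "cnb n c r"]) auto
  qed
next
  assume R: "D \<subseteq> cspace n \<and> openin (top_of_set (cspace n)) D"
  show "copen n D"
    unfolding copen_def
  proof (intro conjI ballI)
    show "D \<subseteq> cspace n" using R by simp
    fix c assume c: "c \<in> D"
    obtain U where U: "open U" "D = cspace n \<inter> U" using R by (auto simp: openin_open)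
    then have "openin (product_topology (\<lambda>i. euclidean) UNIV) U" by (simp add: open_fun_def)
    from product_topology_open_contains_basis[OF this, of c] U c
    obtain X where X: "c \<in> Pi\<^sub>E UNIV X" "\<And>i. openin euclidean (X i)" 
        "finite {i. X i \<noteq> topspace euclidean}" "Pi\<^sub>E UNIV X \<subseteq> U"
      by auto
    obtain m where m: "{i. X i \<noteq> UNIV} \<subseteq> {..<m}"
      using X(3) finite_nat_iff_bounded by auto
    obtain r where r: "r > 0" "\<forall>i<max m n. \<forall>x. \<bar>x - c i\<bar> < r \<longrightarrow> x \<in> X i"
      using uniform_radius[of X c "max m n"] X by (auto simp: PiE_iff)
    have "cnb n c r \<subseteq> D"
    proof
      fix z assume z: "z \<in> cnb n c r"
      have "z i \<in> X i" for i
      proof (cases "i < n")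
        case True then show ?thesis using r z by (auto simp: cnb_def)
      next
        case False
        then have "z i = c i" using z c R by (auto simp: cnb_def cspace_def)
        then show ?thesis using X(1) by (auto simp: PiE_iff)
      qed
      then have "z \<in> U" using X(4) by (auto simp: PiE_iff)
      then show "z \<in> D" using U z by (auto simp: cnb_def)
    qed
    then show "\<exists>r>0. cnb n c r \<subseteq> D" using r by blast
  qed
qed

lemma copen_cnb: "copen n (cnb n c r)"
  by (simp add: copen_iff_openin openin_cnb) (auto simp: cnb_def)

lemma cspace_upd: "y \<in> cspace n \<Longrightarrow> i < n \<Longrightarrow> y(i := s) \<in> cspace n"
  by (auto simp: cspace_def)

lemma copen_line:
  assumes "copen n D" "y \<in> D" "i < n"
  shows "\<exists>S. open S \<and> y i \<in> S \<and> (\<forall>s\<in>S. y(i := s) \<in> D)"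
proof -
  obtain r where r: "r > 0" "cnb n y r \<subseteq> D" using assms by (auto simp: copen_def)
  have "y(i := s) \<in> D" if "s \<in> ball (y i) r" for s
  proof -
    have "y(i := s) \<in> cnb n y r"
      using that r assms by (auto simp: cnb_def cspace_upd copen_def dist_real_def)
    then show ?thesis using r by blast
  qed
  then show ?thesis using r by (intro exI[of _ "ball (y i) r"]) auto
qed

lemma has_pd_cong:
  assumes "copen n D" "y \<in> D" "i < n" "\<And>z. z \<in> D \<Longrightarrow> G z = G' z" "has_pd i G d y"
  shows "has_pd i G' d y"
proof -
  obtain S where S: "open S" "y i \<in> S" "\<And>s. s \<in> S \<Longrightarrow> y(i := s) \<in> D"
    using copen_line[OF assms(1-3)] by blast
  show ?thesis
    using assms(5) unfolding has_pd_def
    by (rule has_vector_derivative_transform_within_open[OF _ S(1,2)]) (use S(3) assms(4) in auto)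
qed

lemma has_pd_imp_pd: "has_pd i G d y \<Longrightarrow> pd i G y = d"
  unfolding has_pd_def pd_def by (rule vector_derivative_at)

lemma pd_cong:
  assumes "copen n D" "y \<in> D" "i < n" "\<And>z. z \<in> D \<Longrightarrow> G z = G' z"
  shows "pd i G y = pd i G' y"
  unfolding pd_def
proof (rule vector_derivative_cong_eq)
  obtain S where S: "open S" "y i \<in> S" "\<And>s. s \<in> S \<Longrightarrow> y(i := s) \<in> D"
    using copen_line[OF assms(1-3)] by blast
  then have "eventually (\<lambda>s. s \<in> S) (nhds (y i))" by (simp add: eventually_nhds_in_open)
  then show "\<forall>\<^sub>F x in nhds (y i). x \<in> UNIV \<longrightarrow> G (y(i := x)) = G' (y(i := x))"
    by eventually_elim (use S assms in auto)
qed auto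

lemma smooth_on_c_iff:
  "smooth_on_c n D G \<longleftrightarrow> (\<forall>is. set is \<subseteq> {..<n} \<longrightarrow> continuous_on D (hpd is G) \<and>
     (\<forall>y\<in>D. \<forall>i<n. \<exists>d. has_pd i (hpd is G) d y))"
  by (simp add: smooth_on_c_def has_pd_def)

text \<open>Induction on the list of indices shows that every iterated derivative of G agrees on D
  with a member of C. Closure properties of smooth functions thus reduce to finding a family C that
  is stable under one derivative, and values outside D never matter.\<close>

lemma smooth_on_c_coinduct:
  assumes D: "copen n D" and "g \<in> C" "\<And>y. y \<in> D \<Longrightarrow> G y = g y"
    and C: "\<And>g. g \<in> C \<Longrightarrow> continuous_on D g"
           "\<And>g i. g \<in> C \<Longrightarrow> i < n \<Longrightarrow> \<exists>g'\<in>C. \<forall>y\<in>D. has_pd i g (g' y) y"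
  shows "smooth_on_c n D G"
proof -
  have *: "\<exists>g\<in>C. \<forall>y\<in>D. hpd is G y = g y" if "set is \<subseteq> {..<n}" for "is"
    using that
  proof (induction "is")
    case Nil then show ?case using assms by auto
  next
    case (Cons i is')
    then obtain g where g: "g \<in> C" "\<forall>y\<in>D. hpd is' G y = g y" by auto
    obtain g' where g': "g' \<in> C" "\<forall>y\<in>D. has_pd i g (g' y) y" using C(2)[OF g(1), of i] Cons.prems by (metis insert_subset lessThan_iff list.set(2))
    have "hpd (i # is') G y = g' y" if "y \<in> D" for y
    proof -
      have "has_pd i (hpd is' G) (g' y) y"
        by (rule has_pd_cong[OF D that, of _ g]) (use g g' that Cons in auto)
      then show ?thesis by (simp add: has_pd_imp_pd)
    qed
    then show ?case using g' by blast
  qed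
  show ?thesis
    unfolding smooth_on_c_iff
  proof (intro allI impI conjI ballI)
    fix "is" assume is': "set is \<subseteq> {..<n}"
    then obtain g where g: "g \<in> C" "\<forall>y\<in>D. hpd is G y = g y" using * by blast
    show "continuous_on D (hpd is G)"
      using C(1)[OF g(1)] g(2) by (simp cong: continuous_on_cong)
    fix y i assume y: "y \<in> D" "i < n"
    obtain g' where g': "g' \<in> C" "\<forall>y\<in>D. has_pd i g (g' y) y" using C(2)[OF g(1), of i] y by blast
    have "has_pd i (hpd is G) (g' y) y"
      by (rule has_pd_cong[OF D y, of g]) (use g g' y in auto)
    then show "\<exists>d. has_pd i (hpd is G) d y" by blast
  qed
qed

lemma smooth_on_c_continuous: "smooth_on_c n D G \<Longrightarrow> continuous_on D G"
  unfolding smooth_on_c_iff by (drule spec[of _ "[]"]) simp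

lemma smooth_on_c_has_pd:
  assumes "smooth_on_c n D G" "y \<in> D" "i < n"
  shows "has_pd i G (pd i G y) y"
proof -
  obtain d where "has_pd i G d y"
    using assms unfolding smooth_on_c_iff by (metis empty_subsetI hpd.simps(1) list.set(1))
  then show ?thesis by (simp add: has_pd_imp_pd)
qed

lemma hpd_append: "hpd (is @ js) G = hpd is (hpd js G)"
  by (induction "is") auto

lemma smooth_on_c_pd:
  assumes "smooth_on_c n D G" "i < n"
  shows "smooth_on_c n D (pd i G)"
  unfolding smooth_on_c_iff
proof (intro allI impI)
  fix "is" assume "set is \<subseteq> {..<n}"
  then have "set (is @ [i]) \<subseteq> {..<n}" using assms by auto
  moreover have "hpd is (pd i G) = hpd (is @ [i]) G" by (simp add: hpd_append)
  ultimately show "continuous_on D (hpd is (pd i G)) \<and>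
     (\<forall>y\<in>D. \<forall>j<n. \<exists>d. has_pd j (hpd is (pd i G)) d y)"
    using assms(1) unfolding smooth_on_c_iff by metis
qed

lemma smooth_on_c_cong:
  assumes "copen n D" "\<And>y. y \<in> D \<Longrightarrow> G y = g y" "smooth_on_c n D g"
  shows "smooth_on_c n D G"
  by (rule smooth_on_c_coinduct[where C = "{g. smooth_on_c n D g}" and g = g])
     (use assms in \<open>auto intro: smooth_on_c_continuous smooth_on_c_has_pd smooth_on_c_pd\<close>)

text \<open>Division by a coordinate is given by different expressions near and away from the
  hyperplane where the coordinate vanishes; this lemma glues them.\<close>

lemma smooth_on_c_local:
  assumes D: "copen n D"
    and loc: "\<And>c. c \<in> D \<Longrightarrow> \<exists>U. c \<in> U \<and> U \<subseteq> D \<and> copen n U \<and> smooth_on_c n U G"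
  shows "smooth_on_c n D G"
  unfolding smooth_on_c_iff
proof (intro allI impI conjI ballI)
  fix "is" assume is': "set is \<subseteq> {..<n}"
  show "continuous_on D (hpd is G)"
  proof -
    have "continuous (at c within D) (hpd is G)" if c: "c \<in> D" for c
    proof -
      obtain U where U: "c \<in> U" "U \<subseteq> D" "copen n U" "smooth_on_c n U G" using loc[OF c] by blast
      obtain S where S: "open S" "U = cspace n \<inter> S" using U by (auto simp: copen_iff_openin openin_open)
      have "at c within D = at c within U"
        by (rule at_within_nhd[of c S]) (use U S D in \<open>auto simp: copen_def\<close>)
      moreover have "continuous (at c within U) (hpd is G)"
        using U is' unfolding smooth_on_c_iff continuous_on_eq_continuous_within by blast
      ultimately show ?thesis by simp
    qed
    then show ?thesis by (simp add: continuous_on_eq_continuous_within)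
  qed
  fix y i assume "y \<in> D" "i < n"
  then show "\<exists>d. has_pd i (hpd is G) d y" using loc is' unfolding smooth_on_c_iff by blast
qed

lemma smooth_on_c_subset:
  "smooth_on_c n D G \<Longrightarrow> U \<subseteq> D \<Longrightarrow> smooth_on_c n U G"
  unfolding smooth_on_c_iff by (meson continuous_on_subset subsetD)

section \<open>Algebraic operations on smooth functions\<close>

lemma has_pd_add:
  "has_pd i g d y \<Longrightarrow> has_pd i h e y \<Longrightarrow> has_pd i (\<lambda>y. g y + h y) (d + e) y"
  unfolding has_pd_def by (rule has_vector_derivative_add)

lemma has_pd_const: "has_pd i (\<lambda>y. k) 0 y"
  unfolding has_pd_def by (rule has_vector_derivative_const)

lemma has_pd_bounded_linear:
  "bounded_linear T \<Longrightarrow> has_pd i g d y \<Longrightarrow> has_pd i (\<lambda>y. T (g y)) (T d) y"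
  unfolding has_pd_def by (rule bounded_linear.has_vector_derivative)

lemma has_pd_scaleR_fun:
  assumes "has_pd i \<phi> e y" "has_pd i g d y"
  shows "has_pd i (\<lambda>y. \<phi> y *\<^sub>R g y) (\<phi> y *\<^sub>R d + e *\<^sub>R g y) y"
proof -
  have "((\<lambda>s. \<phi> (y(i := s))) has_real_derivative e) (at (y i))"
    using assms(1) by (simp add: has_pd_def has_real_derivative_iff_has_vector_derivative)
  from has_vector_derivative_scaleR[OF this assms(2)[unfolded has_pd_def]]
  show ?thesis by (simp add: has_pd_def)
qed

lemma has_pd_coord: "has_pd i (\<lambda>y. y j) (if i = j then 1 else 0) y"
  unfolding has_pd_def by (cases "i = j") (auto intro!: derivative_eq_intros)

lemma has_pd_coord_scaleR:
  assumes "has_pd i g d y"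
  shows "has_pd i (\<lambda>y. y j *\<^sub>R g y) (y j *\<^sub>R d + (if i = j then g y else 0)) y"
  using has_pd_scaleR_fun[OF has_pd_coord[of i j y] assms] by (simp split: if_splits)

lemma continuous_on_coord: "continuous_on D (\<lambda>y::nat \<Rightarrow> real. y j)"
  by (rule continuous_on_subset[OF continuous_on_product_coordinates]) simp

lemma smooth_on_c_const:
  assumes "copen n D"
  shows "smooth_on_c n D (\<lambda>y. k)"
  by (rule smooth_on_c_coinduct[where C = "range (\<lambda>k y. k)", OF assms])
     (auto intro: has_pd_const)

lemma smooth_on_c_add:
  assumes D: "copen n D" and g: "smooth_on_c n D g" "smooth_on_c n D h"
  shows "smooth_on_c n D (\<lambda>y. g y + h y)"
proof (rule smooth_on_c_coinduct[where C = "{\<lambda>y. g y + h y | g h. smooth_on_c n D g \<and> smooth_on_c n D h}", OF D])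
  fix f i assume "f \<in> {\<lambda>y. g y + h y | g h. smooth_on_c n D g \<and> smooth_on_c n D h}" and i: "i < n"
  then obtain g h where gh: "f = (\<lambda>y. g y + h y)" "smooth_on_c n D g" "smooth_on_c n D h" by blast
  then have "\<forall>y\<in>D. has_pd i f (pd i g y + pd i h y) y"
    using i by (auto intro!: has_pd_add smooth_on_c_has_pd)
  then show "\<exists>g'\<in>{\<lambda>y. g y + h y | g h. smooth_on_c n D g \<and> smooth_on_c n D h}. \<forall>y\<in>D. has_pd i f (g' y) y"
    using smooth_on_c_pd[OF gh(2) i] smooth_on_c_pd[OF gh(3) i]
    by (intro bexI[of _ "\<lambda>y. pd i g y + pd i h y"]) blast+
qed (use g in \<open>auto intro!: continuous_on_add intro: smooth_on_c_continuous\<close>)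

lemma smooth_on_c_bounded_linear:
  assumes D: "copen n D" and g: "smooth_on_c n D g" and T: "bounded_linear T"
  shows "smooth_on_c n D (\<lambda>y. T (g y))"
proof (rule smooth_on_c_coinduct[where C = "{\<lambda>y. T (g y) | g. smooth_on_c n D g}", OF D])
  fix f i assume "f \<in> {\<lambda>y. T (g y) | g. smooth_on_c n D g}" and i: "i < n"
  then obtain g where gh: "f = (\<lambda>y. T (g y))" "smooth_on_c n D g" by blast
  then have "\<forall>y\<in>D. has_pd i f (T (pd i g y)) y"
    using has_pd_bounded_linear[OF T smooth_on_c_has_pd[OF gh(2) _ i]] by blast
  then show "\<exists>g'\<in>{\<lambda>y. T (g y) | g. smooth_on_c n D g}. \<forall>y\<in>D. has_pd i f (g' y) y"
    using smooth_on_c_pd[OF gh(2) i]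
    by (intro bexI[of _ "\<lambda>y. T (pd i g y)"]) blast+
qed (use g in \<open>auto intro!: bounded_linear.continuous_on[OF T] intro: smooth_on_c_continuous\<close>)

lemma smooth_on_c_scaleR:
  assumes "copen n D" "smooth_on_c n D g"
  shows "smooth_on_c n D (\<lambda>y. k *\<^sub>R g y)"
  by (rule smooth_on_c_bounded_linear[OF assms bounded_linear_scaleR_right])

text \<open>Differentiating \<open>y j *\<^sub>R g y\<close> along \<open>j\<close> leaves an extra
  \<open>g y\<close>, so the family stable under derivatives consists of all
  \<open>y j *\<^sub>R g y + h y\<close>.\<close>

lemma smooth_on_c_coord_scaleR:
  assumes D: "copen n D" and g: "smooth_on_c n D g" 
  shows "smooth_on_c n D (\<lambda>y. y j *\<^sub>R g y)"
proof -
  define C where "C = {\<lambda>y. y j *\<^sub>R g y + h y | g h :: (nat \<Rightarrow> real) \<Rightarrow> 'a. smooth_on_c n D g \<and> smooth_on_c n D h}"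
  show ?thesis
  proof (rule smooth_on_c_coinduct[where C = C, OF D])
    show "(\<lambda>y. y j *\<^sub>R g y + 0) \<in> C" unfolding C_def mem_Collect_eq using g smooth_on_c_const[OF D, of 0]
      by (intro exI[of _ g] exI[of _ "\<lambda>_. 0"] conjI refl)
  next
    fix f i assume "f \<in> C" and i: "i < n"
    then obtain g h where gh: "f = (\<lambda>y. y j *\<^sub>R g y + h y)" "smooth_on_c n D g" "smooth_on_c n D h" 
      unfolding C_def by blast
    then have 1: "\<forall>y\<in>D. has_pd i f (y j *\<^sub>R pd i g y + (if i = j then g y else 0) + pd i h y) y"
      using has_pd_add[OF has_pd_coord_scaleR[OF smooth_on_c_has_pd[OF gh(2) _ i]] smooth_on_c_has_pd[OF gh(3) _ i], of _ j]
      by blast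
    have "smooth_on_c n D (\<lambda>y. (if i = j then g y else 0) + pd i h y)"
    proof (rule smooth_on_c_add[OF D _ smooth_on_c_pd[OF gh(3) i]])
      show "smooth_on_c n D (\<lambda>y. if i = j then g y else 0)"
        using gh smooth_on_c_const[OF D] by (cases "i = j") auto
    qed
    then have "(\<lambda>y. y j *\<^sub>R pd i g y + ((if i = j then g y else 0) + pd i h y)) \<in> C"
      unfolding C_def mem_Collect_eq using smooth_on_c_pd[OF gh(2) i]
      by (intro exI[of _ "pd i g"] exI[of _ "\<lambda>y. (if i = j then g y else 0) + pd i h y"] conjI refl)
    then show "\<exists>g'\<in>C. \<forall>y\<in>D. has_pd i f (g' y) y"
      by (rule rev_bexI) (use 1 in \<open>simp only: add.assoc\<close>)
  next
    fix f assume "f \<in> C"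
    then obtain g h where "f = (\<lambda>y. y j *\<^sub>R g y + h y)" "smooth_on_c n D g" "smooth_on_c n D h" 
      unfolding C_def by blast
    then show "continuous_on D f" using smooth_on_c_continuous[of n D]
      by (auto intro!: continuous_intros continuous_on_coord)
  qed simp
qed

text \<open>All negative powers of \<open>y j\<close> are taken together: the derivative of
  \<open>y j ^ (-k) g\<close> along \<open>i\<close> is \<open>y j ^ (-k-1)\<close> times the smooth
  function \<open>y j \<partial>\<^sub>i g - k g\<close>, the last term being present only for
  \<open>i = j\<close>.\<close>

lemma smooth_on_c_divide_coord:
  assumes D: "copen n D" and g: "smooth_on_c n D g" and nz: "\<And>y. y \<in> D \<Longrightarrow> y j \<noteq> 0"
  shows "smooth_on_c n D (\<lambda>y. inverse (y j) *\<^sub>R g y)"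
proof -
  define C where "C = {\<lambda>y. inverse (y j) ^ k *\<^sub>R g y | k g :: (nat \<Rightarrow> real) \<Rightarrow> 'a. smooth_on_c n D g}"
  show ?thesis
  proof (rule smooth_on_c_coinduct[where C = C, OF D])
    show "(\<lambda>y. inverse (y j) ^ 1 *\<^sub>R g y) \<in> C" using g unfolding C_def by blast
  next
    fix f i assume "f \<in> C" and i: "i < n"
    then obtain g k where gh: "f = (\<lambda>y. inverse (y j) ^ k *\<^sub>R g y)" "smooth_on_c n D g"
      unfolding C_def by blast
    define g' where "g' = (\<lambda>y. y j *\<^sub>R pd i g y + (if i = j then - real k else 0) *\<^sub>R g y)"
    have g': "smooth_on_c n D g'" unfolding g'_def
      by (rule smooth_on_c_add[OF D smooth_on_c_coord_scaleR[OF D smooth_on_c_pd[OF gh(2) i]]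
            smooth_on_c_scaleR[OF D gh(2)]])
    have "has_pd i f (inverse (y j) ^ Suc k *\<^sub>R g' y) y" if y: "y \<in> D" for y
    proof -
      have "has_pd i (\<lambda>y. inverse (y j) ^ k) (if i = j then - real k * inverse (y j) ^ Suc k else 0) y"
      proof (cases "i = j")
        case True
        have "((\<lambda>s. inverse s ^ k) has_real_derivative - real k * inverse (y j) ^ Suc k) (at (y j))"
        proof (cases k)
          case (Suc q)
          have "((\<lambda>s. inverse s ^ k) has_real_derivative real k * (- (inverse (y j) ^ 2)) * inverse (y j) ^ q) (at (y j))"
            using nz[OF y] Suc DERIV_power[OF DERIV_inverse, of "y j" k UNIV] by (simp add: power2_eq_square mult_ac)
          moreover have "real k * (- (inverse (y j) ^ 2)) * inverse (y j) ^ q = - real k * inverse (y j) ^ Suc k"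
            by (simp add: Suc power2_eq_square algebra_simps)
          ultimately show ?thesis by (simp only:)
        qed simp
        then show ?thesis using True by (simp add: has_pd_def has_real_derivative_iff_has_vector_derivative)
      qed (simp add: has_pd_def)
      from has_pd_scaleR_fun[OF this smooth_on_c_has_pd[OF gh(2) y i]]
      have "has_pd i f (inverse (y j) ^ k *\<^sub>R pd i g y +
          (if i = j then - real k * inverse (y j) ^ Suc k else 0) *\<^sub>R g y) y"
        unfolding gh(1) .
      moreover have "inverse (y j) ^ Suc k * y j = inverse (y j) ^ k" 
        using nz[OF y] by simp
      ultimately show ?thesis
        by (simp add: g'_def scaleR_right_distrib mult.commute del: power_Suc split: if_splits)
    qed
    then have "\<forall>y\<in>D. has_pd i f ((\<lambda>y. inverse (y j) ^ Suc k *\<^sub>R g' y) y) y" by blast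
    moreover have "(\<lambda>y. inverse (y j) ^ Suc k *\<^sub>R g' y) \<in> C" using g' unfolding C_def by blast
    ultimately show "\<exists>g'\<in>C. \<forall>y\<in>D. has_pd i f (g' y) y"
      by (intro bexI[of _ "\<lambda>y. inverse (y j) ^ Suc k *\<^sub>R g' y"])
  next
    fix f assume "f \<in> C"
    then obtain g k where "f = (\<lambda>y. inverse (y j) ^ k *\<^sub>R g y)" "smooth_on_c n D g"
      unfolding C_def by blast
    then show "continuous_on D f" using nz smooth_on_c_continuous[of n D]
      by (auto intro!: continuous_intros continuous_on_coord)
  qed simp
qed

section \<open>Hadamard division by a coordinate\<close>

lemma continuous_on_radial:
  fixes h :: "(nat \<Rightarrow> real) \<Rightarrow> 'a::real_normed_vector" 
    and \<phi> :: "'b::topological_space \<Rightarrow> nat \<Rightarrow> real"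
  assumes star: "\<forall>y\<in>D. \<forall>s\<in>{0..1}. y(i := s * y i) \<in> D"
    and \<phi>: "continuous_on S \<phi>" "\<phi> ` S \<subseteq> D" and h: "continuous_on D h"
  shows "continuous_on (S \<times> cbox 0 1) (\<lambda>(x, s::real). s ^ k *\<^sub>R h ((\<phi> x)(i := s * \<phi> x i)))"
proof -
  have co: "continuous_on (S \<times> {0..1::real}) (\<lambda>x. \<phi> (fst x) j)" for j
    by (rule continuous_on_compose2[OF continuous_on_product_then_coordinatewise[OF \<phi>(1), of j]
          continuous_on_fst[OF continuous_on_id]]) auto
  have "continuous_on (S \<times> cbox 0 1) (\<lambda>x. (\<phi> (fst x))(i := snd x * \<phi> (fst x) i))"
  proof (rule continuous_on_coordinatewise_then_product)
    fix j show "continuous_on (S \<times> cbox 0 1) (\<lambda>x. ((\<phi> (fst x))(i := snd x * \<phi> (fst x) i)) j)"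
      by (cases "j = i") (auto intro!: continuous_intros co)
  qed
  moreover have "(\<lambda>x. (\<phi> (fst x))(i := snd x * \<phi> (fst x) i)) ` (S \<times> cbox 0 1) \<subseteq> D"
    using \<phi>(2) star by auto
  ultimately have "continuous_on (S \<times> cbox 0 1) (\<lambda>x. h ((\<phi> (fst x))(i := snd x * \<phi> (fst x) i)))"
    using continuous_on_compose2[OF h] by blast
  then show ?thesis unfolding split_def by (intro continuous_intros) auto
qed

text \<open>Hadamard's division lemma: an odd smooth function is, near \<open>y i = 0\<close>, \<open>y i\<close> times an
  integral mean of its \<open>i\<close>-th partial derivative. The weighted means
  \<open>\<integral> s^k g(y(i := s y_i)) ds\<close> form a class closed under partial derivatives.\<close>

lemma smooth_on_c_radial_mean:
  fixes g :: "(nat \<Rightarrow> real) \<Rightarrow> 'a::euclidean_space"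
  assumes D: "copen n D" and g: "smooth_on_c n D g" and i: "i < n"
    and star: "\<And>y s. y \<in> D \<Longrightarrow> 0 \<le> s \<Longrightarrow> s \<le> 1 \<Longrightarrow> y(i := s * y i) \<in> D"
  shows "smooth_on_c n D (\<lambda>y. integral {0..1} (\<lambda>s. g (y(i := s * y i))))"
proof -
  define A where "A k g y = integral (cbox 0 1) (\<lambda>s::real. s ^ k *\<^sub>R g (y(i := s * y i)))" 
    for k and g :: "(nat \<Rightarrow> real) \<Rightarrow> 'a" and y
  define C where "C = {A k g | k g. smooth_on_c n D g}"
  have star': "\<forall>y\<in>D. \<forall>s\<in>{0..1}. y(i := s * y i) \<in> D" using star by simp
  note cont_arg = continuous_on_radial[OF star']
  show ?thesis
  proof (rule smooth_on_c_coinduct[where C = C, OF D])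
    show "A 0 g \<in> C" using g unfolding C_def by blast
    show "integral {0..1} (\<lambda>s. g (y(i := s * y i))) = A 0 g y" for y
      by (simp add: A_def)
  next
    fix f assume "f \<in> C"
    then obtain k h where f: "f = A k h" "smooth_on_c n D h" unfolding C_def by blast
    show "continuous_on D f" unfolding f(1) A_def
      by (rule integral_continuous_on_param, rule cont_arg[where \<phi> = "\<lambda>x. x"]) 
         (use smooth_on_c_continuous[OF f(2)] in auto)
  next
    fix f j assume "f \<in> C" and j: "j < n"
    then obtain k h where f: "f = A k h" "smooth_on_c n D h" unfolding C_def by blast
    \<comment> \<open>The inner derivative of \<open>s * y i\<close> along \<open>i\<close> is
      \<open>s\<close>, which raises the weight by one; along any other coordinate the weight is
      unchanged.\<close>
    define k' where "k' = (if j = i then Suc k else k)"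
    have "has_pd j f (A k' (pd j h) y) y" if y: "y \<in> D" for y
    proof -
      obtain r where r: "r > 0" "cnb n y r \<subseteq> D" using D y by (auto simp: copen_def)
      define U where "U = ball (y j) r"
      have U: "y(j := x) \<in> D" if "x \<in> U" for x
      proof -
        have "y(j := x) \<in> cnb n y r" using that r y D j
          by (auto simp: cnb_def U_def dist_real_def cspace_upd copen_def)
        then show ?thesis using r by blast
      qed
      have cont: "continuous_on U (\<lambda>x. y(j := x))" 
      proof (rule continuous_on_coordinatewise_then_product)
        fix l show "continuous_on U (\<lambda>x. (y(j := x)) l)"
          by (cases "l = j") (auto intro!: continuous_intros)
      qed
      have "((\<lambda>x. integral (cbox 0 1) (\<lambda>s. s ^ k *\<^sub>R h ((y(j := x))(i := s * (y(j := x)) i))))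
          has_vector_derivative 
          integral (cbox 0 1) (\<lambda>s. s ^ k' *\<^sub>R pd j h ((y(j := y j))(i := s * (y(j := y j)) i)))) (at (y j) within U)"
      proof (rule leibniz_rule_vector_derivative)
        show "y j \<in> U" "convex U" using r by (auto simp: U_def)
        show "continuous_on (U \<times> cbox 0 1) (\<lambda>(x, s). s ^ k' *\<^sub>R pd j h ((y(j := x))(i := s * (y(j := x)) i)))"
          by (rule cont_arg[OF cont]) (use U smooth_on_c_continuous[OF smooth_on_c_pd[OF f(2) j]] in auto)
        have "continuous_on (U \<times> cbox 0 1) (\<lambda>(x, s). s ^ k *\<^sub>R h ((y(j := x))(i := s * (y(j := x)) i)))"
          by (rule cont_arg[OF cont]) (use U smooth_on_c_continuous[OF f(2)] in auto)
        note 1 = continuous_on_compose2[OF this]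
        show "(\<lambda>s. s ^ k *\<^sub>R h ((y(j := x))(i := s * (y(j := x)) i))) integrable_on cbox 0 1" if "x \<in> U" for x
        proof (rule integrable_continuous)
          have "continuous_on (cbox 0 1) (\<lambda>s::real. (x, s))" by (intro continuous_intros)
          from 1[OF this] 
          have "continuous_on (cbox 0 1) (\<lambda>s. case (x, s) of (x, s) \<Rightarrow> s ^ k *\<^sub>R h ((y(j := x))(i := s * (y(j := x)) i)))"
            using that by blast
          then show "continuous_on (cbox 0 1) (\<lambda>s. s ^ k *\<^sub>R h ((y(j := x))(i := s * (y(j := x)) i)))"
            unfolding prod.case .
        qed
        fix x and s :: real assume x: "x \<in> U" and s: "s \<in> cbox 0 1"
        define z where "z = (y(j := x))(i := s * (y(j := x)) i)"
        have z: "z \<in> D" unfolding z_def by (rule star) (use U x s in auto)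
        have pd: "((\<lambda>q. h (z(j := q))) has_vector_derivative pd j h z) (at (z j))"
          using smooth_on_c_has_pd[OF f(2) z j] by (simp add: has_pd_def)
        have "((\<lambda>x. h ((y(j := x))(i := s * (y(j := x)) i))) has_vector_derivative (if j = i then s else 1) *\<^sub>R pd j h z) (at x)"
        proof (cases "j = i")
          case True
          have "((\<lambda>x. s * x) has_vector_derivative s) (at x)" by (auto intro!: derivative_eq_intros)
          from vector_diff_chain_at[OF this, of "\<lambda>q. h (z(j := q))" "pd j h z"] pd
          show ?thesis using True by (simp add: z_def o_def)
        next
          case False
          have "(\<lambda>x. h ((y(j := x))(i := s * (y(j := x)) i))) = (\<lambda>q. h (z(j := q)))"
            using False by (auto simp: z_def fun_upd_twist)
          moreover have "z j = x" using False by (simp add: z_def)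
          ultimately show ?thesis using pd False by simp
        qed
        then have "((\<lambda>x. s ^ k *\<^sub>R h ((y(j := x))(i := s * (y(j := x)) i))) has_vector_derivative s ^ k *\<^sub>R ((if j = i then s else 1) *\<^sub>R pd j h z)) (at x)"
          by (rule bounded_linear.has_vector_derivative[OF bounded_linear_scaleR_right])
        then have "((\<lambda>x. s ^ k *\<^sub>R h ((y(j := x))(i := s * (y(j := x)) i))) has_vector_derivative s ^ k' *\<^sub>R pd j h z) (at x within U)"
          by (simp add: k'_def has_vector_derivative_at_within mult.commute split: if_splits)
        then show "((\<lambda>x. s ^ k *\<^sub>R h ((y(j := x))(i := s * (y(j := x)) i))) has_vector_derivative
            s ^ k' *\<^sub>R pd j h ((y(j := x))(i := s * (y(j := x)) i))) (at x within U)"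
          unfolding z_def .
      qed
      moreover have "at (y j) within U = at (y j)" using r by (intro at_within_open) (auto simp: U_def)
      ultimately show ?thesis by (simp add: has_pd_def f(1) A_def)
    qed
    moreover have "A k' (pd j h) \<in> C" using f j smooth_on_c_pd unfolding C_def by blast
    ultimately show "\<exists>g'\<in>C. \<forall>y\<in>D. has_pd j f (g' y) y" by (intro bexI[of _ "A k' (pd j h)"] ballI)
  qed
qed

text \<open>The quotient of G by the coordinate \<open>y i\<close>, filled in by its limit when G
  vanishes on the hyperplane \<open>y i = 0\<close>.\<close>

definition qdiv :: "nat \<Rightarrow> ((nat \<Rightarrow> real) \<Rightarrow> 'a::real_normed_vector) \<Rightarrow> (nat \<Rightarrow> real) \<Rightarrow> 'a" where
  "qdiv i G y = (if y i = 0 then pd i G y else inverse (y i) *\<^sub>R G y)"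

text \<open>Away from the hyperplane this is division by a nonzero coordinate. A cube centred on the
  hyperplane is star-shaped in direction \<open>i\<close>, so there the quotient is the mean of
  \<open>pd i G\<close> over the segment from \<open>y(i := 0)\<close> to \<open>y\<close>.\<close>

lemma smooth_on_c_qdiv:
  fixes G :: "(nat \<Rightarrow> real) \<Rightarrow> 'a::euclidean_space"
  assumes D: "copen n D" and G: "smooth_on_c n D G" and i: "i < n"
    and zero: "\<And>y. y \<in> D \<Longrightarrow> y i = 0 \<Longrightarrow> G y = 0"
  shows "smooth_on_c n D (qdiv i G)"
proof (rule smooth_on_c_local[OF D])
  fix c assume c: "c \<in> D"
  then obtain r where r: "r > 0" "cnb n c r \<subseteq> D" using D by (auto simp: copen_def)
  show "\<exists>U. c \<in> U \<and> U \<subseteq> D \<and> copen n U \<and> smooth_on_c n U (qdiv i G)"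
  proof (cases "c i = 0")
    case False
    \<comment> \<open>The bound by \<open>\<bar>c i\<bar>\<close> keeps the cube off the
      hyperplane.\<close>
    define U where "U = cnb n c (min r \<bar>c i\<bar>)"
    have U: "copen n U" unfolding U_def by (rule copen_cnb)
    moreover have "U \<subseteq> D" "c \<in> U" using r c D False by (auto simp: U_def cnb_def copen_def[of n D])
    ultimately have U: "copen n U" "U \<subseteq> D" "c \<in> U" by auto
    have nz: "y i \<noteq> 0" if "y \<in> U" for y using that i by (auto simp: U_def cnb_def)
    have "smooth_on_c n U (qdiv i G)"
      by (rule smooth_on_c_cong[OF U(1) _ smooth_on_c_divide_coord[OF U(1) smooth_on_c_subset[OF G U(2)] nz]])
         (auto simp: qdiv_def nz)
    then show ?thesis using U by blast
  next
    case True
    define U where "U = cnb n c r"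
    have U: "copen n U" "U \<subseteq> D" "c \<in> U"
      using r c D copen_cnb self_in_cnb by (auto simp: U_def copen_def)
    have star: "y(i := s * y i) \<in> U" if "y \<in> U" "0 \<le> s" "s \<le> 1" for y s
    proof -
      have "\<bar>s * y i\<bar> \<le> 1 * \<bar>y i\<bar>" using that unfolding abs_mult by (intro mult_right_mono) auto
      also have "\<dots> < r" using that i True by (auto simp: U_def cnb_def)
      finally have "\<bar>s * y i\<bar> < r" .
      then show ?thesis using that i True by (auto simp: U_def cnb_def cspace_upd)
    qed
    have "qdiv i G y = integral {0..1} (\<lambda>s. pd i G (y(i := s * y i)))" if y: "y \<in> U" for y
    proof (cases "y i = 0")
      case True
      then have "y(i := s * y i) = y" for s by (auto simp: fun_eq_iff)
      then show ?thesis using True by (simp add: qdiv_def)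
    next
      case False
      have "((\<lambda>s. G (y(i := s * y i))) has_vector_derivative y i *\<^sub>R pd i G (y(i := s * y i))) (at s within {0..1})"
        if s: "s \<in> {0..1}" for s
      proof -
        define z where "z = y(i := s * y i)"
        have "z \<in> D" using star[OF y, of s] U s by (auto simp: z_def)
        from smooth_on_c_has_pd[OF G this i] 
        have "((\<lambda>q. G (y(i := q))) has_vector_derivative pd i G z) (at (s * y i))"
          by (simp add: has_pd_def z_def)
        moreover have "((\<lambda>s. s * y i) has_vector_derivative y i) (at s)" 
          by (auto intro!: derivative_eq_intros)
        ultimately show ?thesis
          using vector_diff_chain_at[of "\<lambda>s. s * y i" "y i" s "\<lambda>q. G (y(i := q))" "pd i G z"]
          by (simp add: z_def o_def has_vector_derivative_at_within)
      qed
      from fundamental_theorem_of_calculus[of 0 1, OF _ this]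
      have "((\<lambda>s. y i *\<^sub>R pd i G (y(i := s * y i))) has_integral G (y(i := 1 * y i)) - G (y(i := 0 * y i))) {0..1}"
        by auto
      moreover have "G (y(i := 0)) = 0" using star[OF y, of 0] U by (intro zero) auto
      ultimately have "((\<lambda>s. y i *\<^sub>R pd i G (y(i := s * y i))) has_integral G y) {0..1}" by simp
      from has_integral_cmul[OF this, of "inverse (y i)"] False
      show ?thesis by (simp add: qdiv_def integral_unique)
    qed
    then have "smooth_on_c n U (qdiv i G)"
      by (rule smooth_on_c_cong[OF U(1) _ smooth_on_c_radial_mean[OF U(1) smooth_on_c_subset[OF smooth_on_c_pd[OF G i] U(2)] i star]])
    then show ?thesis using U by blast
  qed
qed

section \<open>Power series in finitely many variables\<close>

definition midx :: "nat \<Rightarrow> (nat \<Rightarrow> nat) set" where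
  "midx n = {m. \<forall>i\<ge>n. m i = 0}"

definition mon :: "nat \<Rightarrow> (nat \<Rightarrow> real) \<Rightarrow> (nat \<Rightarrow> nat) \<Rightarrow> real" where
  "mon n x m = (\<Prod>i<n. x i ^ m i)"

text \<open>Closed boxes, in contrast to \<open>cnb\<close>: finiteness of the weighted norm at
  radius r gives absolute convergence up to and including the boundary.\<close>

definition cbx :: "nat \<Rightarrow> (nat \<Rightarrow> real) \<Rightarrow> real \<Rightarrow> (nat \<Rightarrow> real) set" where
  "cbx n c r = {z \<in> cspace n. \<forall>i<n. \<bar>z i - c i\<bar> \<le> r}"

abbreviation pseries :: "nat \<Rightarrow> (nat \<Rightarrow> real) \<Rightarrow> ((nat \<Rightarrow> nat) \<Rightarrow> 'a::real_normed_vector) \<Rightarrow> (nat \<Rightarrow> real) \<Rightarrow> 'a \<Rightarrow> bool" where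
  "pseries n c a y s \<equiv> ((\<lambda>m. mon n (\<lambda>i. y i - c i) m *\<^sub>R a m) has_sum s) (midx n)"

abbreviation wnorm :: "nat \<Rightarrow> real \<Rightarrow> ((nat \<Rightarrow> nat) \<Rightarrow> 'a::real_normed_vector) \<Rightarrow> real \<Rightarrow> bool" where
  "wnorm n r a S \<equiv> ((\<lambda>m. mon n (\<lambda>_. r) m * norm (a m)) has_sum S) (midx n)"

text \<open>\<open>psb n c r G B\<close>: on the closed box of radius \<open>r\<close> around \<open>c\<close>, \<open>G\<close> is the sum of a power series
  whose weighted \<open>\<ell>\<^sup>1\<close> norm \<open>\<Sum>\<^sub>m \<parallel>a\<^sub>m\<parallel> r^|m|\<close> is at most \<open>B\<close>. These series form a Banach algebra,
  so that the norm estimates below replace all manipulations of coefficients.\<close>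

definition psb :: "nat \<Rightarrow> (nat \<Rightarrow> real) \<Rightarrow> real \<Rightarrow> ((nat \<Rightarrow> real) \<Rightarrow> 'a::real_normed_vector) \<Rightarrow> real \<Rightarrow> bool" where
  "psb n c r G B \<longleftrightarrow> 0 < r \<and> (\<exists>a S. wnorm n r a S \<and> S \<le> B
     \<and> (\<forall>y\<in>cbx n c r. pseries n c a y (G y)))"

lemma mon_pos: "0 < r \<Longrightarrow> 0 < mon n (\<lambda>_. r) m"
  unfolding mon_def by (intro prod_pos) auto

lemma mon_nonneg: "0 \<le> r \<Longrightarrow> 0 \<le> mon n (\<lambda>_. r) m"
  unfolding mon_def by (intro prod_nonneg) auto

lemma mon_const: "mon n (\<lambda>_. r) m = r ^ (\<Sum>i<n. m i)"
  by (simp add: mon_def power_sum)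

lemma abs_mon_le:
  assumes "\<And>i. i < n \<Longrightarrow> \<bar>x i\<bar> \<le> r"
  shows "\<bar>mon n x m\<bar> \<le> mon n (\<lambda>_. r) m"
  unfolding mon_def abs_prod power_abs
  using assms by (intro prod_mono) (auto intro!: power_mono)

lemma abs_mon_cbx: "y \<in> cbx n c r \<Longrightarrow> \<bar>mon n (\<lambda>i. y i - c i) m\<bar> \<le> mon n (\<lambda>_. r) m"
  by (rule abs_mon_le) (auto simp: cbx_def)

lemma mon_split:
  assumes "i < n"
  shows "mon n x m = x i ^ m i * (\<Prod>j\<in>{..<n} - {i}. x j ^ m j)"
  unfolding mon_def using assms by (subst prod.remove[of _ i]) auto

lemma mon_upd:
  assumes "i < n"
  shows "mon n x (m(i := k)) = x i ^ k * (\<Prod>j\<in>{..<n} - {i}. x j ^ m j)"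
  unfolding mon_split[OF assms, of x "m(i := k)"] by (auto intro!: arg_cong2[where f="(*)"] prod.cong)

lemma cbx_mono: "r' \<le> r \<Longrightarrow> cbx n c r' \<subseteq> cbx n c r"
  by (fastforce simp: cbx_def)

lemma psbE:
  assumes "psb n c r G B"
  obtains a S where "0 < r" "wnorm n r a S" "S \<le> B"
    "\<forall>y\<in>cbx n c r. pseries n c a y (G y)"
proof -
  from assms have "0 < r" and "\<exists>a S. wnorm n r a S \<and> S \<le> B
     \<and> (\<forall>y\<in>cbx n c r. pseries n c a y (G y))"
    unfolding psb_def by simp_all
  then show thesis using that by (elim exE conjE) simp
qed

lemma psbI:
  assumes "0 < r" "wnorm n r a S" "S \<le> B"
    "\<And>y. y \<in> cbx n c r \<Longrightarrow> pseries n c a y (G y)"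
  shows "psb n c r G B"
  unfolding psb_def using assms by (intro conjI exI[of _ a] exI[of _ S]) auto

lemma psb_pos: "psb n c r G B \<Longrightarrow> 0 < r"
  by (simp add: psb_def)

lemma psb_mono: "psb n c r G B \<Longrightarrow> B \<le> B' \<Longrightarrow> psb n c r G B'"
  unfolding psb_def by (meson order_trans)

lemma psb_cong:
  assumes "psb n c r G B" "\<And>y. y \<in> cbx n c r \<Longrightarrow> G' y = G y"
  shows "psb n c r G' B"
  using assms unfolding psb_def by metis

lemma psb_norm_le:
  assumes "psb n c r G B" "y \<in> cbx n c r"
  shows "norm (G y) \<le> B"
proof -
  obtain a S where a: "0 < r" "wnorm n r a S" "S \<le> B"
    "\<forall>y\<in>cbx n c r. pseries n c a y (G y)"
    using psbE[OF assms(1)] .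
  have "norm (G y) \<le> S"
    by (rule norm_infsum_le[OF a(4)[THEN bspec, OF assms(2)] a(2)])
       (use abs_mon_cbx[OF assms(2)] in \<open>auto intro!: mult_right_mono\<close>)
  then show ?thesis using a by simp
qed

lemma psb_bound_nonneg:
  assumes "psb n c r G B"
  shows "0 \<le> B"
proof -
  obtain a S where a: "0 < r" "wnorm n r a S" "S \<le> B"
    "\<forall>y\<in>cbx n c r. pseries n c a y (G y)"
    using psbE[OF assms] .
  have "0 \<le> S" using a(1) by (intro has_sum_nonneg[OF a(2)]) (auto simp: mon_nonneg)
  then show ?thesis using a by simp
qed

text \<open>Completeness of the algebra of series: if the norms are summable, the series may be
  added coefficient by coefficient. This is the Fubini theorem for an absolutely summable family
  over pairs (series, multi-index), applied once to the weighted norms and once to the values at a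
  point.\<close>

lemma psb_sum_family:
  fixes G :: "'b \<Rightarrow> (nat \<Rightarrow> real) \<Rightarrow> 'a::banach"
  assumes r: "0 < r" and G: "\<And>k. k \<in> I \<Longrightarrow> psb n c r (G k) (B k)"
    and B: "(B has_sum S) I"
    and H: "\<And>y. y \<in> cbx n c r \<Longrightarrow> ((\<lambda>k. G k y) has_sum H y) I"
  shows "psb n c r H S"
proof -
  define W where "W = mon n (\<lambda>_. r)"
  have W: "W m > 0" for m using r by (simp add: W_def mon_pos)
  obtain a s where a: "\<And>k. k \<in> I \<Longrightarrow> ((\<lambda>m. W m * norm (a k m)) has_sum s k) (midx n)"
      "\<And>k. k \<in> I \<Longrightarrow> s k \<le> B k"
      "\<And>k y. k \<in> I \<Longrightarrow> y \<in> cbx n c r \<Longrightarrow> ((\<lambda>m. mon n (\<lambda>i. y i - c i) m *\<^sub>R a k m) has_sum G k y) (midx n)"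
  proof -
    have "\<forall>k. \<exists>p. k \<in> I \<longrightarrow> ((\<lambda>m. W m * norm (fst p m)) has_sum snd p) (midx n) \<and> snd p \<le> B k \<and>
      (\<forall>y\<in>cbx n c r. ((\<lambda>m. mon n (\<lambda>i. y i - c i) m *\<^sub>R fst p m) has_sum G k y) (midx n))"
    proof (intro allI)
      fix k
      show "\<exists>p. k \<in> I \<longrightarrow> ((\<lambda>m. W m * norm (fst p m)) has_sum snd p) (midx n) \<and> snd p \<le> B k \<and>
        (\<forall>y\<in>cbx n c r. ((\<lambda>m. mon n (\<lambda>i. y i - c i) m *\<^sub>R fst p m) has_sum G k y) (midx n))"
      proof (cases "k \<in> I")
        case True
        obtain a S where "0 < r" "((\<lambda>m. W m * norm (a m)) has_sum S) (midx n)" "S \<le> B k"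
          "\<forall>y\<in>cbx n c r. pseries n c a y (G k y)"
          unfolding W_def using psbE[OF G[OF True]] .
        then show ?thesis by (intro exI[of _ "(a, S)"]) auto
      qed simp
    qed
    from choice[OF this] obtain p where p: "\<forall>k. k \<in> I \<longrightarrow> ((\<lambda>m. W m * norm (fst (p k) m)) has_sum snd (p k)) (midx n) \<and> snd (p k) \<le> B k \<and>
      (\<forall>y\<in>cbx n c r. ((\<lambda>m. mon n (\<lambda>i. y i - c i) m *\<^sub>R fst (p k) m) has_sum G k y) (midx n))" ..
    show thesis by (rule that[of "\<lambda>k. fst (p k)" "\<lambda>k. snd (p k)"]) (use p in auto)
  qed
  \<comment> \<open>The weighted family whose absolute sum V over all pairs is computed in both
    orders: by rows it is at most S, by columns it bounds the norm of the coefficients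
    \<open>b\<close>.\<close>
  define f where "f = (\<lambda>(k, m). W m *\<^sub>R a k m)"
  have nf: "norm (f (k, m)) = W m * norm (a k m)" for k m using W[of m] by (simp add: f_def)
  have s0: "0 \<le> s k" if "k \<in> I" for k
    using W by (intro has_sum_nonneg[OF a(1)[OF that]]) (simp add: less_imp_le)
  have sk: "infsum (\<lambda>m. W m * norm (a k m)) (midx n) = s k" if "k \<in> I" for k
    by (rule infsumI[OF a(1)[OF that]])
  have f_abs: "(\<lambda>x. norm (f x)) summable_on I \<times> midx n"
  proof (rule Infinite_Sum.abs_summable_on_Sigma_iff[THEN iffD2], unfold nf, intro conjI ballI)
    fix k assume "k \<in> I" then show "(\<lambda>m. W m * norm (a k m)) summable_on midx n"
      by (rule has_sum_imp_summable[OF a(1)])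
  next
    have "(\<lambda>k. infsum (\<lambda>m. W m * norm (a k m)) (midx n)) summable_on I"
      by (rule summable_on_comparison_test[OF has_sum_imp_summable[OF B]])
         (simp_all add: sk s0 a(2))
    then show "(\<lambda>k. norm (infsum (\<lambda>m. W m * norm (a k m)) (midx n))) summable_on I"
      by (rule summable_on_iff_abs_summable_on_real[THEN iffD1])
  qed
  define f' where "f' = (\<lambda>(m, k). f (k, m))"
  have nf': "norm (f' (m, k)) = W m * norm (a k m)" for k m by (simp add: f'_def nf)
  have f'_abs: "(\<lambda>x. norm (f' x)) summable_on midx n \<times> I"
    using summable_on_swap[THEN iffD1, OF f_abs] by (simp add: f'_def split_def)
  have a_abs: "(\<lambda>k. norm (a k m)) summable_on I" if "m \<in> midx n" for m
  proof -
    have "(\<lambda>k. W m * norm (a k m)) summable_on I"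
      using f'_abs that unfolding Infinite_Sum.abs_summable_on_Sigma_iff nf' by blast
    then show ?thesis using W[of m] by (simp add: summable_on_cmult_right')
  qed
  define b where "b m = infsum (\<lambda>k. a k m) I" for m
  have b: "((\<lambda>k. a k m) has_sum b m) I" if "m \<in> midx n" for m
    unfolding b_def using abs_summable_summable[OF a_abs[OF that]] by simp
  define u where "u m = infsum (\<lambda>k. W m * norm (a k m)) I" for m
  have u: "((\<lambda>k. W m * norm (a k m)) has_sum u m) I" if "m \<in> midx n" for m
    unfolding u_def using f'_abs that unfolding Infinite_Sum.abs_summable_on_Sigma_iff nf' by simp
  obtain V where V: "((\<lambda>x. norm (f x)) has_sum V) (I \<times> midx n)"
    using f_abs by (auto simp: summable_on_def)
  have "(s has_sum V) I"
    by (rule has_sum_SigmaD[OF V]) (simp add: nf a(1))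
  then have VS: "V \<le> S" by (rule has_sum_mono[OF _ B a(2)])
  have "((\<lambda>x. norm (f' x)) has_sum V) (midx n \<times> I)"
    using has_sum_swap[THEN iffD1, OF V] by (simp add: f'_def split_def)
  then have uV: "(u has_sum V) (midx n)"
    by (rule has_sum_SigmaD) (simp add: nf' u)
  have Wb: "W m * norm (b m) \<le> u m" if "m \<in> midx n" for m
  proof -
    have "norm (W m *\<^sub>R b m) \<le> u m"
      by (rule norm_infsum_le[OF has_sum_scaleR[OF b[OF that]] u[OF that]]) (use W[of m] in simp)
    then show ?thesis using W[of m] by simp
  qed
  have sb: "(\<lambda>m. W m * norm (b m)) summable_on midx n"
    by (rule summable_on_comparison_test[OF has_sum_imp_summable[OF uV] Wb]) 
       (auto intro!: mult_nonneg_nonneg less_imp_le[OF W])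
  have "infsum (\<lambda>m. W m * norm (b m)) (midx n) \<le> V"
    by (rule has_sum_mono[OF has_sum_infsum[OF sb] uV Wb])
  moreover have "pseries n c b y (H y)" if y: "y \<in> cbx n c r" for y
  proof -
    \<comment> \<open>The terms of all series at the point y; on the box they are dominated by
      \<open>f\<close>.\<close>
    define h where "h = (\<lambda>(k, m). mon n (\<lambda>i. y i - c i) m *\<^sub>R a k m)"
    have "norm (h x) \<le> norm (f x)" for x
      using abs_mon_cbx[OF y, of "snd x"] W[of "snd x"]
      by (auto simp: h_def f_def split_def W_def intro!: mult_right_mono)
    then have "(\<lambda>x. norm (h x)) summable_on I \<times> midx n" by (intro Infinite_Sum.abs_summable_on_comparison_test[OF f_abs])
    then have "h summable_on I \<times> midx n" by (rule abs_summable_summable)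
    then obtain T where T: "(h has_sum T) (I \<times> midx n)" by (auto simp: summable_on_def)
    have "((\<lambda>k. G k y) has_sum T) I"
      by (rule has_sum_SigmaD[OF T]) (simp add: h_def a(3) y)
    with H[OF y] have TH: "T = H y" by (rule has_sum_unique[rotated])
    have "((\<lambda>(m, k). h (k, m)) has_sum T) (midx n \<times> I)"
      using has_sum_swap[THEN iffD1, OF T] .
    then have "pseries n c b y T"
      by (rule has_sum_SigmaD) (simp add: h_def has_sum_scaleR b)
    then show ?thesis by (simp add: TH)
  qed
  ultimately show ?thesis
    using r VS by (intro psbI[OF r has_sum_infsum[OF sb, unfolded W_def]]) (auto simp: W_def)
qed

text \<open>For families whose pointwise sum is not known beforehand; the norms bound the values on
  the box and so yield pointwise summability.\<close>

lemma psb_sum_family':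
  fixes G :: "'b \<Rightarrow> (nat \<Rightarrow> real) \<Rightarrow> 'a::banach"
  assumes r: "0 < r" and G: "\<And>k. k \<in> I \<Longrightarrow> psb n c r (G k) (B k)"
    and B: "(B has_sum S) I"
  shows "psb n c r (\<lambda>y. infsum (\<lambda>k. G k y) I) S"
    and "\<And>y. y \<in> cbx n c r \<Longrightarrow> ((\<lambda>k. G k y) has_sum infsum (\<lambda>k. G k y) I) I"
proof -
  show *: "((\<lambda>k. G k y) has_sum infsum (\<lambda>k. G k y) I) I" if "y \<in> cbx n c r" for y
  proof -
    have "(\<lambda>k. norm (G k y)) summable_on I"
      by (rule summable_on_comparison_test[OF has_sum_imp_summable[OF B]])
         (use psb_norm_le[OF G that] in auto)
    then show ?thesis by (rule has_sum_infsum[OF abs_summable_summable])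
  qed
  show "psb n c r (\<lambda>y. infsum (\<lambda>k. G k y) I) S"
    by (rule psb_sum_family[OF r G B *])
qed

section \<open>Algebraic operations on power series\<close>

lemma zero_in_midx: "(\<lambda>_. 0) \<in> midx n"
  by (simp add: midx_def)

lemma psb_const:
  assumes "0 < r"
  shows "psb n c r (\<lambda>_. k) (norm k)"
proof -
  define a where "a = (\<lambda>m::nat \<Rightarrow> nat. if m = (\<lambda>_. 0) then k else 0)"
  have "wnorm n r a (norm k)"
    by (rule has_sum_finite_neutralI[of "{\<lambda>_. 0}"]) (auto simp: a_def zero_in_midx mon_def)
  moreover have "pseries n c a y k" for y
    by (rule has_sum_finite_neutralI[of "{\<lambda>_. 0}"]) (auto simp: a_def zero_in_midx mon_def)
  ultimately show ?thesis using assms by (intro psbI[of r n a]) auto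
qed

text \<open>Multiplication by \<open>y i - c i\<close> shifts the coefficients along
  \<open>\<phi>\<close>, which raises the exponent of coordinate \<open>i\<close>. The new
  coefficients vanish outside the image of \<open>\<phi>\<close>, so reindexing suffices.\<close>

lemma psb_coord_scaleR:
  assumes G: "psb n c r G B" and i: "i < n"
  shows "psb n c r (\<lambda>y. (y i - c i) *\<^sub>R G y) (r * B)"
proof -
  obtain a S where a: "0 < r" "wnorm n r a S" "S \<le> B"
    "\<forall>y\<in>cbx n c r. pseries n c a y (G y)"
    using psbE[OF G] .
  define \<phi> where "\<phi> = (\<lambda>m::nat \<Rightarrow> nat. m(i := Suc (m i)))"
  define b where "b m = (if m i = 0 then 0 else a (m(i := m i - 1)))" for m
  have inj: "inj_on \<phi> (midx n)"
  proof (rule inj_onI)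
    fix m m' assume e: "\<phi> m = \<phi> m'"
    then have "(\<phi> m)(i := \<phi> m i - 1) = (\<phi> m')(i := \<phi> m' i - 1)" by simp
    then show "m = m'" by (simp add: \<phi>_def)
  qed
  have sub: "\<phi> ` midx n \<subseteq> midx n" using i by (auto simp: \<phi>_def midx_def)
  have off: "b m = 0" if "m \<in> midx n - \<phi> ` midx n" for m
  proof (rule ccontr)
    assume "b m \<noteq> 0"
    then have "m i \<noteq> 0" by (metis b_def)
    then have "m = \<phi> (m(i := m i - 1))" by (auto simp: \<phi>_def)
    moreover have "m(i := m i - 1) \<in> midx n" using that i by (auto simp: midx_def)
    ultimately show False using that by blast
  qed
  have b\<phi>: "b (\<phi> m) = a m" for m by (simp add: b_def \<phi>_def)
  have mon\<phi>: "mon n x (\<phi> m) = x i * mon n x m" for x m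
    unfolding \<phi>_def mon_upd[OF i] mon_split[OF i, of x m] by simp
  have off': "mon n x m * norm (b m) = 0" "mon n x m *\<^sub>R b m = 0" if "m \<in> midx n - \<phi> ` midx n" for m x
    using off[OF that] by auto
  have 1: "wnorm n r b (r * S)"
  proof -
    have "((\<lambda>m. mon n (\<lambda>_. r) m * norm (b m)) has_sum r * S) (\<phi> ` midx n)"
      using has_sum_cmult_right[OF a(2), of r] 
      by (simp add: has_sum_reindex[OF inj] o_def b\<phi> mon\<phi> mult_ac)
    then show ?thesis
      by (subst has_sum_cong_neutral[of "\<phi> ` midx n" _ "\<lambda>m. mon n (\<lambda>_. r) m * norm (b m)" "\<lambda>m. mon n (\<lambda>_. r) m * norm (b m)"]) (use off' sub in auto)
  qed
  have 2: "pseries n c b y ((y i - c i) *\<^sub>R G y)" 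
    if "y \<in> cbx n c r" for y
  proof -
    have "((\<lambda>m. mon n (\<lambda>i. y i - c i) m *\<^sub>R b m) has_sum (y i - c i) *\<^sub>R G y) (\<phi> ` midx n)"
      using has_sum_scaleR[OF a(4)[THEN bspec, OF that], of "y i - c i"] 
      by (simp add: has_sum_reindex[OF inj] o_def b\<phi> mon\<phi> mult_ac)
    then show ?thesis
      by (subst has_sum_cong_neutral[of "\<phi> ` midx n" _ "\<lambda>m. mon n (\<lambda>i. y i - c i) m *\<^sub>R b m" "\<lambda>m. mon n (\<lambda>i. y i - c i) m *\<^sub>R b m"]) (use off' sub in auto)
  qed
  show ?thesis by (rule psbI[OF a(1) 1 _ 2]) (use a(1,3) in simp)
qed

lemma psb_coord_power_scaleR:
  assumes "psb n c r G B" "i < n"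
  shows "psb n c r (\<lambda>y. (y i - c i) ^ k *\<^sub>R G y) (r ^ k * B)"
proof (induction k)
  case (Suc k)
  from psb_coord_scaleR[OF this assms(2)] show ?case by (simp add: mult_ac)
qed (use assms in simp)

lemma psb_mon_scaleR:
  assumes "psb n c r G B"
  shows "psb n c r (\<lambda>y. mon n (\<lambda>i. y i - c i) k *\<^sub>R G y) (mon n (\<lambda>_. r) k * B)"
proof -
  have "l \<le> n \<Longrightarrow> psb n c r (\<lambda>y. (\<Prod>i<l. (y i - c i) ^ k i) *\<^sub>R G y) ((\<Prod>i<l. r ^ k i) * B)" for l
  proof (induction l)
    case (Suc l)
    then have "psb n c r (\<lambda>y. (\<Prod>i<l. (y i - c i) ^ k i) *\<^sub>R G y) ((\<Prod>i<l. r ^ k i) * B)" "l < n" by auto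
    from psb_coord_power_scaleR[OF this] show ?case by (simp add: mult_ac)
  qed (use assms in simp)
  then show ?thesis by (simp add: mon_def)
qed

lemma psb_bounded_linear:
  assumes G: "psb n c r G B" and T: "bounded_linear T" "\<And>x. norm (T x) \<le> K * norm x" and K: "0 \<le> K"
  shows "psb n c r (\<lambda>y. T (G y)) (K * B)"
proof -
  obtain a S where a: "0 < r" "wnorm n r a S" "S \<le> B"
    "\<forall>y\<in>cbx n c r. pseries n c a y (G y)"
    using psbE[OF G] .
  have le: "mon n (\<lambda>_. r) m * norm (T (a m)) \<le> K * (mon n (\<lambda>_. r) m * norm (a m))" for m
    using mult_left_mono[OF T(2)[of "a m"] mon_nonneg[of r n m]] a(1) by (simp add: mult.left_commute)
  have "(\<lambda>m. mon n (\<lambda>_. r) m * norm (T (a m))) summable_on midx n"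
    by (rule summable_on_comparison_test[OF has_sum_imp_summable[OF has_sum_cmult_right[OF a(2), of K]] le])
       (use a(1) in \<open>auto simp: mon_nonneg\<close>)
  then obtain S' where S': "((\<lambda>m. mon n (\<lambda>_. r) m * norm (T (a m))) has_sum S') (midx n)"
    by (auto simp: summable_on_def)
  have "S' \<le> K * S"
    by (rule has_sum_mono[OF S' has_sum_cmult_right[OF a(2), of K] le])
  then have le': "S' \<le> K * B" using a(3) K by (meson mult_left_mono order_trans)
  show ?thesis
    by (rule psbI[OF a(1) S' le'])
       (use has_sum_bounded_linear[OF T(1) a(4)[THEN bspec]] in \<open>simp add: linear_simps[OF T(1)]\<close>)
qed

lemma psb_scaleR:
  assumes "psb n c r G B"
  shows "psb n c r (\<lambda>y. k *\<^sub>R G y) (\<bar>k\<bar> * B)"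
  by (rule psb_bounded_linear[OF assms bounded_linear_scaleR_right]) auto

lemma psb_sum:
  fixes G :: "'b \<Rightarrow> (nat \<Rightarrow> real) \<Rightarrow> 'a::banach"
  assumes "0 < r" "finite I" "\<And>k. k \<in> I \<Longrightarrow> psb n c r (G k) (B k)"
  shows "psb n c r (\<lambda>y. \<Sum>k\<in>I. G k y) (\<Sum>k\<in>I. B k)"
  by (rule psb_sum_family[of r I n c G B]) (use assms in auto)

lemma psb_add:
  fixes G :: "(nat \<Rightarrow> real) \<Rightarrow> 'a::banach"
  assumes "psb n c r G B" "psb n c r H C"
  shows "psb n c r (\<lambda>y. G y + H y) (B + C)"
  using psb_sum[of r UNIV n c "\<lambda>b. if b then G else H" "\<lambda>b. if b then B else C"] assms psb_pos[OF assms(1)]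
  by (simp add: UNIV_bool add_ac)

text \<open>The product estimate without a convolution of coefficients: expand only
  \<open>\<phi>\<close>, and regard the product as the sum of the series \<open>a m\<close> times a
  monomial times G, whose norms add up to at most the product of the norms.\<close>

lemma psb_scaleR_fun:
  fixes G :: "(nat \<Rightarrow> real) \<Rightarrow> 'a::banach"
  assumes \<phi>: "psb n c r \<phi> C" and G: "psb n c r G B"
  shows "psb n c r (\<lambda>y. \<phi> y *\<^sub>R G y) (C * B)"
proof -
  obtain a S where a: "0 < r" "wnorm n r a S" "S \<le> C"
    "\<forall>y\<in>cbx n c r. pseries n c a y (\<phi> y)"
    using psbE[OF \<phi>] .
  have "psb n c r (\<lambda>y. \<phi> y *\<^sub>R G y) (S * B)"
  proof (rule psb_sum_family[OF a(1)])
    show "psb n c r (\<lambda>y. mon n (\<lambda>i. y i - c i) m *\<^sub>R (a m *\<^sub>R G y)) (mon n (\<lambda>_. r) m * norm (a m) * B)" for m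
      using psb_mon_scaleR[OF psb_scaleR[OF G, of "a m"], of m] by (simp add: mult.assoc)
    show "((\<lambda>m. mon n (\<lambda>_. r) m * norm (a m) * B) has_sum S * B) (midx n)"
      by (rule has_sum_cmult_left[OF a(2)])
    show "((\<lambda>m. mon n (\<lambda>i. y i - c i) m *\<^sub>R (a m *\<^sub>R G y)) has_sum \<phi> y *\<^sub>R G y) (midx n)" if "y \<in> cbx n c r" for y
      using has_sum_bounded_linear[OF bounded_linear_scaleR_left[of "G y"] a(4)[THEN bspec, OF that]] by simp
  qed
  then show ?thesis
    by (rule psb_mono) (use a(3) psb_bound_nonneg[OF G] in \<open>simp add: mult_right_mono\<close>)
qed

lemma psb_power:
  fixes \<phi> :: "(nat \<Rightarrow> real) \<Rightarrow> real"
  assumes "psb n c r \<phi> C"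
  shows "psb n c r (\<lambda>y. \<phi> y ^ k) (C ^ k)"
proof (induction k)
  case 0
  show ?case using psb_const[OF psb_pos[OF assms], of n c "1::real"] by simp
next
  case (Suc k)
  from psb_scaleR_fun[OF assms Suc] show ?case by simp
qed

lemma psb_prod:
  fixes \<phi> :: "'b \<Rightarrow> (nat \<Rightarrow> real) \<Rightarrow> real"
  assumes "finite I" "0 < r" "\<And>k. k \<in> I \<Longrightarrow> psb n c r (\<phi> k) (C k)"
  shows "psb n c r (\<lambda>y. \<Prod>k\<in>I. \<phi> k y) (\<Prod>k\<in>I. C k)"
  using assms(1,3)
proof (induction I rule: finite_induct)
  case empty
  show ?case using psb_const[OF assms(2), of n c "1::real"] by simp
next
  case (insert k I)
  have "psb n c r (\<phi> k) (C k)" "psb n c r (\<lambda>y. \<Prod>k\<in>I. \<phi> k y) (\<Prod>k\<in>I. C k)" using insert by auto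
  from psb_scaleR_fun[OF this] show ?case using insert by simp
qed

lemma psb_coord:
  assumes "0 < r" "i < n"
  shows "psb n c r (\<lambda>y. y i - c i) r"
  using psb_coord_scaleR[OF psb_const[OF assms(1), of n c "1::real"] assms(2)] by simp

section \<open>Change of radius and comparison with analyticity\<close>

lemma psb_shrink:
  assumes G: "psb n c r G B" and r': "0 < r'" "r' \<le> r" 
  shows "psb n c r' G B"
proof -
  obtain a S where a: "0 < r" "wnorm n r a S" "S \<le> B"
    "\<forall>y\<in>cbx n c r. pseries n c a y (G y)"
    using psbE[OF G] .
  have le: "mon n (\<lambda>_. r') m * norm (a m) \<le> mon n (\<lambda>_. r) m * norm (a m)" for m
    unfolding mon_const using r' by (intro mult_right_mono power_mono) auto
  have "(\<lambda>m. mon n (\<lambda>_. r') m * norm (a m)) summable_on midx n"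
    by (rule summable_on_comparison_test[OF has_sum_imp_summable[OF a(2)] le]) (use r' in \<open>auto simp: mon_nonneg\<close>)
  then obtain S' where S': "wnorm n r' a S'"
    by (auto simp: summable_on_def)
  have "S' \<le> S" by (rule has_sum_mono[OF S' a(2) le])
  then show ?thesis
    by (intro psbI[OF r'(1) S']) (use a(3,4) cbx_mono[OF r'(2)] in auto)
qed

lemma mon_zero:
  assumes "m \<in> midx n" "m \<noteq> (\<lambda>_. 0)"
  obtains j where "j < n" "0 < m j"
  using assms by (auto simp: midx_def fun_eq_iff) (metis not_le gr0I)

text \<open>A series vanishing at its centre has no constant term. Every remaining monomial has
  degree at least 1, and shrinking the radius gains at least one factor
  \<open>r' / r\<close>.\<close>

lemma psb_shrink_zero:
  assumes G: "psb n c r G B" and r': "0 < r'" "r' \<le> r" and c: "c \<in> cspace n" "G c = 0"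
  shows "psb n c r' G (r' / r * B)"
proof -
  obtain a S where a: "0 < r" "wnorm n r a S" "S \<le> B"
    "\<forall>y\<in>cbx n c r. pseries n c a y (G y)"
    using psbE[OF G] .
  have "pseries n c a c (a (\<lambda>_. 0))"
  proof (rule has_sum_finite_neutralI[of "{\<lambda>_. 0}"])
    fix m assume "m \<in> midx n - {\<lambda>_. 0}"
    then obtain j where j: "j < n" "0 < m j" using mon_zero by blast
    then have "mon n (\<lambda>i. c i - c i) m = 0"
      unfolding mon_split[OF j(1)] by simp
    then show "mon n (\<lambda>i. c i - c i) m *\<^sub>R a m = 0" by simp
  qed (auto simp: zero_in_midx mon_def)
  moreover have "c \<in> cbx n c r" using c a(1) by (simp add: cbx_def)
  ultimately have a0: "a (\<lambda>_. 0) = 0" using a(4) c(2) has_sum_unique by metis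
  have le: "mon n (\<lambda>_. r') m * norm (a m) \<le> r' / r * (mon n (\<lambda>_. r) m * norm (a m))" if m: "m \<in> midx n" for m
  proof (cases "m = (\<lambda>_. 0)")
    case False
    then obtain j where j: "j < n" "0 < m j" using m mon_zero by blast
    define q where "q = (\<Sum>i<n. m i)"
    have "m j \<le> q" unfolding q_def using j by (intro member_le_sum) auto
    then obtain q' where q': "q = Suc q'" using j by (cases q) auto
    have "r' ^ q = r' * r' ^ q'" by (simp add: q')
    also have "\<dots> \<le> r' * r ^ q'" using r' by (intro mult_left_mono power_mono) auto
    also have "\<dots> = r' / r * r ^ q" using a(1) by (simp add: q')
    finally have "mon n (\<lambda>_. r') m \<le> r' / r * mon n (\<lambda>_. r) m" by (simp add: mon_const q_def)
    then show ?thesis using mult_right_mono[OF _ norm_ge_zero[of "a m"]] by (metis mult.assoc)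
  qed (simp add: a0)
  have "(\<lambda>m. mon n (\<lambda>_. r') m * norm (a m)) summable_on midx n"
    by (rule summable_on_comparison_test[OF has_sum_imp_summable[OF has_sum_cmult_right[OF a(2)]] le]) (use r' in \<open>auto simp: mon_nonneg\<close>)
  then obtain S' where S': "wnorm n r' a S'"
    by (auto simp: summable_on_def)
  have "S' \<le> r' / r * S" by (rule has_sum_mono[OF S' has_sum_cmult_right[OF a(2)] le])
  also have "\<dots> \<le> r' / r * B" using a r' by (intro mult_left_mono) auto
  finally show ?thesis
    by (intro psbI[OF r'(1) S']) (use a(4) cbx_mono[OF r'(2)] in auto)
qed

text \<open>Makes a series small enough to be substituted into another one. The claim covers all
  smaller radii, so that finitely many series can be given a common radius.\<close>

lemma psb_small:
  assumes G: "psb n c r G B" and c: "c \<in> cspace n" "G c = 0" and e: "0 < e"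
  shows "\<exists>r0>0. \<forall>r'. 0 < r' \<longrightarrow> r' \<le> r0 \<longrightarrow> psb n c r' G e"
proof (intro exI conjI allI impI)
  have r: "0 < r" and B: "0 \<le> B" using psb_pos[OF G] psb_bound_nonneg[OF G] by auto
  \<comment> \<open>The denominator \<open>B + 1\<close> is positive even when B is 0.\<close>
  show "0 < min r (r * e / (B + 1))" using r e B by simp
  fix r' assume r': "0 < r'" "r' \<le> min r (r * e / (B + 1))"
  have "psb n c r' G (r' / r * B)" by (rule psb_shrink_zero[OF G _ _ c]) (use r' in auto)
  moreover have "r' / r * B \<le> e"
  proof -
    have "r' * B \<le> r' * (B + 1)" using r' by simp
    also have "\<dots> \<le> r * e" using r' B by (simp add: pos_le_divide_eq)
    finally show ?thesis using r by (simp add: field_simps)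
  qed
  ultimately show "psb n c r' G e" by (rule psb_mono)
qed

lemma cbx_sub_copen:
  assumes "copen n D" "c \<in> D"
  shows "\<exists>r>0. cbx n c r \<subseteq> D"
proof -
  obtain r where r: "r > 0" "cnb n c r \<subseteq> D" using assms by (auto simp: copen_def)
  have "cbx n c (r/2) \<subseteq> cnb n c r" using r(1) by (fastforce simp: cbx_def cnb_def)
  then show ?thesis using r by (intro exI[of _ "r/2"]) auto
qed

lemma cnb_sub_cbx: "cnb n c r \<subseteq> cbx n c r"
  by (auto simp: cnb_def cbx_def less_imp_le)

text \<open>In finite dimension unconditional convergence is absolute. It turns the
  \<open>has_sum\<close> in the definition of analyticity into a bound on norms.\<close>

lemma euclidean_summable_on_norm:
  fixes f :: "'b \<Rightarrow> 'a::euclidean_space"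
  assumes "f summable_on A"
  shows "(\<lambda>x. norm (f x)) summable_on A"
proof -
  have "(\<lambda>x. \<bar>f x \<bullet> b\<bar>) summable_on A" if "b \<in> Basis" for b
  proof -
    have "(\<lambda>x. f x \<bullet> b) summable_on A"
      by (rule summable_on_bounded_linear[OF bounded_linear_inner_left assms])
    then show ?thesis using summable_on_iff_abs_summable_on_real[of "\<lambda>x. f x \<bullet> b" A] by simp
  qed
  note comp = this
  have "(\<lambda>x. \<Sum>b\<in>B. \<bar>f x \<bullet> b\<bar>) summable_on A" if "finite B" "B \<subseteq> Basis" for B
    using that by (induction B rule: finite_induct) (auto intro!: summable_on_add comp)
  from this[OF finite_Basis order_refl]
  have "(\<lambda>x. \<Sum>b\<in>Basis. \<bar>f x \<bullet> b\<bar>) summable_on A" .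
  then show ?thesis
    by (rule summable_on_comparison_test) (auto intro: norm_le_l1)
qed

lemma ranalytic_on_c_iff_psb:
  fixes G :: "(nat \<Rightarrow> real) \<Rightarrow> 'a::euclidean_space"
  assumes D: "copen n D"
  shows "ranalytic_on_c n D G \<longleftrightarrow> (\<forall>c\<in>D. \<exists>r B. psb n c r G B)"
proof (intro iffI ballI)
  fix c assume an: "ranalytic_on_c n D G" and c: "c \<in> D"
  from an[unfolded ranalytic_on_c_def, THEN bspec, OF c] 
  obtain r a where r: "r > 0" and a: "\<forall>y\<in>D. (\<forall>i<n. \<bar>y i - c i\<bar> < r) \<longrightarrow>
      pseries n c a y (G y)"
    unfolding mon_def midx_def by (elim exE conjE) auto
  obtain r1 where r1: "r1 > 0" "cbx n c r1 \<subseteq> D" using cbx_sub_copen[OF D c] by blast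
  \<comment> \<open>The box must lie in D and its closure must respect the strict bound
    \<open>r\<close>, hence the half.\<close>
  define r' where "r' = min r1 (r/2)"
  have r': "r' > 0" "r' < r" "cbx n c r' \<subseteq> D" using r r1 cbx_mono[of r' r1 n c] by (auto simp: r'_def)
  have cc: "c \<in> cspace n" using c D by (auto simp: copen_def)
  \<comment> \<open>The corner of the box: there every monomial equals its weight, so convergence at
    this single point makes the weighted norm finite.\<close>
  define y where "y i = (if i < n then c i + r' else 0)" for i
  have y: "y \<in> cbx n c r'" using r' by (auto simp: y_def cbx_def cspace_def)
  have "mon n (\<lambda>i. y i - c i) m = mon n (\<lambda>_. r') m" for m
    by (auto simp: mon_def y_def intro!: prod.cong)
  moreover have "pseries n c a y (G y)"
  proof (rule a[rule_format])
    show "y \<in> D" using y r' by blast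
    show "\<bar>y i - c i\<bar> < r" if "i < n" for i using that r' by (simp add: y_def)
  qed
  ultimately have "(\<lambda>m. mon n (\<lambda>_. r') m *\<^sub>R a m) summable_on midx n" 
    by (auto simp: summable_on_def)
  from euclidean_summable_on_norm[OF this]
  have "(\<lambda>m. mon n (\<lambda>_. r') m * norm (a m)) summable_on midx n" using r' by (simp add: mon_nonneg)
  then obtain S where S: "wnorm n r' a S"
    by (auto simp: summable_on_def)
  have "psb n c r' G S"
  proof (rule psbI[OF r'(1) S order_refl])
    fix z assume "z \<in> cbx n c r'"
    then show "pseries n c a z (G z)"
      using r' by (intro a[rule_format]) (auto simp: cbx_def intro: order.strict_trans1)
  qed
  then show "\<exists>r B. psb n c r G B" by blast
next
  assume R: "\<forall>c\<in>D. \<exists>r B. psb n c r G B"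
  show "ranalytic_on_c n D G"
    unfolding ranalytic_on_c_def
  proof
    fix c assume "c \<in> D"
    then obtain r B where G: "psb n c r G B" using R by blast
    obtain a S where a: "0 < r" "wnorm n r a S" "S \<le> B"
      "\<forall>y\<in>cbx n c r. pseries n c a y (G y)"
      using psbE[OF G] .
    have "\<forall>y\<in>D. (\<forall>i<n. \<bar>y i - c i\<bar> < r) \<longrightarrow>
            ((\<lambda>m. (\<Prod>i<n. (y i - c i) ^ m i) *\<^sub>R a m) has_sum G y) {m. \<forall>i\<ge>n. m i = 0}"
    proof (intro ballI impI)
      fix y assume "y \<in> D" "\<forall>i<n. \<bar>y i - c i\<bar> < r"
      then have "y \<in> cbx n c r" using D by (auto simp: cbx_def copen_def less_imp_le)
      then show "((\<lambda>m. (\<Prod>i<n. (y i - c i) ^ m i) *\<^sub>R a m) has_sum G y) {m. \<forall>i\<ge>n. m i = 0}"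
        using a(4) by (simp add: mon_def midx_def)
    qed
    then show "\<exists>r>0. \<exists>a. \<forall>y\<in>D. (\<forall>i<n. \<bar>y i - c i\<bar> < r) \<longrightarrow>
            ((\<lambda>m. (\<Prod>i<n. (y i - c i) ^ m i) *\<^sub>R a m) has_sum G y) {m. \<forall>i\<ge>n. m i = 0}"
      using a(1) by (intro exI[of _ r] conjI exI[of _ a])
  qed
qed

section \<open>Termwise differentiation of power series\<close>

lemma power_taylor1_bound:
  fixes x z \<rho> :: real
  assumes "\<bar>x\<bar> \<le> \<rho>" "\<bar>z\<bar> \<le> \<rho>"
  shows "\<rho>\<^sup>2 * \<bar>x ^ k - z ^ k - real k * z ^ (k - 1) * (x - z)\<bar> \<le> (real k)\<^sup>2 * \<rho> ^ k * (x - z)\<^sup>2"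
proof (induction k)
  case (Suc k)
  define e where "e = x ^ k - z ^ k - real k * z ^ (k - 1) * (x - z)"
  have \<rho>: "0 \<le> \<rho>" using assms by linarith
  \<comment> \<open>Recursion for the first-order Taylor remainder: x times the old remainder, plus
    one new quadratic term. The bound is stated with the factor \<open>\<rho>\<^sup>2\<close> so
    that no negative power of \<open>\<rho>\<close> occurs for small k.\<close>
  have eq: "x ^ Suc k - z ^ Suc k - real (Suc k) * z ^ (Suc k - 1) * (x - z)
      = x * e + real k * z ^ (k - 1) * (x - z)\<^sup>2"
    by (cases k) (auto simp: e_def algebra_simps power2_eq_square)
  have 1: "\<rho>\<^sup>2 * \<bar>x * e\<bar> \<le> \<rho> * ((real k)\<^sup>2 * \<rho> ^ k * (x - z)\<^sup>2)"
  proof -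
    have "\<rho>\<^sup>2 * \<bar>x * e\<bar> = \<bar>x\<bar> * (\<rho>\<^sup>2 * \<bar>e\<bar>)" by (simp add: abs_mult)
    also have "\<dots> \<le> \<rho> * ((real k)\<^sup>2 * \<rho> ^ k * (x - z)\<^sup>2)"
      by (rule mult_mono[OF assms(1) Suc[folded e_def] \<rho>]) simp
    finally show ?thesis .
  qed
  have 2: "\<rho>\<^sup>2 * \<bar>real k * z ^ (k - 1) * (x - z)\<^sup>2\<bar> \<le> real k * \<rho> ^ Suc k * (x - z)\<^sup>2"
  proof (cases k)
    case (Suc q)
    have "\<rho>\<^sup>2 * \<bar>z ^ q\<bar> \<le> \<rho>\<^sup>2 * \<rho> ^ q"
      using assms by (intro mult_left_mono) (auto simp: power_abs intro: power_mono)
    also have "\<dots> = \<rho> ^ Suc k" by (simp add: Suc power2_eq_square)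
    finally have "real k * (\<rho>\<^sup>2 * \<bar>z ^ q\<bar>) * (x - z)\<^sup>2 \<le> real k * \<rho> ^ Suc k * (x - z)\<^sup>2"
      by (intro mult_right_mono mult_left_mono) auto
    then show ?thesis by (simp add: Suc abs_mult mult_ac del: of_nat_Suc)
  qed simp
  have "\<rho>\<^sup>2 * \<bar>x * e + real k * z ^ (k - 1) * (x - z)\<^sup>2\<bar> 
      \<le> \<rho>\<^sup>2 * \<bar>x * e\<bar> + \<rho>\<^sup>2 * \<bar>real k * z ^ (k - 1) * (x - z)\<^sup>2\<bar>"
    unfolding distrib_left[symmetric] by (intro mult_left_mono abs_triangle_ineq) auto
  also have "\<dots> \<le> \<rho> * ((real k)\<^sup>2 * \<rho> ^ k * (x - z)\<^sup>2) + real k * \<rho> ^ Suc k * (x - z)\<^sup>2"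
    using 1 2 by linarith
  also have "\<dots> = ((real k)\<^sup>2 + real k) * (\<rho> ^ Suc k * (x - z)\<^sup>2)" by (simp add: algebra_simps)
  also have "\<dots> \<le> (real (Suc k))\<^sup>2 * (\<rho> ^ Suc k * (x - z)\<^sup>2)"
  proof (rule mult_right_mono)
    show "(real k)\<^sup>2 + real k \<le> (real (Suc k))\<^sup>2" by (simp add: power2_eq_square algebra_simps)
    show "0 \<le> \<rho> ^ Suc k * (x - z)\<^sup>2" using \<rho> by (intro mult_nonneg_nonneg zero_le_power zero_le_power2)
  qed
  finally show ?case unfolding eq by (simp add: mult.assoc)
qed simp

lemma square_times_power_bounded:
  fixes q :: real
  assumes "0 \<le> q" "q < 1"
  shows "\<exists>K. \<forall>k. (real k)\<^sup>2 * q ^ k \<le> K"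
proof -
  \<comment> \<open>\<open>k\<^sup>2 q ^ k\<close> is the square of \<open>k s ^ k\<close>, a null
    sequence.\<close>
  define s where "s = sqrt q"
  have s: "0 \<le> s" "s < 1" "q = s\<^sup>2" using assms by (auto simp: s_def)
  have "(\<lambda>k. of_nat k * s ^ k) \<longlonglongrightarrow> 0"
    by (rule powser_times_n_limit_0) (use s in auto)
  then have "Bseq (\<lambda>k. real k * s ^ k)" by (intro convergent_imp_Bseq convergentI)
  then obtain C where C: "\<And>k. \<bar>real k * s ^ k\<bar> \<le> C" unfolding Bseq_def by auto
  have "(real k)\<^sup>2 * q ^ k \<le> C\<^sup>2" for k
  proof -
    have "(real k)\<^sup>2 * q ^ k = \<bar>real k * s ^ k\<bar>\<^sup>2"
      by (simp add: s(3) power_mult_distrib flip: power_mult) (simp add: mult.commute)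
    also have "\<dots> \<le> C\<^sup>2" by (intro power_mono C) auto
    finally show ?thesis .
  qed
  then show ?thesis by blast
qed

lemma has_vector_derivative_quadratic:
  fixes f :: "real \<Rightarrow> 'a::real_normed_vector"
  assumes e: "0 < e" and b: "\<And>s. \<bar>s - x\<bar> < e \<Longrightarrow> norm (f s - f x - (s - x) *\<^sub>R d) \<le> C * (s - x)\<^sup>2"
  shows "(f has_vector_derivative d) (at x)"
  unfolding has_vector_derivative_def
proof (rule has_derivativeI_sandwich[OF e bounded_linear_scaleR_left])
  fix s assume s: "s \<noteq> x" "dist s x < e"
  have "norm (f s - f x - (s - x) *\<^sub>R d) \<le> C * \<bar>s - x\<bar> * \<bar>s - x\<bar>"
    using b[of s] s by (simp add: dist_real_def power2_eq_square mult.assoc)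
  then show "norm (f s - f x - (s - x) *\<^sub>R d) / norm (s - x) \<le> C * \<bar>s - x\<bar>"
    using s by (simp add: pos_divide_le_eq)
next
  have "((\<lambda>s. C * \<bar>s - x\<bar>) \<longlongrightarrow> C * \<bar>x - x\<bar>) (at x)" by (intro tendsto_intros)
  then show "((\<lambda>s. C * \<bar>s - x\<bar>) \<longlongrightarrow> 0) (at x)" by simp
qed

text \<open>The differentiated series has finite norm on a smaller radius, since
  \<open>k\<^sup>2 (r' / r) ^ k\<close> is bounded by some K. The same K controls the quadratic
  Taylor remainder of each monomial uniformly, so the remainders may be summed, which proves that
  the sum of the differentiated terms is the derivative.\<close>

lemma psb_pd:
  fixes G :: "(nat \<Rightarrow> real) \<Rightarrow> 'a::banach"
  assumes G: "psb n c r G B" and r': "0 < r'" "r' < r" and i: "i < n"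
  shows "\<exists>G' B'. psb n c r' G' B' \<and> (\<forall>y\<in>cnb n c r'. has_pd i G (G' y) y)"
proof -
  obtain a S where a: "0 < r" "wnorm n r a S" "S \<le> B"
    "\<forall>y\<in>cbx n c r. pseries n c a y (G y)"
    using psbE[OF G] .
  obtain K where K: "\<And>k. (real k)\<^sup>2 * (r' / r) ^ k \<le> K"
    using square_times_power_bounded[of "r' / r"] r' a(1) by auto
  have Km: "(real (m i))\<^sup>2 * mon n (\<lambda>_. r') m \<le> K * mon n (\<lambda>_. r) m" for m
  proof -
    have "(real (m i))\<^sup>2 * r' ^ m i = (real (m i))\<^sup>2 * (r' / r) ^ m i * r ^ m i"
      using a(1) by (simp add: power_divide)
    also have "\<dots> \<le> K * r ^ m i" using K a(1) by (intro mult_right_mono) auto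
    finally have "(real (m i))\<^sup>2 * r' ^ m i * (\<Prod>j\<in>{..<n} - {i}. r' ^ m j) \<le> K * r ^ m i * (\<Prod>j\<in>{..<n} - {i}. r ^ m j)"
    proof (rule mult_mono)
      show "(\<Prod>j\<in>{..<n} - {i}. r' ^ m j) \<le> (\<Prod>j\<in>{..<n} - {i}. r ^ m j)"
        using r' by (intro prod_mono) (auto intro!: power_mono)
      show "0 \<le> K * r ^ m i" using K[of 0] a(1) by simp
      show "0 \<le> (\<Prod>j\<in>{..<n} - {i}. r' ^ m j)" using r' by (intro prod_nonneg) auto
    qed
    then show ?thesis by (simp add: mon_split[OF i] mult.assoc)
  qed
  have Km1: "real (m i) * mon n (\<lambda>_. r') m \<le> K * mon n (\<lambda>_. r) m" for m
  proof -
    have "real (m i) \<le> (real (m i))\<^sup>2" by (cases "m i") (auto simp: power2_eq_square algebra_simps)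
    then have "real (m i) * mon n (\<lambda>_. r') m \<le> (real (m i))\<^sup>2 * mon n (\<lambda>_. r') m"
      using r' by (intro mult_right_mono) (auto simp: mon_nonneg)
    then show ?thesis using Km[of m] by linarith
  qed
  \<comment> \<open>For \<open>m i = 0\<close> the truncated exponent \<open>m i - 1\<close> is 0,
    and the factor \<open>real (m i)\<close> makes the term vanish.\<close>
  define T where "T = (\<lambda>m y. mon n (\<lambda>i. y i - c i) (m(i := m i - 1)) *\<^sub>R (real (m i) *\<^sub>R a m))"
  have T: "psb n c r' (T m) (K / r' * (mon n (\<lambda>_. r) m * norm (a m)))" for m
  proof -
    have "psb n c r' (T m) (mon n (\<lambda>_. r') (m(i := m i - 1)) * norm (real (m i) *\<^sub>R a m))"
      unfolding T_def by (rule psb_mon_scaleR[OF psb_const[OF r'(1)]])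
    moreover have "mon n (\<lambda>_. r') (m(i := m i - 1)) * norm (real (m i) *\<^sub>R a m)
        = (real (m i) * mon n (\<lambda>_. r') m) / r' * norm (a m)"
      using r' by (cases "m i") (auto simp: mon_upd[OF i] mon_split[OF i, of _ m])
    moreover have "\<dots> \<le> (K * mon n (\<lambda>_. r) m) / r' * norm (a m)"
      using Km1 r' by (intro mult_right_mono divide_right_mono) auto
    ultimately show ?thesis by (auto elim!: psb_mono)
  qed
  define G' where "G' = (\<lambda>y. infsum (\<lambda>m. T m y) (midx n))"
  note G'1 = psb_sum_family'[of r' "midx n" n c T, OF r'(1) T has_sum_cmult_right[OF a(2)]]
  have G': "psb n c r' G' (K / r' * S)" unfolding G'_def by (rule G'1(1))
  have G'sum: "((\<lambda>m. T m y) has_sum G' y) (midx n)" if "y \<in> cbx n c r'" for y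
    unfolding G'_def by (rule G'1(2)[OF that])
  have "has_pd i G (G' y) y" if y: "y \<in> cnb n c r'" for y
  proof -
    \<comment> \<open>Within this distance the displaced point stays in the box of radius
      \<open>r'\<close>.\<close>
    define e where "e = r' - \<bar>y i - c i\<bar>"
    have e: "e > 0" using y i by (simp add: e_def cnb_def)
    have yc: "y \<in> cbx n c r'" using y cnb_sub_cbx by blast
    have "norm (G (y(i := s)) - G (y(i := y i)) - (s - y i) *\<^sub>R G' y) \<le> (K / r'\<^sup>2 * S) * (s - y i)\<^sup>2" if s: "\<bar>s - y i\<bar> < e" for s
    proof -
      have sc: "\<bar>s - c i\<bar> \<le> r'" using s by (simp add: e_def)
      have ys: "y(i := s) \<in> cbx n c r'" using yc sc i by (auto simp: cbx_def cspace_upd)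
      define t where "t = (\<lambda>m. mon n (\<lambda>j. (y(i := s)) j - c j) m *\<^sub>R a m - mon n (\<lambda>j. y j - c j) m *\<^sub>R a m - (s - y i) *\<^sub>R T m y)"
      have sum: "(t has_sum (G (y(i := s)) - G y - (s - y i) *\<^sub>R G' y)) (midx n)"
      proof -
        have 1: "pseries n c a (y(i := s)) (G (y(i := s)))"
          "pseries n c a y (G y)"
          using a(4)[THEN bspec] ys yc cbx_mono[of r' r n c] r' by (blast intro: less_imp_le)+
        from has_sum_add[OF 1(1) has_sum_scaleR[OF 1(2), of "-1"]]
        have "((\<lambda>m. mon n (\<lambda>j. (y(i := s)) j - c j) m *\<^sub>R a m - mon n (\<lambda>j. y j - c j) m *\<^sub>R a m) has_sum G (y(i := s)) - G y) (midx n)"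
          by simp
        from has_sum_add[OF this has_sum_scaleR[OF G'sum[OF yc], of "- (s - y i)"]]
        show ?thesis unfolding t_def scaleR_minus_left by (simp only: add_uminus_conv_diff)
      qed
      have "norm (t m) \<le> (K / r'\<^sup>2 * (s - y i)\<^sup>2) * (mon n (\<lambda>_. r) m * norm (a m))" for m
      proof -
        define P where "P = (\<Prod>j\<in>{..<n} - {i}. (y j - c j) ^ m j)"
        define E where "E = (s - c i) ^ m i - (y i - c i) ^ m i - real (m i) * (y i - c i) ^ (m i - 1) * ((s - c i) - (y i - c i))"
        have P: "(\<Prod>j\<in>{..<n} - {i}. ((y(i := s)) j - c j) ^ m j) = P"
          unfolding P_def by (rule prod.cong) auto
        have t: "t m = (E * P) *\<^sub>R a m"
          unfolding t_def T_def mon_upd[OF i] mon_split[OF i, of _ m] P P_def[symmetric] E_def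
          by (simp add: algebra_simps)
        have Ple: "\<bar>P\<bar> \<le> (\<Prod>j\<in>{..<n} - {i}. r' ^ m j)"
          unfolding P_def abs_prod power_abs using yc 
          by (intro prod_mono) (auto simp: cbx_def intro!: power_mono)
        have "r'\<^sup>2 * \<bar>E\<bar> \<le> (real (m i))\<^sup>2 * r' ^ m i * ((s - c i) - (y i - c i))\<^sup>2"
          unfolding E_def by (rule power_taylor1_bound) (use sc yc i in \<open>auto simp: cbx_def\<close>)
        then have "r'\<^sup>2 * \<bar>E\<bar> \<le> (real (m i))\<^sup>2 * r' ^ m i * (s - y i)\<^sup>2" by simp
        from mult_mono[OF this Ple]
        have "(r'\<^sup>2 * \<bar>E\<bar>) * \<bar>P\<bar> \<le> ((real (m i))\<^sup>2 * r' ^ m i * (s - y i)\<^sup>2) * (\<Prod>j\<in>{..<n} - {i}. r' ^ m j)"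
          using r' by simp
        also have "\<dots> = ((real (m i))\<^sup>2 * mon n (\<lambda>_. r') m) * (s - y i)\<^sup>2"
          by (simp add: mon_split[OF i])
        also have "\<dots> \<le> (K * mon n (\<lambda>_. r) m) * (s - y i)\<^sup>2" using Km by (intro mult_right_mono) auto
        finally have "\<bar>E * P\<bar> \<le> K / r'\<^sup>2 * (s - y i)\<^sup>2 * mon n (\<lambda>_. r) m"
          using r' by (simp add: field_simps abs_mult)
        from mult_right_mono[OF this norm_ge_zero[of "a m"]]
        show ?thesis unfolding t by (simp add: mult_ac)
      qed
      from norm_infsum_le[OF sum has_sum_cmult_right[OF a(2)] this]
      show ?thesis by (simp add: mult_ac)
    qed
    from has_vector_derivative_quadratic[OF e this] show ?thesis by (simp add: has_pd_def)
  qed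
  then show ?thesis using G' by blast
qed


text \<open>The geometric series of \<open>1 / y i\<close> in powers of \<open>y i - c i\<close>;
  its norms form a geometric sequence with ratio \<open>r / \<bar>c i\<bar> < 1\<close>.\<close>

lemma psb_inverse_coord:
  assumes i: "i < n" and c: "c i \<noteq> 0" and r: "0 < r" "r < \<bar>c i\<bar>"
  shows "\<exists>B. psb n c r (\<lambda>y. inverse (y i)) B"
proof -
  define B where "B = (\<lambda>k. \<bar>inverse (c i)\<bar> * (r / \<bar>c i\<bar>) ^ k)"
  have sB: "summable B" unfolding B_def using r by (intro summable_mult summable_geometric) auto
  have B0: "0 \<le> B k" for k unfolding B_def using r by auto
  have sB': "B summable_on UNIV" using sB B0 by (simp add: summable_on_UNIV_nonneg_real_iff)
  have "psb n c r (\<lambda>y. inverse (y i)) (infsum B UNIV)"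
  proof (rule psb_sum_family[OF r(1) _ has_sum_infsum[OF sB']])
    fix k :: nat
    have "psb n c r (\<lambda>y. (inverse (c i) * (- inverse (c i)) ^ k) *\<^sub>R (y i - c i) ^ k) (\<bar>inverse (c i) * (- inverse (c i)) ^ k\<bar> * r ^ k)"
      by (rule psb_scaleR[OF psb_power[OF psb_coord[OF r(1) i]]])
    moreover have "\<bar>inverse (c i) * (- inverse (c i)) ^ k\<bar> * r ^ k = B k"
      by (simp add: B_def abs_mult power_abs power_divide field_simps)
    ultimately show "psb n c r (\<lambda>y. (inverse (c i) * (- inverse (c i)) ^ k) *\<^sub>R (y i - c i) ^ k) (B k)" by simp
  next
    fix y assume y: "y \<in> cbx n c r"
    define q where "q = - inverse (c i) * (y i - c i)"
    have yi: "\<bar>y i - c i\<bar> \<le> r" using y i by (auto simp: cbx_def)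
    then have "y i \<noteq> 0" using r by auto
    have q: "\<bar>q\<bar> < 1" using yi r c by (simp add: q_def abs_mult field_simps)
    have "(\<lambda>k. inverse (c i) * q ^ k) sums (inverse (c i) * (1 / (1 - q)))"
      using q by (intro sums_mult geometric_sums) auto
    moreover have "inverse (c i) * (1 / (1 - q)) = inverse (y i)"
      using c \<open>y i \<noteq> 0\<close> by (simp add: q_def field_simps)
    moreover have "summable (\<lambda>k. norm (inverse (c i) * q ^ k))"
      using q by (simp add: abs_mult power_abs summable_mult summable_geometric)
    ultimately have "((\<lambda>k. inverse (c i) * q ^ k) has_sum inverse (y i)) UNIV"
      by (simp add: norm_summable_imp_has_sum)
    then show "((\<lambda>k. (inverse (c i) * (- inverse (c i)) ^ k) *\<^sub>R (y i - c i) ^ k) has_sum inverse (y i)) UNIV"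
      unfolding q_def power_mult_distrib real_scaleR_def mult.assoc .
  qed
  then show ?thesis by blast
qed

text \<open>The binomial series of the square root at \<open>p c\<close>, into which
  \<open>p - p c\<close> is substituted after shrinking its norm to half of the radius of
  convergence \<open>p c\<close>.\<close>

lemma psb_sqrt:
  fixes p :: "(nat \<Rightarrow> real) \<Rightarrow> real"
  assumes p: "psb n c r p B" and c: "c \<in> cspace n" "p c > 0"
  shows "\<exists>r B. psb n c r (\<lambda>y. sqrt (p y)) B"
proof -
  define e where "e = p c / 2"
  have e: "0 < e" using c by (simp add: e_def)
  define z where "z = (\<lambda>y. p y - p c)"
  have "psb n c r (\<lambda>y. p y + (- p c)) (B + norm (- p c))" 
    by (rule psb_add[OF p psb_const[OF psb_pos[OF p]]])
  then have "psb n c r z (B + norm (- p c))" by (simp add: z_def)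
  from psb_small[OF this c(1) _ e]
  obtain r0 where r0: "r0 > 0" "psb n c r0 z e" by (auto simp: z_def)
  define b where "b = (\<lambda>k. ((1/2) gchoose k) * p c powr (1/2 - real k))"
  \<comment> \<open>The factor 3/4 lies strictly between the 1/2 in \<open>e\<close> and 1:
    convergence at \<open>3/4 * p c\<close> gives absolute convergence at \<open>e\<close>.\<close>
  have "summable (\<lambda>k. b k * (3/4 * p c) ^ k)" 
    unfolding b_def by (rule sums_summable[OF sqrt_series']) (use c in auto)
  from powser_insidea[OF this, of e] have sb: "summable (\<lambda>k. norm (b k * e ^ k))"
    using c by (simp add: e_def)
  have sB: "(\<lambda>k. \<bar>b k\<bar> * e ^ k) summable_on UNIV"
    using sb e by (subst summable_on_UNIV_nonneg_real_iff) (auto simp: abs_mult)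
  have "psb n c r0 (\<lambda>y. sqrt (p y)) (infsum (\<lambda>k. \<bar>b k\<bar> * e ^ k) UNIV)"
  proof (rule psb_sum_family[OF r0(1) _ has_sum_infsum[OF sB]])
    show "psb n c r0 (\<lambda>y. b k *\<^sub>R z y ^ k) (\<bar>b k\<bar> * e ^ k)" for k
      by (rule psb_scaleR[OF psb_power[OF r0(2)]])
    fix y assume y: "y \<in> cbx n c r0"
    have zy: "\<bar>z y\<bar> \<le> e" using psb_norm_le[OF r0(2) y] by simp
    have "(\<lambda>k. b k * z y ^ k) sums sqrt (p c + z y)"
      unfolding b_def by (rule sqrt_series') (use zy c in \<open>auto simp: e_def\<close>)
    moreover have "summable (\<lambda>k. norm (b k * z y ^ k))"
    proof (rule summable_comparison_test'[OF sb, of 0])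
      fix k show "norm (norm (b k * z y ^ k)) \<le> norm (b k * e ^ k)"
        using zy e by (auto simp: abs_mult power_abs intro!: mult_left_mono power_mono)
    qed
    ultimately show "((\<lambda>k. b k *\<^sub>R z y ^ k) has_sum sqrt (p y)) UNIV"
      by (simp add: norm_summable_imp_has_sum z_def)
  qed
  then show ?thesis by blast
qed

text \<open>The terms without the variable \<open>y i\<close> add up to
  \<open>G (y(i := 0)) = 0\<close> and may be dropped; every other term is divided by
  \<open>y i\<close>, which gives a series H with \<open>G y = y i *\<^sub>R H y\<close>. On the
  hyperplane the product rule yields \<open>pd i G = H\<close>, the value prescribed by
  \<open>qdiv\<close>.\<close>

lemma psb_qdiv_zero:
  fixes G :: "(nat \<Rightarrow> real) \<Rightarrow> 'a::banach"
  assumes G: "psb n c r G B" and i: "i < n" and c: "c i = 0"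
    and zero: "\<And>y. y \<in> cbx n c r \<Longrightarrow> y i = 0 \<Longrightarrow> G y = 0"
  shows "\<exists>r' B'. psb n c r' (qdiv i G) B'"
proof -
  obtain a S where a: "0 < r" "wnorm n r a S" "S \<le> B"
    "\<forall>y\<in>cbx n c r. pseries n c a y (G y)"
    using psbE[OF G] .
  define T where "T = (\<lambda>m y. mon n (\<lambda>i. y i - c i) (m(i := m i - 1)) *\<^sub>R (if m i = 0 then 0 else a m))"
  have T: "psb n c r (T m) (1 / r * (mon n (\<lambda>_. r) m * norm (a m)))" for m
  proof -
    have "psb n c r (T m) (mon n (\<lambda>_. r) (m(i := m i - 1)) * norm (if m i = 0 then 0 else a m))"
      unfolding T_def by (rule psb_mon_scaleR[OF psb_const[OF a(1)]])
    moreover have "mon n (\<lambda>_. r) (m(i := m i - 1)) * norm (if m i = 0 then 0 else a m) \<le> 1 / r * (mon n (\<lambda>_. r) m * norm (a m))"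
      using a(1) by (cases "m i") (auto simp: mon_upd[OF i] mon_split[OF i, of _ m] intro!: mult_nonneg_nonneg divide_nonneg_pos prod_nonneg)
    ultimately show ?thesis by (rule psb_mono)
  qed
  define H where "H = (\<lambda>y. infsum (\<lambda>m. T m y) (midx n))"
  note H1 = psb_sum_family'[of r "midx n" n c T, OF a(1) T has_sum_cmult_right[OF a(2)]]
  have H: "psb n c r H (1 / r * S)" unfolding H_def by (rule H1(1))
  have Hsum: "((\<lambda>m. T m y) has_sum H y) (midx n)" if "y \<in> cbx n c r" for y
    unfolding H_def by (rule H1(2)[OF that])
  have GH: "G y = y i *\<^sub>R H y" if y: "y \<in> cbx n c r" for y
  proof -
    have y0: "y(i := 0) \<in> cbx n c r" using y i c a(1) by (auto simp: cbx_def cspace_upd)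
    have "pseries n c a (y(i := 0)) (G (y(i := 0)))"
      using a(4) y0 by blast
    moreover have "G (y(i := 0)) = 0" by (rule zero[OF y0]) simp
    ultimately have 0: "pseries n c a (y(i := 0)) 0" by simp
    have "mon n (\<lambda>j. y j - c j) m *\<^sub>R a m = y i *\<^sub>R T m y + mon n (\<lambda>j. (y(i := 0)) j - c j) m *\<^sub>R a m" for m
    proof -
      have P: "(\<Prod>j\<in>{..<n} - {i}. ((y(i := 0)) j - c j) ^ m j) = (\<Prod>j\<in>{..<n} - {i}. (y j - c j) ^ m j)"
        by (rule prod.cong) auto
      show ?thesis
        unfolding T_def mon_upd[OF i] mon_split[OF i, of _ m] P using c by (cases "m i") auto
    qed
    moreover have "((\<lambda>m. y i *\<^sub>R T m y + mon n (\<lambda>j. (y(i := 0)) j - c j) m *\<^sub>R a m) has_sum y i *\<^sub>R H y + 0) (midx n)"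
      by (intro has_sum_add has_sum_scaleR Hsum y 0)
    ultimately have "pseries n c a y (y i *\<^sub>R H y)" by simp
    with a(4) y show ?thesis using has_sum_unique by blast
  qed
  have "0 < r / 2" "r / 2 < r" using a(1) by auto
  from psb_pd[OF H this i] obtain H' where H': "\<And>y. y \<in> cnb n c (r / 2) \<Longrightarrow> has_pd i H (H' y) y" by blast
  have "psb n c (r / 4) (qdiv i G) (1 / r * S)"
  proof (rule psb_cong[OF psb_shrink[OF H]])
    fix y assume y: "y \<in> cbx n c (r / 4)"
    have y1: "y \<in> cbx n c r" using y cbx_mono[of "r/4" r n c] a(1) by auto
    show "qdiv i G y = H y"
    proof (cases "y i = 0")
      case False
      then show ?thesis by (simp add: qdiv_def GH[OF y1])
    next
      case True
      have y2: "y \<in> cnb n c (r / 2)" using y a(1) by (fastforce simp: cnb_def cbx_def)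
      have "has_pd i (\<lambda>y. y i *\<^sub>R H y) (H y) y"
        using has_pd_coord_scaleR[OF H'[OF y2], of i] True by simp
      then have "has_pd i G (H y) y"
        by (rule has_pd_cong[OF copen_cnb y2 i, rotated])
           (use GH cnb_sub_cbx[of n c "r/2"] cbx_mono[of "r/2" r n c] a(1) in auto)
      then show ?thesis by (simp add: qdiv_def True has_pd_imp_pd)
    qed
  qed (use a(1) in auto)
  then show ?thesis by blast
qed

text \<open>Averaging the series at y and at its reflection in coordinate \<open>i\<close> deletes
  the coefficients with odd exponent at \<open>i\<close> and keeps the sum, as G is even. This is
  repeated for all \<open>i \<in> Z\<close>; the norm does not increase.\<close>

lemma psb_even_coeffs:
  fixes G :: "(nat \<Rightarrow> real) \<Rightarrow> 'a::banach"
  assumes G: "psb n c r G B" and Z: "finite Z" "Z \<subseteq> {..<n}" "\<And>i. i \<in> Z \<Longrightarrow> c i = 0"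
    and even: "\<And>y i. y \<in> cbx n c r \<Longrightarrow> i \<in> Z \<Longrightarrow> G (y(i := - y i)) = G y"
  shows "\<exists>a S. wnorm n r a S \<and> S \<le> B \<and>
    (\<forall>y\<in>cbx n c r. pseries n c a y (G y)) \<and>
    (\<forall>m. (\<exists>i\<in>Z. odd (m i)) \<longrightarrow> a m = 0)"
  using Z even
proof (induction Z rule: finite_induct)
  case empty
  obtain a S where "0 < r" "wnorm n r a S" "S \<le> B"
    "\<forall>y\<in>cbx n c r. pseries n c a y (G y)"
    using psbE[OF G] .
  then show ?case by (intro exI[of _ a] exI[of _ S]) auto
next
  case (insert i Z)
  have r: "0 < r" using psb_pos[OF G] .
  have "\<exists>a S. wnorm n r a S \<and> S \<le> B \<and>
    (\<forall>y\<in>cbx n c r. pseries n c a y (G y)) \<and>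
    (\<forall>m. (\<exists>i\<in>Z. odd (m i)) \<longrightarrow> a m = 0)"
    by (rule insert.IH) (use insert.prems in auto)
  then obtain a S where a: "wnorm n r a S" "S \<le> B"
    "\<forall>y\<in>cbx n c r. pseries n c a y (G y)"
    "\<forall>m. (\<exists>i\<in>Z. odd (m i)) \<longrightarrow> a m = 0"
    by (elim exE conjE)
  have i: "i < n" "c i = 0" using insert.prems by auto
  define b where "b = (\<lambda>m. if odd (m i) then 0 else a m)"
  have le: "mon n (\<lambda>_. r) m * norm (b m) \<le> mon n (\<lambda>_. r) m * norm (a m)" for m
    using r by (auto simp: b_def intro!: mult_nonneg_nonneg mon_nonneg)
  have "(\<lambda>m. mon n (\<lambda>_. r) m * norm (b m)) summable_on midx n"
    by (rule summable_on_comparison_test[OF has_sum_imp_summable[OF a(1)] le]) (use r in \<open>auto simp: mon_nonneg\<close>)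
  then obtain S' where S': "wnorm n r b S'"
    by (auto simp: summable_on_def)
  have "S' \<le> S" by (rule has_sum_mono[OF S' a(1) le])
  moreover have "pseries n c b y (G y)" if y: "y \<in> cbx n c r" for y
  proof -
    let ?y = "y(i := - y i)"
    have y': "?y \<in> cbx n c r" using y i by (auto simp: cbx_def cspace_upd)
    have Gy: "G ?y = G y" using insert.prems y by blast
    have "((\<lambda>m. (1/2) *\<^sub>R (mon n (\<lambda>i. y i - c i) m *\<^sub>R a m + mon n (\<lambda>j. ?y j - c j) m *\<^sub>R a m)) has_sum (1/2) *\<^sub>R (G y + G ?y)) (midx n)"
      by (intro has_sum_scaleR has_sum_add a(3)[THEN bspec] y y')
    moreover have "(1/2) *\<^sub>R (G y + G ?y) = G y" by (simp add: Gy flip: scaleR_2)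
    moreover have "(1/2) *\<^sub>R (mon n (\<lambda>i. y i - c i) m *\<^sub>R a m + mon n (\<lambda>j. ?y j - c j) m *\<^sub>R a m) = mon n (\<lambda>i. y i - c i) m *\<^sub>R b m" for m
    proof -
      have P: "(\<Prod>j\<in>{..<n} - {i}. (?y j - c j) ^ m j) = (\<Prod>j\<in>{..<n} - {i}. (y j - c j) ^ m j)"
        by (rule prod.cong) auto
      have "mon n (\<lambda>j. ?y j - c j) m = (-1) ^ m i * mon n (\<lambda>i. y i - c i) m"
        unfolding mon_split[OF i(1), of _ m] P using i(2) power_mult_distrib[of "-1" "y i" "m i"] by simp
      then show ?thesis by (simp add: b_def flip: scaleR_2)
    qed
    ultimately show ?thesis by simp
  qed
  moreover have "\<forall>m. (\<exists>i\<in>insert i Z. odd (m i)) \<longrightarrow> b m = 0" using a(4) by (auto simp: b_def)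
  ultimately show ?case using S' a(2) by (intro exI[of _ b] exI[of _ S']) auto
qed

text \<open>Substitution of power series. In the coordinates \<open>i \<in> Z\<close>, where \<open>G\<close> is even, only the square of
  the substituted function has to be a power series.\<close>

lemma psb_compose_even:
  fixes G :: "(nat \<Rightarrow> real) \<Rightarrow> 'a::banach"
  assumes G: "psb n c R G B" and Z: "Z \<subseteq> {..<n}" "\<And>i. i \<in> Z \<Longrightarrow> c i = 0"
    and even: "\<And>y i. y \<in> cbx n c R \<Longrightarrow> i \<in> Z \<Longrightarrow> G (y(i := - y i)) = G y"
    and r: "0 < r"
    and \<psi>: "\<And>y. y \<in> cbx n' c' r \<Longrightarrow> \<psi> y \<in> cbx n c R"
    and \<psi>1: "\<And>i. i < n \<Longrightarrow> i \<notin> Z \<Longrightarrow> psb n' c' r (\<lambda>y. \<psi> y i - c i) R"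
    and \<psi>2: "\<And>i. i \<in> Z \<Longrightarrow> psb n' c' r (\<lambda>y. (\<psi> y i)\<^sup>2) (R\<^sup>2)"
  shows "psb n' c' r (\<lambda>y. G (\<psi> y)) B"
proof -
  have "finite Z" using Z finite_subset by blast
  have "\<exists>a S. wnorm n R a S \<and> S \<le> B \<and>
    (\<forall>y\<in>cbx n c R. pseries n c a y (G y)) \<and>
    (\<forall>m. (\<exists>i\<in>Z. odd (m i)) \<longrightarrow> a m = 0)"
    by (rule psb_even_coeffs[OF G \<open>finite Z\<close> Z even])
  then obtain a S where a: "wnorm n R a S" "S \<le> B"
    "\<forall>y\<in>cbx n c R. pseries n c a y (G y)"
    "\<forall>m. (\<exists>i\<in>Z. odd (m i)) \<longrightarrow> a m = 0"
    by (elim exE conjE)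
  have "psb n' c' r (\<lambda>y. G (\<psi> y)) S"
  proof (rule psb_sum_family[OF r _ a(1)])
    fix m
    show "psb n' c' r (\<lambda>y. mon n (\<lambda>i. \<psi> y i - c i) m *\<^sub>R a m) (mon n (\<lambda>_. R) m * norm (a m))"
    proof (cases "\<exists>i\<in>Z. odd (m i)")
      case True
      then have "a m = 0" using a(4) by blast
      then show ?thesis using psb_const[OF r, of n' c' "0::'a"] by simp
    next
      case False
      have "psb n' c' r (\<lambda>y. mon n (\<lambda>i. \<psi> y i - c i) m) (mon n (\<lambda>_. R) m)"
        unfolding mon_def
      proof (rule psb_prod[OF _ r])
        fix i assume "i \<in> {..<n}"
        then have i: "i < n" by simp
        show "psb n' c' r (\<lambda>y. (\<psi> y i - c i) ^ m i) (R ^ m i)"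
        proof (cases "i \<in> Z")
          case False then show ?thesis by (intro psb_power \<psi>1 i)
        next
          case True
          then obtain k where k: "m i = 2 * k" using \<open>\<not> (\<exists>i\<in>Z. odd (m i))\<close> by (auto elim: evenE)
          show ?thesis using psb_power[OF \<psi>2[OF True], of k] Z(2)[OF True] by (simp add: k power_mult)
        qed
      qed simp
      from psb_scaleR_fun[OF this psb_const[OF r]] show ?thesis .
    qed
  next
    fix y assume "y \<in> cbx n' c' r"
    then show "((\<lambda>m. mon n (\<lambda>i. \<psi> y i - c i) m *\<^sub>R a m) has_sum G (\<psi> y)) (midx n)"
      using a(3) \<psi> by blast
  qed
  then show ?thesis using a(2) by (rule psb_mono)
qed

section \<open>Regularity classes and parity\<close>

lemma ranalytic_on_c_has_pd:
  fixes G :: "(nat \<Rightarrow> real) \<Rightarrow> 'a::euclidean_space"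
  assumes D: "copen n D" and G: "ranalytic_on_c n D G" and y: "y \<in> D" and i: "i < n"
  shows "has_pd i G (pd i G y) y"
proof -
  obtain r B where r: "psb n y r G B" using G y unfolding ranalytic_on_c_iff_psb[OF D] by blast
  have "0 < r / 2" "r / 2 < r" using psb_pos[OF r] by auto
  from psb_pd[OF r this i] obtain G' where "\<forall>z\<in>cnb n y (r/2). has_pd i G (G' z) z" by blast
  moreover have "y \<in> cnb n y (r/2)" using D y psb_pos[OF r] by (intro self_in_cnb) (auto simp: copen_def)
  ultimately have "has_pd i G (G' y) y" by blast
  then show ?thesis by (simp add: has_pd_imp_pd)
qed

lemma ranalytic_on_c_pd:
  fixes G :: "(nat \<Rightarrow> real) \<Rightarrow> 'a::euclidean_space"
  assumes D: "copen n D" and G: "ranalytic_on_c n D G" and i: "i < n"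
  shows "ranalytic_on_c n D (pd i G)"
  unfolding ranalytic_on_c_iff_psb[OF D]
proof
  fix c assume "c \<in> D"
  then obtain r B where r: "psb n c r G B" using G unfolding ranalytic_on_c_iff_psb[OF D] by blast
  have r2: "0 < r / 2" "r / 2 < r" using psb_pos[OF r] by auto
  from psb_pd[OF r this i] obtain G' B' where G': "psb n c (r/2) G' B'" 
    "\<forall>z\<in>cnb n c (r/2). has_pd i G (G' z) z" by blast
  have "psb n c (r/4) (pd i G) B'"
  proof (rule psb_cong[OF psb_shrink[OF G'(1)]])
    fix y assume "y \<in> cbx n c (r/4)"
    then have "y \<in> cnb n c (r/2)" using r2 by (fastforce simp: cbx_def cnb_def)
    then show "pd i G y = G' y" using G'(2) has_pd_imp_pd by blast
  qed (use r2 in auto)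
  then show "\<exists>r B. psb n c r (pd i G) B" by blast
qed

lemma ranalytic_on_c_qdiv:
  fixes G :: "(nat \<Rightarrow> real) \<Rightarrow> 'a::euclidean_space"
  assumes D: "copen n D" and G: "ranalytic_on_c n D G" and i: "i < n"
    and zero: "\<And>y. y \<in> D \<Longrightarrow> y i = 0 \<Longrightarrow> G y = 0"
  shows "ranalytic_on_c n D (qdiv i G)"
  unfolding ranalytic_on_c_iff_psb[OF D]
proof
  fix c assume c: "c \<in> D"
  then obtain r0 B where r0: "psb n c r0 G B" using G unfolding ranalytic_on_c_iff_psb[OF D] by blast
  obtain r1 where r1: "r1 > 0" "cbx n c r1 \<subseteq> D" using cbx_sub_copen[OF D c] by blast
  show "\<exists>r B. psb n c r (qdiv i G) B"
  proof (cases "c i = 0")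
    case True
    have G': "psb n c (min r0 r1) G B" using psb_pos[OF r0] r1 by (intro psb_shrink[OF r0]) auto
    have "G y = 0" if "y \<in> cbx n c (min r0 r1)" "y i = 0" for y
      using that zero r1 cbx_mono[of "min r0 r1" r1 n c] by auto
    from psb_qdiv_zero[OF G' i True this] show ?thesis .
  next
    case False
    define r where "r = min r0 (\<bar>c i\<bar> / 2)"
    have r: "0 < r" "r < \<bar>c i\<bar>" "r \<le> r0" using psb_pos[OF r0] False by (auto simp: r_def)
    obtain C where C: "psb n c r (\<lambda>y. inverse (y i)) C" using psb_inverse_coord[of i n c r, OF i False r(1,2)] by blast
    have "psb n c r (qdiv i G) (C * B)"
    proof (rule psb_cong[OF psb_scaleR_fun[OF C psb_shrink[OF r0 r(1,3)]]])
      fix y assume "y \<in> cbx n c r"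
      then have "\<bar>y i - c i\<bar> \<le> r" using i by (auto simp: cbx_def)
      then have "y i \<noteq> 0" using r by auto
      then show "qdiv i G y = inverse (y i) *\<^sub>R G y" by (simp add: qdiv_def)
    qed
    then show ?thesis by blast
  qed
qed

section \<open>Operations common to both regularity classes\<close>

lemma reg_on_pd:
  fixes G :: "(nat \<Rightarrow> real) \<Rightarrow> 'a::euclidean_space"
  assumes "copen n D" "reg_on p n D G" "i < n"
  shows "reg_on p n D (pd i G)"
  using assms smooth_on_c_pd ranalytic_on_c_pd by (cases p) (auto simp: reg_on_def)

lemma reg_on_has_pd:
  fixes G :: "(nat \<Rightarrow> real) \<Rightarrow> 'a::euclidean_space"
  assumes "copen n D" "reg_on p n D G" "y \<in> D" "i < n"
  shows "has_pd i G (pd i G y) y"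
  using assms smooth_on_c_has_pd ranalytic_on_c_has_pd by (cases p) (auto simp: reg_on_def)

lemma reg_on_qdiv:
  fixes G :: "(nat \<Rightarrow> real) \<Rightarrow> 'a::euclidean_space"
  assumes "copen n D" "reg_on p n D G" "i < n" "\<And>y. y \<in> D \<Longrightarrow> y i = 0 \<Longrightarrow> G y = 0"
  shows "reg_on p n D (qdiv i G)"
  using assms smooth_on_c_qdiv[OF assms(1) _ assms(3,4)] ranalytic_on_c_qdiv[OF assms(1) _ assms(3,4)]
  by (cases p) (auto simp: reg_on_def)

lemma reg_on_C_omega_psb:
  fixes G :: "(nat \<Rightarrow> real) \<Rightarrow> 'a::euclidean_space"
  assumes "copen n D" "reg_on C_omega n D G" "c \<in> D"
  obtains r B where "psb n c r G B"
proof -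
  have "\<exists>r B. psb n c r G B"
    using assms(2,3) unfolding reg_on_def regularity.case ranalytic_on_c_iff_psb[OF assms(1)] by blast
  then show thesis using that by blast
qed

lemma reg_on_add:
  fixes G :: "(nat \<Rightarrow> real) \<Rightarrow> 'a::euclidean_space"
  assumes D: "copen n D" and "reg_on p n D G" "reg_on p n D H"
  shows "reg_on p n D (\<lambda>y. G y + H y)"
proof (cases p)
  case C_infinity
  then show ?thesis using assms smooth_on_c_add by (simp add: reg_on_def)
next
  case C_omega
  have "\<exists>r B. psb n c r (\<lambda>y. G y + H y) B" if cD: "c \<in> D" for c
  proof -
    obtain r B where r1: "psb n c r G B"
      using reg_on_C_omega_psb[OF D assms(2)[unfolded C_omega] cD] .
    obtain r' B' where r2: "psb n c r' H B'"
      using reg_on_C_omega_psb[OF D assms(3)[unfolded C_omega] cD] .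
    note r = r1 r2
    have "psb n c (min r r') G B" "psb n c (min r r') H B'"
      using r psb_pos[OF r(1)] psb_pos[OF r(2)] by (auto intro: psb_shrink)
    from psb_add[OF this] show ?thesis by blast
  qed
  then show ?thesis using C_omega D by (simp add: reg_on_def ranalytic_on_c_iff_psb)
qed

lemma reg_on_bounded_linear:
  fixes G :: "(nat \<Rightarrow> real) \<Rightarrow> 'a::euclidean_space" and T :: "'a \<Rightarrow> 'b::euclidean_space"
  assumes D: "copen n D" and "reg_on p n D G" and T: "bounded_linear T"
  shows "reg_on p n D (\<lambda>y. T (G y))"
proof (cases p)
  case C_infinity
  then show ?thesis using assms smooth_on_c_bounded_linear by (simp add: reg_on_def)
next
  case C_omega
  obtain K where K: "0 \<le> K" "\<And>x. norm (T x) \<le> K * norm x"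
    using bounded_linear.nonneg_bounded[OF T] by (auto simp: mult.commute)
  have "\<exists>r B. psb n c r (\<lambda>y. T (G y)) B" if cD: "c \<in> D" for c
  proof -
    obtain r B where r: "psb n c r G B"
      using reg_on_C_omega_psb[OF D assms(2)[unfolded C_omega] cD] .
    from psb_bounded_linear[OF this T K(2,1)] show ?thesis by blast
  qed
  then show ?thesis using C_omega D by (simp add: reg_on_def ranalytic_on_c_iff_psb)
qed

lemma reg_on_scaleR:
  fixes G :: "(nat \<Rightarrow> real) \<Rightarrow> 'a::euclidean_space"
  assumes "copen n D" "reg_on p n D G"
  shows "reg_on p n D (\<lambda>y. k *\<^sub>R G y)"
  by (rule reg_on_bounded_linear[OF assms bounded_linear_scaleR_right])

lemma bounded_linear_mult_left_algebra:
  fixes a :: "'a::{euclidean_space, real_algebra_1}"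
  shows "bounded_linear (\<lambda>x. a * x)"
  by (rule linear_conv_bounded_linear[THEN iffD1]) (auto intro!: linearI simp: distrib_left)

lemma reg_on_mult_left:
  fixes G :: "(nat \<Rightarrow> real) \<Rightarrow> 'a::{euclidean_space, real_algebra_1}"
  assumes "copen n D" "reg_on p n D G"
  shows "reg_on p n D (\<lambda>y. a * G y)"
  by (rule reg_on_bounded_linear[OF assms bounded_linear_mult_left_algebra])

lemma reg_on_coord_scaleR:
  fixes G :: "(nat \<Rightarrow> real) \<Rightarrow> 'a::euclidean_space"
  assumes D: "copen n D" and G: "reg_on p n D G" and i: "i < n"
  shows "reg_on p n D (\<lambda>y. y i *\<^sub>R G y)"
proof (cases p)
  case C_infinity
  then show ?thesis using assms smooth_on_c_coord_scaleR by (simp add: reg_on_def)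
next
  case C_omega
  have "\<exists>r B. psb n c r (\<lambda>y. y i *\<^sub>R G y) B" if cD: "c \<in> D" for c
  proof -
    obtain r B where r: "psb n c r G B"
      using reg_on_C_omega_psb[OF D assms(2)[unfolded C_omega] cD] .
    have "psb n c r (\<lambda>y. (y i - c i) *\<^sub>R G y + c i *\<^sub>R G y) (r * B + \<bar>c i\<bar> * B)"
      by (rule psb_add[OF psb_coord_scaleR[OF r i] psb_scaleR[OF r]])
    then show ?thesis by (auto simp: algebra_simps)
  qed
  then show ?thesis using C_omega D by (simp add: reg_on_def ranalytic_on_c_iff_psb)
qed

lemma reg_on_zero:
  assumes "copen n D"
  shows "reg_on p n D (\<lambda>y. 0 :: 'a::euclidean_space)"
proof (cases p)
  case C_infinity
  then show ?thesis using smooth_on_c_const[OF assms] by (simp add: reg_on_def)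
next
  case C_omega
  then show ?thesis using assms psb_const[of 1 n _ "0::'a"]
    by (auto simp: reg_on_def ranalytic_on_c_iff_psb)
qed

lemma reg_on_sum:
  fixes G :: "'b \<Rightarrow> (nat \<Rightarrow> real) \<Rightarrow> 'a::euclidean_space"
  assumes D: "copen n D" and "\<And>k. k \<in> I \<Longrightarrow> reg_on p n D (G k)"
  shows "reg_on p n D (\<lambda>y. \<Sum>k\<in>I. G k y)"
  using assms(2)
proof (induction I rule: infinite_finite_induct)
  case (insert k I)
  then have "reg_on p n D (G k)" "reg_on p n D (\<lambda>y. \<Sum>k\<in>I. G k y)" by auto
  from reg_on_add[OF D this] show ?case using insert by simp
qed (simp_all add: reg_on_zero[OF D])

lemma reg_on_lapl:
  fixes G :: "(nat \<Rightarrow> real) \<Rightarrow> 'a::euclidean_space"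
  assumes D: "copen n D" and G: "reg_on p n D G"
  shows "reg_on p n D (lapl n G)"
proof -
  have "lapl n G = (\<lambda>y. \<Sum>i<n. pd i (pd i G) y)" by (simp add: lapl_def fun_eq_iff)
  moreover have "reg_on p n D (\<lambda>y. \<Sum>i<n. pd i (pd i G) y)"
    by (rule reg_on_sum[OF D]) (auto intro!: reg_on_pd[OF D] G)
  ultimately show ?thesis by simp
qed

text \<open>The sign \<open>e\<close> is 1 for even and -1 for odd functions. Invariance of D is
  part of the notion, so that reflections in several coordinates can be applied in
  succession.\<close>

definition parity :: "(nat \<Rightarrow> real) set \<Rightarrow> nat \<Rightarrow> real \<Rightarrow> ((nat \<Rightarrow> real) \<Rightarrow> 'a::real_vector) \<Rightarrow> bool" where
  "parity D i e G \<longleftrightarrow> (\<forall>y\<in>D. y(i := - y i) \<in> D \<and> G (y(i := - y i)) = e *\<^sub>R G y)"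

lemma parity_odd_zero:
  assumes "parity D i (-1) G" "y \<in> D" "y i = 0"
  shows "G y = 0"
proof -
  have "y(i := - y i) = y" using assms(3) by (auto simp: fun_eq_iff)
  moreover have "G (y(i := - y i)) = (-1) *\<^sub>R G y" using assms unfolding parity_def by blast
  ultimately have "G y = - G y" by (metis scaleR_minus1_left)
  then have "2 *\<^sub>R G y = 0" by (simp add: scaleR_2 eq_neg_iff_add_eq_0)
  then show ?thesis by simp
qed

lemma parity_pd_same:
  assumes D: "copen n D" and i: "i < n" and G: "parity D i e G" 
    and d: "\<And>y. y \<in> D \<Longrightarrow> has_pd i G (pd i G y) y"
  shows "parity D i (- e) (pd i G)"
  unfolding parity_def
proof (intro ballI conjI)
  fix y assume y: "y \<in> D"
  show y': "y(i := - y i) \<in> D" using G y by (simp add: parity_def)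
  obtain S where S: "open S" "y i \<in> S" "\<And>s. s \<in> S \<Longrightarrow> y(i := s) \<in> D"
    using copen_line[OF D y i] by blast
  have "((\<lambda>q. - q) has_vector_derivative -1) (at (- y i))" by (auto intro!: derivative_eq_intros)
  from vector_diff_chain_at[OF this, of "\<lambda>s. G (y(i := s))" "pd i G y"] d[OF y]
  have "((\<lambda>q. G (y(i := - q))) has_vector_derivative - pd i G y) (at (- y i))"
    by (simp add: has_pd_def o_def)
  from bounded_linear.has_vector_derivative[OF bounded_linear_scaleR_right this, of e]
  have "((\<lambda>q. e *\<^sub>R G (y(i := - q))) has_vector_derivative (- e) *\<^sub>R pd i G y) (at (- y i))" by simp
  then have "((\<lambda>q. G (y(i := q))) has_vector_derivative (- e) *\<^sub>R pd i G y) (at (- y i))"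
  proof (rule has_vector_derivative_transform_within_open)
    show "open (uminus ` S)" using S(1) by (rule open_negations)
    show "- y i \<in> uminus ` S" using S(2) by blast
    fix q assume "q \<in> uminus ` S"
    then have "y(i := - q) \<in> D" using S(3) by auto
    then show "e *\<^sub>R G (y(i := - q)) = G (y(i := q))" using G by (auto simp: parity_def dest!: bspec)
  qed
  then have "has_pd i G ((- e) *\<^sub>R pd i G y) (y(i := - y i))" by (simp add: has_pd_def)
  then show "pd i G (y(i := - y i)) = (- e) *\<^sub>R pd i G y" by (rule has_pd_imp_pd)
qed

lemma parity_pd_other:
  assumes D: "copen n D" and j: "j < n" "j \<noteq> i" and G: "parity D i e G" 
    and d: "\<And>y. y \<in> D \<Longrightarrow> has_pd j G (pd j G y) y"
  shows "parity D i e (pd j G)"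
  unfolding parity_def
proof (intro ballI conjI)
  fix y assume y: "y \<in> D"
  show y': "y(i := - y i) \<in> D" using G y by (simp add: parity_def)
  obtain S where S: "open S" "y j \<in> S" "\<And>s. s \<in> S \<Longrightarrow> y(j := s) \<in> D"
    using copen_line[OF D y j(1)] by blast
  from bounded_linear.has_vector_derivative[OF bounded_linear_scaleR_right d[OF y, unfolded has_pd_def], of e]
  have "((\<lambda>q. G ((y(i := - y i))(j := q))) has_vector_derivative e *\<^sub>R pd j G y) (at (y j))"
  proof (rule has_vector_derivative_transform_within_open)
    fix q assume "q \<in> S"
    then have "y(j := q) \<in> D" using S(3) by auto
    then have "G ((y(j := q))(i := - y i)) = e *\<^sub>R G (y(j := q))" using G j by (auto simp: parity_def dest!: bspec)
    then show "e *\<^sub>R G (y(j := q)) = G ((y(i := - y i))(j := q))" using j by (simp add: fun_upd_twist)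
  qed (use S in auto)
  then have "has_pd j G (e *\<^sub>R pd j G y) (y(i := - y i))" using j by (simp add: has_pd_def)
  then show "pd j G (y(i := - y i)) = e *\<^sub>R pd j G y" by (rule has_pd_imp_pd)
qed

lemma parity_qdiv_same:
  assumes D: "copen n D" and i: "i < n" and G: "parity D i e G" 
    and d: "\<And>y. y \<in> D \<Longrightarrow> has_pd i G (pd i G y) y"
  shows "parity D i (- e) (qdiv i G)"
  using parity_pd_same[OF assms] G by (auto simp: parity_def qdiv_def)

lemma parity_qdiv_other:
  assumes D: "copen n D" and j: "j < n" "j \<noteq> i" and G: "parity D i e G" 
    and d: "\<And>y. y \<in> D \<Longrightarrow> has_pd j G (pd j G y) y"
  shows "parity D i e (qdiv j G)"
  using parity_pd_other[OF assms] G j(2) by (auto simp: parity_def qdiv_def)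

lemma qdiv_mult: "y i \<noteq> 0 \<or> G y = 0 \<Longrightarrow> y i *\<^sub>R qdiv i G y = G y"
  by (auto simp: qdiv_def)

section \<open>The map from the domain of the shorter list of steps\<close>

text \<open>The module over the polynomials in the coordinates generated by X. The derivative of
  \<open>H (nu y)\<close> in a block coordinate is that coordinate times another function of the
  same kind, so such functions alone are not closed under differentiation, but the module they
  generate is.\<close>

inductive_set coord_module :: "((nat \<Rightarrow> real) \<Rightarrow> 'a::real_vector) set \<Rightarrow> ((nat \<Rightarrow> real) \<Rightarrow> 'a) set"
  for X where
  base: "h \<in> X \<Longrightarrow> h \<in> coord_module X"
| mult: "g \<in> coord_module X \<Longrightarrow> (\<lambda>y. y i *\<^sub>R g y) \<in> coord_module X"
| add: "g \<in> coord_module X \<Longrightarrow> h \<in> coord_module X \<Longrightarrow> (\<lambda>y. g y + h y) \<in> coord_module X"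

text \<open>By the product rule it suffices that the derivatives of the generators lie in the
  module.\<close>

lemma smooth_on_c_coord_module:
  assumes D: "copen n D" and cont: "\<And>h. h \<in> X \<Longrightarrow> continuous_on D h"
    and deriv: "\<And>h i. h \<in> X \<Longrightarrow> i < n \<Longrightarrow> \<exists>g\<in>coord_module X. \<forall>y\<in>D. has_pd i h (g y) y"
    and g: "g \<in> coord_module X"
  shows "smooth_on_c n D g"
proof (rule smooth_on_c_coinduct[OF D g])
  fix g assume "g \<in> coord_module X"
  then show "continuous_on D g"
    by induction (auto intro!: continuous_on_scaleR continuous_on_add continuous_on_coord intro: cont)
next
  fix g i assume "g \<in> coord_module X" and i: "i < n"
  then show "\<exists>g'\<in>coord_module X. \<forall>y\<in>D. has_pd i g (g' y) y"
  proof induction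
    case (base h)
    then show ?case using deriv i by blast
  next
    case (mult g j)
    then obtain g' where g': "g' \<in> coord_module X" "\<forall>y\<in>D. has_pd i g (g' y) y" by blast
    have 1: "\<forall>y\<in>D. has_pd i (\<lambda>y. y j *\<^sub>R g y) (y j *\<^sub>R g' y + (if i = j then g y else 0)) y"
      using g'(2) has_pd_coord_scaleR by blast
    have "(\<lambda>y. y j *\<^sub>R g' y + (if i = j then g y else 0)) \<in> coord_module X"
      using coord_module.mult[OF g'(1), of j] coord_module.add[OF coord_module.mult[OF g'(1), of j] mult(1)]
      by (cases "i = j") simp_all
    then show ?case by (rule rev_bexI) (rule 1)
  next
    case (add g h)
    then obtain g' h' where g': "g' \<in> coord_module X" "\<forall>y\<in>D. has_pd i g (g' y) y"
      "h' \<in> coord_module X" "\<forall>y\<in>D. has_pd i h (h' y) y" by blast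
    have "\<forall>y\<in>D. has_pd i (\<lambda>y. g y + h y) (g' y + h' y) y" using g' has_pd_add by blast
    then show ?case by (rule rev_bexI[OF coord_module.add[OF g'(1,3)]])
  qed
qed simp

locale steps =
  fixes t :: "nat \<Rightarrow> nat" and \<tau> \<sigma> :: nat and D :: "(nat \<Rightarrow> real) set"
  assumes t_step: "\<And>h. h < \<tau> \<Longrightarrow> t h < t (Suc h)"
    and \<sigma>_le: "\<sigma> \<le> \<tau>"
    and adm: "admissible_dom t \<tau> D"
begin

text \<open>\<open>blk u\<close> indexes the coordinates of \<open>x^u\<close>, and \<open>nu\<close> sends \<open>(\<alpha> + x^1 + \<dots> + x^\<sigma>, \<beta>)\<close> to
  \<open>(\<alpha>, \<parallel>x^1\<parallel>, \<dots>, \<parallel>x^\<sigma>\<parallel>, \<beta>)\<close>, so that \<open>D'\<close>, the domain \<open>D^\<sigma>\<close>, is the preimage of \<open>D\<close>.\<close>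

definition n where "n = t 0 + 1 + \<tau>"
definition n' where "n' = t \<sigma> + 1 + (\<tau> - \<sigma>)"
definition D' where "D' = Dsig t \<tau> \<sigma> D"
definition blk where "blk u = {t (u - 1) + 1..t u}"

definition nu :: "(nat \<Rightarrow> real) \<Rightarrow> nat \<Rightarrow> real" where
  "nu y = (\<lambda>i. if i \<le> t 0 then y i
          else if i \<le> t 0 + \<sigma> then blocknorm t (i - t 0) y
          else if i < n then y (t \<sigma> + (i - t 0 - \<sigma>))
          else 0)"

lemma sdim_n: "sdim t \<tau> = n" "sdim (tsig t \<sigma>) (\<tau> - \<sigma>) = n'"
  by (simp_all add: sdim_def n_def n'_def tsig_def)

lemma D'_iff: "y \<in> D' \<longleftrightarrow> y \<in> cspace n' \<and> nu y \<in> D"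
  unfolding D'_def Dsig_def nu_def sdim_n by simp

lemma t_less: "h < k \<Longrightarrow> k \<le> \<tau> \<Longrightarrow> t h < t k"
proof (induction k)
  case (Suc k)
  then show ?case using t_step[of k] by (cases "h = k") auto
qed simp

lemma t_le: "h \<le> k \<Longrightarrow> k \<le> \<tau> \<Longrightarrow> t h \<le> t k"
  using t_less[of h k] by (cases "h = k") auto

lemma block_unique:
  assumes "i \<in> blk u" "i \<in> blk w" "1 \<le> u" "u \<le> \<tau>" "1 \<le> w" "w \<le> \<tau>"
  shows "u = w"
proof (rule ccontr)
  assume "u \<noteq> w"
  then consider "u \<le> w - 1" | "w \<le> u - 1" by linarith
  moreover have "w - 1 \<le> \<tau>" "u - 1 \<le> \<tau>" using assms by auto
  ultimately show False
    using assms(1,2) t_le[of u "w - 1"] t_le[of w "u - 1"] by cases (auto simp: blk_def)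
qed

lemma block_exists:
  assumes "t 0 < i" "i \<le> t k" "k \<le> \<tau>"
  obtains u where "1 \<le> u" "u \<le> k" "i \<in> blk u"
proof -
  define u where "u = (LEAST u. i \<le> t u)"
  have u: "i \<le> t u" unfolding u_def by (rule LeastI[of _ k]) (rule assms(2))
  have uk: "u \<le> k" unfolding u_def by (rule Least_le) (rule assms(2))
  have u1: "u \<noteq> 0" using u assms(1) by (intro notI) auto
  then have "\<not> i \<le> t (u - 1)" unfolding u_def by (intro not_less_Least) auto
  then show thesis using that[of u] u uk u1 by (auto simp: blk_def)
qed

lemma blk_range:
  assumes "1 \<le> u" "u \<le> \<sigma>" "i \<in> blk u"
  shows "t 0 < i" "i \<le> t \<sigma>" "i < n'"
proof -
  have "u - 1 \<le> \<tau>" using assms \<sigma>_le by linarith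
  then show "t 0 < i" "i \<le> t \<sigma>" "i < n'"
    using assms t_le[of 0 "u - 1"] t_le[of u \<sigma>] \<sigma>_le by (auto simp: blk_def n'_def)
qed

lemma blocknorm_upd_other: "i \<notin> blk u \<Longrightarrow> blocknorm t u (y(i := s)) = blocknorm t u y"
  unfolding blocknorm_def blk_def by (intro arg_cong[where f = sqrt] sum.cong) auto

lemma copen_D: "copen n D"
  using adm by (simp add: copen_iff_openin admissible_dom_def sdim_n)

lemma continuous_nu: "continuous_on S nu"
proof (rule continuous_on_coordinatewise_then_product)
  fix i
  consider "i \<le> t 0" | "t 0 < i" "i \<le> t 0 + \<sigma>" | "t 0 + \<sigma> < i" "i < n" | "t 0 + \<sigma> < i" "n \<le> i" by linarith
  then show "continuous_on S (\<lambda>x. nu x i)"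
    by cases (auto simp: nu_def blocknorm_def intro!: continuous_intros continuous_on_coord)
qed

lemma nu_cspace: "nu y \<in> cspace n"
  using \<sigma>_le by (auto simp: nu_def cspace_def n_def)

lemma copen_D': "copen n' D'"
proof -
  have "D' = cspace n' \<inter> nu -` D" by (auto simp: D'_iff)
  moreover have "openin (top_of_set (cspace n')) (cspace n' \<inter> nu -` D)"
  proof (rule continuous_openin_preimage[OF continuous_nu])
    show "nu \<in> cspace n' \<rightarrow> cspace n" using nu_cspace by blast
    show "openin (top_of_set (cspace n)) D" using copen_D by (simp add: copen_iff_openin)
  qed
  ultimately show ?thesis by (auto simp: copen_iff_openin)
qed

lemma nu_upd_head:
  assumes "i \<le> t 0"
  shows "nu (y(i := s)) = (nu y)(i := s)"
proof
  fix k
  have "blocknorm t u (y(i := s)) = blocknorm t u y" if "1 \<le> u" "u \<le> \<sigma>" for u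
    using blk_range(1)[OF that, of i] assms by (intro blocknorm_upd_other) auto
  then show "nu (y(i := s)) k = ((nu y)(i := s)) k"
    using assms t_le[of 0 \<sigma>] \<sigma>_le by (auto simp: nu_def)
qed

lemma nu_upd_tail:
  assumes "1 \<le> h" "h \<le> \<tau> - \<sigma>"
  shows "nu (y(t \<sigma> + h := s)) = (nu y)(t 0 + \<sigma> + h := s)"
proof
  fix k
  have "blocknorm t u (y(t \<sigma> + h := s)) = blocknorm t u y" if "1 \<le> u" "u \<le> \<sigma>" for u
    using blk_range(2)[OF that, of "t \<sigma> + h"] assms by (intro blocknorm_upd_other) auto
  then show "nu (y(t \<sigma> + h := s)) k = ((nu y)(t 0 + \<sigma> + h := s)) k"
    using assms t_le[of 0 \<sigma>] \<sigma>_le by (auto simp: nu_def n_def)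
qed

lemma blocknorm_upd:
  assumes "i \<in> blk u"
  shows "blocknorm t u (y(i := s)) = sqrt ((\<Sum>j\<in>blk u - {i}. (y j)\<^sup>2) + s\<^sup>2)"
proof -
  have "(\<Sum>j\<in>blk u. ((y(i := s)) j)\<^sup>2) = s\<^sup>2 + (\<Sum>j\<in>blk u - {i}. ((y(i := s)) j)\<^sup>2)"
    using assms by (subst sum.remove[of _ i]) (auto simp: blk_def)
  also have "(\<Sum>j\<in>blk u - {i}. ((y(i := s)) j)\<^sup>2) = (\<Sum>j\<in>blk u - {i}. (y j)\<^sup>2)"
    by (rule sum.cong) auto
  finally show ?thesis by (simp add: blocknorm_def blk_def add.commute)
qed

lemma nu_block: "1 \<le> u \<Longrightarrow> u \<le> \<sigma> \<Longrightarrow> nu y (t 0 + u) = blocknorm t u y"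
  by (simp add: nu_def)

lemma nu_upd_block:
  assumes u: "1 \<le> u" "u \<le> \<sigma>" and i: "i \<in> blk u"
  shows "nu (y(i := s)) = (nu y)(t 0 + u := sqrt ((\<Sum>j\<in>blk u - {i}. (y j)\<^sup>2) + s\<^sup>2))"
proof
  fix k
  have "blocknorm t w (y(i := s)) = blocknorm t w y" if "1 \<le> w" "w \<le> \<sigma>" "w \<noteq> u" for w
  proof -
    have "i \<notin> blk w" using block_unique[OF i _ u(1) _ that(1)] that u \<sigma>_le by auto
    then show ?thesis by (rule blocknorm_upd_other)
  qed
  then show "nu (y(i := s)) k = ((nu y)(t 0 + u := sqrt ((\<Sum>j\<in>blk u - {i}. (y j)\<^sup>2) + s\<^sup>2))) k"
    using u blk_range[OF u i] blocknorm_upd[OF i, of y s] by (auto simp: nu_def)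
qed

section \<open>Even functions composed with the norms of the blocks\<close>

definition ev :: "((nat \<Rightarrow> real) \<Rightarrow> 'a::real_vector) \<Rightarrow> bool" where
  "ev H \<longleftrightarrow> (\<forall>u\<in>{1..\<sigma>}. parity D (t 0 + u) 1 H)"

text \<open>The function \<open>E\<^sub>u\<close> of the overview, for an arbitrary even H; at
  \<open>\<beta>\<^sub>u = 0\<close> its value is the second derivative of H.\<close>

definition Eq :: "nat \<Rightarrow> ((nat \<Rightarrow> real) \<Rightarrow> 'a::real_normed_vector) \<Rightarrow> (nat \<Rightarrow> real) \<Rightarrow> 'a" where
  "Eq u H = qdiv (t 0 + u) (pd (t 0 + u) H)"

lemma idx_less_n: "u \<le> \<tau> \<Longrightarrow> t 0 + u < n"
  by (simp add: n_def)

lemma ev_pd_odd: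
  fixes H :: "(nat \<Rightarrow> real) \<Rightarrow> 'a::euclidean_space"
  assumes "reg_on p n D H" "ev H" "1 \<le> u" "u \<le> \<sigma>"
  shows "parity D (t 0 + u) (-1) (pd (t 0 + u) H)"
  using parity_pd_same[OF copen_D, of "t 0 + u" 1 H] assms reg_on_has_pd[OF copen_D assms(1)] idx_less_n \<sigma>_le
  by (auto simp: ev_def)

lemma Eq_mult:
  fixes H :: "(nat \<Rightarrow> real) \<Rightarrow> 'a::euclidean_space"
  assumes "reg_on p n D H" "ev H" "1 \<le> u" "u \<le> \<sigma>" "y \<in> D"
  shows "y (t 0 + u) *\<^sub>R Eq u H y = pd (t 0 + u) H y"
  unfolding Eq_def by (rule qdiv_mult) (use parity_odd_zero[OF ev_pd_odd[OF assms(1-4)] assms(5)] in blast)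

lemma reg_on_Eq:
  fixes H :: "(nat \<Rightarrow> real) \<Rightarrow> 'a::euclidean_space"
  assumes "reg_on p n D H" "ev H" "1 \<le> u" "u \<le> \<sigma>"
  shows "reg_on p n D (Eq u H)"
  unfolding Eq_def
  by (rule reg_on_qdiv[OF copen_D reg_on_pd[OF copen_D assms(1)]])
     (use assms \<sigma>_le idx_less_n parity_odd_zero[OF ev_pd_odd[OF assms(1-4)]] in auto)

text \<open>In the coordinate u itself, differentiation and division each reverse the parity; in the
  others neither does. Hence the construction can be iterated on even functions.\<close>

lemma parity_Eq:
  fixes H :: "(nat \<Rightarrow> real) \<Rightarrow> 'a::euclidean_space"
  assumes H: "reg_on p n D H" and u: "1 \<le> u" "u \<le> \<sigma>" and par: "parity D i e H"
  shows "parity D i e (Eq u H)"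
proof -
  have un: "t 0 + u < n" using u \<sigma>_le idx_less_n by simp
  note H' = reg_on_pd[OF copen_D H un]
  note d = reg_on_has_pd[OF copen_D H _ un] and d' = reg_on_has_pd[OF copen_D H' _ un]
  show ?thesis
  proof (cases "i = t 0 + u")
    case True
    then show ?thesis unfolding Eq_def
      using parity_qdiv_same[OF copen_D un parity_pd_same[OF copen_D un _ d] d'] par by simp
  next
    case False
    then show ?thesis unfolding Eq_def
      using parity_qdiv_other[OF copen_D un _ parity_pd_other[OF copen_D un _ par d] d'] by simp
  qed
qed

lemma ev_Eq:
  fixes H :: "(nat \<Rightarrow> real) \<Rightarrow> 'a::euclidean_space"
  assumes "reg_on p n D H" "ev H" "1 \<le> u" "u \<le> \<sigma>"
  shows "ev (Eq u H)"
  using assms parity_Eq unfolding ev_def by blast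

lemma ev_pd:
  fixes H :: "(nat \<Rightarrow> real) \<Rightarrow> 'a::euclidean_space"
  assumes "reg_on p n D H" "ev H" "i < n" "i \<le> t 0 \<or> t 0 + \<sigma> < i"
  shows "ev (pd i H)"
  unfolding ev_def
proof
  fix u assume "u \<in> {1..\<sigma>}"
  then show "parity D (t 0 + u) 1 (pd i H)"
    using assms by (intro parity_pd_other[OF copen_D assms(3) _ _ reg_on_has_pd[OF copen_D assms(1) _ assms(3)]])
      (auto simp: ev_def)
qed

lemma has_pd_nu_head:
  fixes H :: "(nat \<Rightarrow> real) \<Rightarrow> 'a::euclidean_space"
  assumes "reg_on p n D H" "y \<in> D'" "i \<le> t 0"
  shows "has_pd i (\<lambda>y. H (nu y)) (pd i H (nu y)) y"
proof -
  have "has_pd i H (pd i H (nu y)) (nu y)"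
    by (rule reg_on_has_pd[OF copen_D assms(1)]) (use assms D'_iff in \<open>auto simp: n_def\<close>)
  moreover have "nu y i = y i" using assms by (simp add: nu_def)
  ultimately show ?thesis by (simp add: has_pd_def nu_upd_head[OF assms(3)])
qed

lemma has_pd_nu_tail:
  fixes H :: "(nat \<Rightarrow> real) \<Rightarrow> 'a::euclidean_space"
  assumes "reg_on p n D H" "y \<in> D'" "1 \<le> h" "h \<le> \<tau> - \<sigma>"
  shows "has_pd (t \<sigma> + h) (\<lambda>y. H (nu y)) (pd (t 0 + \<sigma> + h) H (nu y)) y"
proof -
  have "has_pd (t 0 + \<sigma> + h) H (pd (t 0 + \<sigma> + h) H (nu y)) (nu y)"
    by (rule reg_on_has_pd[OF copen_D assms(1)]) (use assms D'_iff in \<open>auto simp: n_def\<close>)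
  moreover have "nu y (t 0 + \<sigma> + h) = y (t \<sigma> + h)" using assms by (simp add: nu_def n_def)
  ultimately show ?thesis by (simp add: has_pd_def nu_upd_tail[OF assms(3,4)])
qed

text \<open>Where the norm of \<open>x^u\<close> is positive, its derivative is \<open>y i\<close>
  divided by the norm, and the denominator is absorbed by
  \<open>\<partial>\<^sub>u H = \<beta>\<^sub>u E\<^sub>u\<close>. The result makes sense, and is
  true, at norm 0 as well.\<close>

lemma has_pd_nu_block:
  fixes H :: "(nat \<Rightarrow> real) \<Rightarrow> 'a::euclidean_space"
  assumes H: "reg_on p n D H" "ev H" and y: "y \<in> D'" and u: "1 \<le> u" "u \<le> \<sigma>" and i: "i \<in> blk u"
  shows "has_pd i (\<lambda>y. H (nu y)) (y i *\<^sub>R Eq u H (nu y)) y"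
proof -
  define z where "z = nu y"
  define k where "k = t 0 + u"
  have kn: "k < n" using u \<sigma>_le idx_less_n by (simp add: k_def)
  have z: "z \<in> D" using y by (simp add: z_def D'_iff)
  define q where "q = (\<Sum>j\<in>blk u - {i}. (y j)\<^sup>2)"
  have q0: "0 \<le> q" unfolding q_def by (intro sum_nonneg) auto
  have zk: "z k = sqrt (q + (y i)\<^sup>2)"
    using blocknorm_upd[OF i, of y "y i"] u by (simp add: z_def k_def nu_block q_def)
  have pd: "((\<lambda>s. H (z(k := s))) has_vector_derivative pd k H z) (at (z k))"
    using reg_on_has_pd[OF copen_D H(1) z kn] by (simp add: has_pd_def)
  have E: "z k *\<^sub>R Eq u H z = pd k H z" unfolding k_def by (rule Eq_mult[OF H u z])
  have upd: "(\<lambda>s. H (nu (y(i := s)))) = (\<lambda>s. H (z(k := sqrt (q + s\<^sup>2))))"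
    by (simp add: nu_upd_block[OF u i] z_def k_def q_def)
  have "((\<lambda>s. H (z(k := sqrt (q + s\<^sup>2)))) has_vector_derivative y i *\<^sub>R Eq u H z) (at (y i))"
  proof (cases "z k = 0")
    case False
    then have pos: "q + (y i)\<^sup>2 > 0" using zk q0 by (metis add_nonneg_nonneg less_eq_real_def real_sqrt_zero zero_le_power2)
    have "((\<lambda>s. sqrt (q + s\<^sup>2)) has_real_derivative y i / z k) (at (y i))"
      using pos False by (auto intro!: derivative_eq_intros simp: zk field_simps)
    then have "((\<lambda>s. sqrt (q + s\<^sup>2)) has_vector_derivative y i / z k) (at (y i))"
      by (simp add: has_real_derivative_iff_has_vector_derivative)
    from vector_diff_chain_at[OF this, of "\<lambda>s. H (z(k := s))" "pd k H z"] pd zk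
    have "((\<lambda>s. H (z(k := sqrt (q + s\<^sup>2)))) has_vector_derivative (y i / z k) *\<^sub>R pd k H z) (at (y i))"
      by (simp add: o_def)
    then show ?thesis using False by (simp flip: E)
  next
    case True
    then have "q + (y i)\<^sup>2 = 0" by (simp add: zk)
    then have q: "q = 0" and yi: "y i = 0" using q0 by (auto simp: add_nonneg_eq_0_iff)
    have "pd k H z = 0" using E True by simp
    then have d0: "((\<lambda>s. H (z(k := s))) has_vector_derivative 0) (at 0)" using pd True by simp
    obtain S where S: "open S" "z k \<in> S" "\<And>s. s \<in> S \<Longrightarrow> z(k := s) \<in> D"
      using copen_line[OF copen_D z kn] by blast
    \<comment> \<open>The other coordinates of the block vanish, so along the line the norm is the
      absolute value of s. Evenness allows s in its place, and the derivative at 0 of an even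
      function is 0.\<close>
    have "((\<lambda>s. H (z(k := sqrt (0 + s\<^sup>2)))) has_vector_derivative 0) (at 0)"
    proof (rule has_vector_derivative_transform_within_open[OF d0])
      show "open S" "0 \<in> S" using S True by auto
      fix s assume s: "s \<in> S"
      have "H ((z(k := s))(k := - (z(k := s)) k)) = H (z(k := s))"
        using H(2) u S(3)[OF s] unfolding ev_def parity_def k_def by (metis atLeastAtMost_iff scaleR_one)
      then show "H (z(k := s)) = H (z(k := sqrt (0 + s\<^sup>2)))"
        by (cases "s \<ge> 0") auto
    qed
    then show ?thesis by (simp add: q yi)
  qed
  then show ?thesis unfolding has_pd_def upd z_def .
qed

lemma index_cases:
  assumes "i < n'"
  obtains "i \<le> t 0" | u where "1 \<le> u" "u \<le> \<sigma>" "i \<in> blk u" | h where "1 \<le> h" "h \<le> \<tau> - \<sigma>" "i = t \<sigma> + h"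
proof -
  consider "i \<le> t 0" | "t 0 < i" "i \<le> t \<sigma>" | "t \<sigma> < i" by linarith
  then show thesis
  proof cases
    case 2
    then show thesis using block_exists[OF 2 \<sigma>_le] that(2) by blast
  next
    case 3
    then show thesis using assms by (intro that(3)[of "i - t \<sigma>"]) (auto simp: n'_def)
  qed (use that in blast)
qed

lemma smooth_on_c_nu:
  fixes H :: "(nat \<Rightarrow> real) \<Rightarrow> 'a::euclidean_space"
  assumes H: "smooth_on_c n D H" "ev H"
  shows "smooth_on_c n' D' (\<lambda>y. H (nu y))"
proof -
  define X where "X = {\<lambda>y. H (nu y) | H :: (nat \<Rightarrow> real) \<Rightarrow> 'a. smooth_on_c n D H \<and> ev H}"
  have XI: "(\<lambda>y. H (nu y)) \<in> X" if "smooth_on_c n D H" "ev H" for H :: "(nat \<Rightarrow> real) \<Rightarrow> 'a"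
    using that unfolding X_def by blast
  show ?thesis
  proof (rule smooth_on_c_coord_module[OF copen_D', of X])
    show "(\<lambda>y. H (nu y)) \<in> coord_module X" by (rule coord_module.base[OF XI[OF H]])
  next
    fix h assume "h \<in> X"
    then obtain H :: "(nat \<Rightarrow> real) \<Rightarrow> 'a" where h: "h = (\<lambda>y. H (nu y))" "smooth_on_c n D H" by (auto simp: X_def)
    show "continuous_on D' h" unfolding h(1)
      by (rule continuous_on_compose2[OF smooth_on_c_continuous[OF h(2)] continuous_nu]) (auto simp: D'_iff)
  next
    fix h i assume "h \<in> X" and i: "i < n'"
    then obtain H :: "(nat \<Rightarrow> real) \<Rightarrow> 'a" where h: "h = (\<lambda>y. H (nu y))" "smooth_on_c n D H" "ev H" by (auto simp: X_def)
    then have R: "reg_on C_infinity n D H" by (simp add: reg_on_def)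
    from i show "\<exists>g\<in>coord_module X. \<forall>y\<in>D'. has_pd i h (g y) y"
    proof (cases rule: index_cases)
      case 1
      have "(\<lambda>y. pd i H (nu y)) \<in> coord_module X"
        using 1 h(2) by (intro coord_module.base XI ev_pd[OF R h(3)] smooth_on_c_pd) (auto simp: n_def)
      then show ?thesis by (rule rev_bexI) (use has_pd_nu_head[OF R _ 1] h(1) in blast)
    next
      case (2 u)
      have "Eq u H \<in> {H. smooth_on_c n D H \<and> ev H}"
        using reg_on_Eq[OF R h(3) 2(1,2)] ev_Eq[OF R h(3) 2(1,2)] by (simp add: reg_on_def)
      then have "(\<lambda>y. y i *\<^sub>R Eq u H (nu y)) \<in> coord_module X"
        by (intro coord_module.mult coord_module.base XI) auto
      then show ?thesis by (rule rev_bexI) (use has_pd_nu_block[OF R h(3) _ 2] h(1) in blast)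
    next
      case (3 k)
      have "(\<lambda>y. pd (t 0 + \<sigma> + k) H (nu y)) \<in> coord_module X"
        using 3 h(2) by (intro coord_module.base XI ev_pd[OF R h(3)] smooth_on_c_pd) (auto simp: n_def)
      then show ?thesis by (rule rev_bexI) (use has_pd_nu_tail[OF R _ 3(1,2)] h(1) 3(3) in blast)
    qed
  qed
qed

text \<open>Applied to properties stable under shrinking, in the form provided by
  \<open>psb_small\<close>.\<close>

lemma radius_uniform:
  fixes m :: nat
  assumes "\<And>i. i < m \<Longrightarrow> \<exists>r0>0::real. \<forall>r. 0 < r \<longrightarrow> r \<le> r0 \<longrightarrow> P i r"
  shows "\<exists>r>0. \<forall>i<m. P i r"
proof -
  have "\<exists>r0>0. \<forall>i<m. \<forall>r. 0 < r \<longrightarrow> r \<le> r0 \<longrightarrow> P i r"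
    using assms
  proof (induction m)
    case (Suc m)
    have "\<exists>r0>0. \<forall>i<m. \<forall>r. 0 < r \<longrightarrow> r \<le> r0 \<longrightarrow> P i r"
      by (rule Suc.IH, rule Suc.prems) simp
    then obtain r1 where r1: "r1 > 0" "\<forall>i<m. \<forall>r. 0 < r \<longrightarrow> r \<le> r1 \<longrightarrow> P i r" by (elim exE conjE)
    obtain r2 where r2: "r2 > 0" "\<forall>r. 0 < r \<longrightarrow> r \<le> r2 \<longrightarrow> P m r"
      using Suc.prems[of m] by auto
    show ?case using r1 r2 by (intro exI[of _ "min r1 r2"]) (auto simp: less_Suc_eq)
  qed (auto intro: exI[of _ 1])
  then obtain r0 where "r0 > 0" "\<forall>i<m. \<forall>r. 0 < r \<longrightarrow> r \<le> r0 \<longrightarrow> P i r" by blast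
  then show ?thesis by (intro exI[of _ r0]) auto
qed

text \<open>At a centre where the norm of a block is positive, this norm is analytic as the square
  root of a positive polynomial. Where it vanishes, only its square is analytic, and this is enough
  because H is even in that coordinate.\<close>

lemma ranalytic_on_c_nu:
  fixes H :: "(nat \<Rightarrow> real) \<Rightarrow> 'a::euclidean_space"
  assumes H: "ranalytic_on_c n D H" "ev H"
  shows "ranalytic_on_c n' D' (\<lambda>y. H (nu y))"
  unfolding ranalytic_on_c_iff_psb[OF copen_D']
proof
  fix c' assume c': "c' \<in> D'"
  define c where "c = nu c'"
  have c: "c \<in> D" and cs: "c' \<in> cspace n'" using c' by (auto simp: c_def D'_iff)
  obtain R0 B where R0: "psb n c R0 H B" using H(1) c unfolding ranalytic_on_c_iff_psb[OF copen_D] by blast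
  obtain R1 where R1: "R1 > 0" "cbx n c R1 \<subseteq> D" using cbx_sub_copen[OF copen_D c] by blast
  define R where "R = min R0 R1"
  have Rpos: "R > 0" using psb_pos[OF R0] R1 by (simp add: R_def)
  have R: "psb n c R H B" using Rpos by (intro psb_shrink[OF R0]) (auto simp: R_def)
  have RD: "cbx n c R \<subseteq> D" using R1 cbx_mono[of R R1 n c] by (auto simp: R_def)
  \<comment> \<open>The norms that vanish at the centre, entering only through their
    squares.\<close>
  define Z where "Z = {i. t 0 < i \<and> i \<le> t 0 + \<sigma> \<and> c i = 0}"
  have coord: "\<exists>r0>0. \<forall>r. 0 < r \<longrightarrow> r \<le> r0 \<longrightarrow> psb n' c' r (\<lambda>y. y j - c' j) R" if "j < n'" for j
    using that Rpos by (intro exI[of _ R]) (auto intro: psb_mono[OF psb_coord])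
  have "\<exists>r0>0. \<forall>r. 0 < r \<longrightarrow> r \<le> r0 \<longrightarrow> 
      (if i \<in> Z then psb n' c' r (\<lambda>y. (nu y i)\<^sup>2) (R\<^sup>2) else psb n' c' r (\<lambda>y. nu y i - c i) R)" if i: "i < n" for i
  proof -
    consider "i \<le> t 0" | u where "i = t 0 + u" "1 \<le> u" "u \<le> \<sigma>" | "t 0 + \<sigma> < i"
    proof -
      assume a: "i \<le> t 0 \<Longrightarrow> thesis" "\<And>u. i = t 0 + u \<Longrightarrow> 1 \<le> u \<Longrightarrow> u \<le> \<sigma> \<Longrightarrow> thesis" "t 0 + \<sigma> < i \<Longrightarrow> thesis"
      show thesis using a(1) a(2)[of "i - t 0"] a(3) by linarith
    qed
    then show ?thesis
    proof cases
      case 1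
      then have "i \<notin> Z" "i < n'" using t_le[of 0 \<sigma>] \<sigma>_le by (auto simp: Z_def n'_def)
      then show ?thesis using coord[of i] 1 by (simp add: c_def nu_def)
    next
      case 3
      then have "i \<notin> Z" "t \<sigma> + (i - t 0 - \<sigma>) < n'" using i \<sigma>_le by (auto simp: Z_def n'_def n_def)
      then show ?thesis using coord[of "t \<sigma> + (i - t 0 - \<sigma>)"] 3 i by (simp add: c_def nu_def)
    next
      case (2 u)
      define P where "P = (\<lambda>y::nat \<Rightarrow> real. \<Sum>s\<in>blk u. (y s)\<^sup>2)"
      have nuP: "nu y i = sqrt (P y)" for y using 2 by (simp add: nu_block blocknorm_def P_def blk_def)
      have P0: "0 \<le> P y" for y unfolding P_def by (intro sum_nonneg) auto
      \<comment> \<open>Polynomials are power series on every box; the radius 1 is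
        arbitrary.\<close>
      have "psb n' c' 1 P (\<Sum>s\<in>blk u. (1 + \<bar>c' s\<bar>)\<^sup>2)"
        unfolding P_def
      proof (rule psb_sum)
        fix s assume "s \<in> blk u"
        then have "s < n'" using blk_range 2 by blast
        then have "psb n' c' 1 (\<lambda>y. (y s - c' s) + c' s) (1 + norm (c' s))"
          by (intro psb_add psb_coord psb_const) auto
        then have "psb n' c' 1 (\<lambda>y. y s) (1 + \<bar>c' s\<bar>)" by simp
        then show "psb n' c' 1 (\<lambda>y. (y s)\<^sup>2) ((1 + \<bar>c' s\<bar>)\<^sup>2)" by (rule psb_power)
      qed (auto simp: blk_def)
      then obtain BP where P: "psb n' c' 1 P BP" by blast
      have ciP: "c i = sqrt (P c')" by (simp add: c_def nuP)
      show ?thesis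
      proof (cases "P c' = 0")
        case True
        have "i \<in> Z" using 2 True ciP by (simp add: Z_def)
        moreover have "(nu y i)\<^sup>2 = P y" for y by (simp add: nuP P0)
        ultimately show ?thesis using psb_small[OF P cs True, of "R\<^sup>2"] Rpos by simp
      next
        case False
        then have "P c' > 0" using P0[of c'] by linarith
        from psb_sqrt[OF P cs this] obtain r B' where rB: "psb n' c' r (\<lambda>y. sqrt (P y)) B'" by blast
        have "psb n' c' r (\<lambda>y. sqrt (P y) + (- c i)) (B' + norm (- c i))"
          by (rule psb_add[OF rB psb_const[OF psb_pos[OF rB]]])
        then have "psb n' c' r (\<lambda>y. nu y i - c i) (B' + norm (- c i))" by (simp add: nuP)
        from psb_small[OF this cs _ Rpos] 
        have "\<exists>r0>0. \<forall>r. 0 < r \<longrightarrow> r \<le> r0 \<longrightarrow> psb n' c' r (\<lambda>y. nu y i - c i) R" by (simp add: c_def)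
        moreover have "i \<notin> Z" using False ciP by (simp add: Z_def)
        ultimately show ?thesis by simp
      qed
    qed
  qed
  then have "\<exists>r>0. \<forall>i<n. if i \<in> Z then psb n' c' r (\<lambda>y. (nu y i)\<^sup>2) (R\<^sup>2) else psb n' c' r (\<lambda>y. nu y i - c i) R"
    by (rule radius_uniform)
  then obtain r where r: "r > 0" "\<And>i. i < n \<Longrightarrow> if i \<in> Z then psb n' c' r (\<lambda>y. (nu y i)\<^sup>2) (R\<^sup>2) else psb n' c' r (\<lambda>y. nu y i - c i) R" by blast
  have Zn: "Z \<subseteq> {..<n}" using \<sigma>_le by (auto simp: Z_def n_def)
  have "psb n' c' r (\<lambda>y. H (nu y)) B"
  proof (rule psb_compose_even[OF R Zn _ _ r(1)])
    show "c i = 0" if "i \<in> Z" for i using that by (simp add: Z_def)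
    show "H (y(i := - y i)) = H y" if "y \<in> cbx n c R" "i \<in> Z" for y i
    proof -
      have "i - t 0 \<in> {1..\<sigma>}" "t 0 + (i - t 0) = i" "y \<in> D" using that RD by (auto simp: Z_def)
      then show ?thesis using H(2) unfolding ev_def parity_def by (metis scaleR_one)
    qed
    show "psb n' c' r (\<lambda>y. nu y i - c i) R" if "i < n" "i \<notin> Z" for i using r(2)[of i] that by simp
    show "psb n' c' r (\<lambda>y. (nu y i)\<^sup>2) (R\<^sup>2)" if "i \<in> Z" for i using r(2)[of i] that Zn by auto
    show "nu y \<in> cbx n c R" if y: "y \<in> cbx n' c' r" for y
    proof -
      have "\<bar>nu y i - c i\<bar> \<le> R" if i: "i < n" for i
      proof (cases "i \<in> Z")
        case True
        then have "psb n' c' r (\<lambda>y. (nu y i)\<^sup>2) (R\<^sup>2)" using r(2)[OF i] by simp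
        from psb_norm_le[OF this y] have "\<bar>nu y i\<bar> \<le> R" 
          using Rpos abs_le_square_iff[of "nu y i" R] by simp
        then show ?thesis using True by (simp add: Z_def)
      next
        case False
        then have "psb n' c' r (\<lambda>y. nu y i - c i) R" using r(2)[OF i] by simp
        from psb_norm_le[OF this y] show ?thesis by simp
      qed
      then show ?thesis by (simp add: cbx_def nu_cspace)
    qed
  qed
  then show "\<exists>r B. psb n' c' r (\<lambda>y. H (nu y)) B" by blast
qed

lemma reg_on_nu:
  fixes H :: "(nat \<Rightarrow> real) \<Rightarrow> 'a::euclidean_space"
  assumes "reg_on p n D H" "ev H"
  shows "reg_on p n' D' (\<lambda>y. H (nu y))"
  using assms smooth_on_c_nu ranalytic_on_c_nu by (cases p) (auto simp: reg_on_def)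

end

section \<open>Slice functions and their stem functions\<close>

text \<open>The product of \<open>Jprod\<close> over an arbitrary list: inductions run over lists,
  while the sets of \<open>Jprod\<close> enter through their sorted lists.\<close>

definition lprod :: "(nat \<Rightarrow> 'a::monoid_mult) \<Rightarrow> nat list \<Rightarrow> 'a" where
  "lprod J xs = foldr (*) (map J xs) 1"

lemma lprod_simps [simp]: "lprod J [] = 1" "lprod J (x # xs) = J x * lprod J xs"
  by (simp_all add: lprod_def)

lemma Jprod_lprod: "Jprod J K = lprod J (sorted_list_of_set K)"
  by (simp add: Jprod_def lprod_def)

lemma lprod_append: "lprod J (xs @ ys) = lprod J xs * lprod J ys"
  by (induction xs) (auto simp: mult.assoc)

lemma lprod_cong: "(\<And>x. x \<in> set xs \<Longrightarrow> J x = J' x) \<Longrightarrow> lprod J xs = lprod J' xs"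
  by (induction xs) auto

lemma lprod_scaleR:
  fixes J :: "nat \<Rightarrow> 'a::real_algebra_1"
  shows "lprod (\<lambda>h. c h *\<^sub>R J h) xs = (prod_list (map c xs)) *\<^sub>R lprod J xs"
  by (induction xs) auto

lemma lprod_anticommute:
  fixes J :: "nat \<Rightarrow> 'a::real_algebra_1"
  assumes "\<And>x. x \<in> set xs \<Longrightarrow> a * J x = - (J x * a)"
  shows "a * lprod J xs = (-1) ^ length xs *\<^sub>R (lprod J xs * a)"
  using assms
proof (induction xs)
  case (Cons x xs)
  have "a * lprod J (x # xs) = (a * J x) * lprod J xs" by (simp add: mult.assoc)
  also have "\<dots> = - (J x * (a * lprod J xs))" using Cons.prems[of x] by (simp add: mult.assoc)
  also have "\<dots> = (-1) ^ length (x # xs) *\<^sub>R (lprod J (x # xs) * a)" 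
    using Cons by (simp add: mult.assoc)
  finally show ?case .
qed simp

lemma lprod_lprod_anticommute:
  fixes J J' :: "nat \<Rightarrow> 'a::real_algebra_1"
  assumes "\<And>x z. x \<in> set xs \<Longrightarrow> z \<in> set zs \<Longrightarrow> J x * J' z = - (J' z * J x)"
  shows "lprod J xs * lprod J' zs = (-1) ^ (length xs * length zs) *\<^sub>R (lprod J' zs * lprod J xs)"
  using assms
proof (induction xs)
  case (Cons x xs)
  have "lprod J (x # xs) * lprod J' zs = J x * (lprod J xs * lprod J' zs)" by (simp add: mult.assoc)
  also have "lprod J xs * lprod J' zs = (-1) ^ (length xs * length zs) *\<^sub>R (lprod J' zs * lprod J xs)"
    using Cons by simp
  also have "J x * \<dots> = (-1) ^ (length xs * length zs) *\<^sub>R ((J x * lprod J' zs) * lprod J xs)"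
    by (simp add: mult.assoc)
  also have "J x * lprod J' zs = (-1) ^ length zs *\<^sub>R (lprod J' zs * J x)"
    by (rule lprod_anticommute) (use Cons.prems in auto)
  finally show ?case by (simp add: mult.assoc power_add mult.commute)
qed simp

text \<open>Every factor has the left inverse \<open>- J x\<close>.\<close>

lemma lprod_cancel:
  fixes J :: "nat \<Rightarrow> 'a::real_algebra_1"
  assumes "\<And>x. x \<in> set xs \<Longrightarrow> J x * J x = -1" "lprod J xs * a = 0"
  shows "a = 0"
  using assms
proof (induction xs)
  case (Cons x xs)
  have "J x * (lprod J (x # xs) * a) = (J x * J x) * (lprod J xs * a)" by (simp add: mult.assoc)
  then have "lprod J xs * a = 0" using Cons.prems by simp
  then show ?case using Cons by simp
qed simp

text \<open>Ordered products are multilinear in their factors. For \<open>J h = x^h\<close> this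
  makes the product affine in each coordinate, which governs its derivatives.\<close>

lemma lprod_linear_slot:
  fixes J :: "nat \<Rightarrow> 'a::real_algebra_1"
  assumes "distinct xs" "u \<in> set xs"
  shows "linear (\<lambda>z. lprod (J(u := z)) xs)"
  using assms
proof (induction xs)
  case (Cons x xs)
  show ?case
  proof (cases "x = u")
    case True
    then have "lprod (J(u := z)) xs = lprod J xs" for z using Cons.prems by (intro lprod_cong) auto
    then have "lprod (J(u := z)) (x # xs) = z * lprod J xs" for z using True by simp
    then show ?thesis by (auto intro!: linearI simp only: distrib_right mult_scaleR_left)
  next
    case False
    then have L: "linear (\<lambda>z. lprod (J(u := z)) xs)" using Cons.prems by (intro Cons.IH) auto
    have "lprod (J(u := z)) (x # xs) = J x * lprod (J(u := z)) xs" for z using False by simp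
    then show ?thesis
      by (auto intro!: linearI simp only: linear_add[OF L] linear_scale[OF L] distrib_left mult_scaleR_right)
  qed
qed simp

lemma Jprod_cong: "finite K \<Longrightarrow> (\<And>h. h \<in> K \<Longrightarrow> J h = J' h) \<Longrightarrow> Jprod J K = Jprod J' K"
  unfolding Jprod_lprod by (rule lprod_cong) simp

lemma Jprod_scaleR:
  fixes J :: "nat \<Rightarrow> 'a::real_algebra_1"
  assumes "finite K"
  shows "Jprod (\<lambda>h. c h *\<^sub>R J h) K = (\<Prod>h\<in>K. c h) *\<^sub>R Jprod J K"
proof -
  have "prod_list (map c (sorted_list_of_set K)) = (\<Prod>h\<in>K. c h)"
    using assms prod.distinct_set_conv_list[of "sorted_list_of_set K" c] by simp
  then show ?thesis by (simp add: Jprod_lprod lprod_scaleR)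
qed

lemma Jprod_Un_less:
  assumes "finite A" "finite B" "\<And>a b. a \<in> A \<Longrightarrow> b \<in> B \<Longrightarrow> a < b"
  shows "Jprod J (A \<union> B) = Jprod J A * Jprod J B"
proof -
  have "sorted_list_of_set (A \<union> B) = sorted_list_of_set A @ sorted_list_of_set B"
    by (rule sorted_distinct_set_unique) (use assms in \<open>force simp: sorted_append\<close>)+
  then show ?thesis by (simp add: Jprod_lprod lprod_append)
qed

lemma Jprod_shift:
  assumes "finite K"
  shows "Jprod J ((+) k ` K) = Jprod (\<lambda>h. J (k + h)) K"
proof -
  have "sorted_list_of_set ((+) k ` K) = map ((+) k) (sorted_list_of_set K)"
    by (rule sorted_distinct_set_unique) 
       (use assms in \<open>auto simp: distinct_map sorted_map sorted_wrt_mono_rel[of _ "(\<le>)"]\<close>)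
  moreover have "lprod J (map ((+) k) xs) = lprod (\<lambda>h. J (k + h)) xs" for xs
    by (induction xs) auto
  ultimately show ?thesis by (simp add: Jprod_lprod)
qed

lemma Jprod_anticommute:
  fixes J J' :: "nat \<Rightarrow> 'a::real_algebra_1"
  assumes "finite A" "finite B" "\<And>x z. x \<in> A \<Longrightarrow> z \<in> B \<Longrightarrow> J x * J' z = - (J' z * J x)"
  shows "Jprod J A * Jprod J' B = (-1) ^ (card A * card B) *\<^sub>R (Jprod J' B * Jprod J A)"
  unfolding Jprod_lprod
  using lprod_lprod_anticommute[of "sorted_list_of_set A" "sorted_list_of_set B" J J'] assms by simp

lemma Jprod_cancel:
  fixes J :: "nat \<Rightarrow> 'a::real_algebra_1"
  assumes "finite K" "\<And>h. h \<in> K \<Longrightarrow> J h * J h = -1" "Jprod J K * a = 0"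
  shows "a = 0"
  using lprod_cancel[of "sorted_list_of_set K" J a] assms by (simp add: Jprod_lprod)

lemma Jprod_linear_slot:
  fixes J :: "nat \<Rightarrow> 'a::real_algebra_1"
  assumes "finite K" "u \<in> K"
  shows "linear (\<lambda>z. Jprod (J(u := z)) K)"
  unfolding Jprod_lprod by (rule lprod_linear_slot) (use assms in auto)

text \<open>Two encodings of the same point of A may differ in the signs of the
  \<open>\<beta>\<^sub>h\<close>. One is reached from the other by flipping the differing signs one
  at a time, with membership in D carried along.\<close>

lemma sign_change:
  assumes S: "finite S" "\<And>i. i \<in> S \<Longrightarrow> parity D i 1 H" 
    and y: "y \<in> D" "\<And>j. j \<notin> S \<Longrightarrow> z j = y j" "\<And>j. j \<in> S \<Longrightarrow> \<bar>z j\<bar> = \<bar>y j\<bar>"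
  shows "z \<in> D \<and> H z = H y"
  using S y
proof (induction S arbitrary: y rule: finite_induct)
  case empty
  then have "z = y" by auto
  then show ?case using empty by simp
next
  case (insert i S)
  define w where "w = (if z i = y i then y else y(i := - y i))"
  have w: "w \<in> D" "H w = H y" using insert.prems(1)[of i] insert.prems(2) by (auto simp: w_def parity_def)
  have zi: "z i = y i \<or> z i = - y i" using insert.prems(4)[of i] by (auto simp: abs_eq_iff)
  have "z \<in> D \<and> H z = H w"
  proof (rule insert.IH)
    show "parity D k 1 H" if "k \<in> S" for k using insert.prems(1) that by blast
    show "z j = w j" if "j \<notin> S" for j 
      using insert.prems(3)[of j] that zi by (cases "j = i") (auto simp: w_def)
    show "\<bar>z j\<bar> = \<bar>w j\<bar>" if "j \<in> S" for j
      using insert.prems(4)[of j] that by (auto simp: w_def)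
  qed (rule w)
  then show ?case using w by simp
qed

lemma prod_flip:
  fixes y :: "nat \<Rightarrow> real"
  assumes K: "finite K"
  shows "(\<Prod>k\<in>K. (y(m + h := - y (m + h))) (m + k)) = (if h \<in> K then -1 else 1) * (\<Prod>k\<in>K. y (m + k))"
proof (cases "h \<in> K")
  case True
  let ?y = "y(m + h := - y (m + h))"
  have "(\<Prod>k\<in>K - {h}. ?y (m + k)) = (\<Prod>k\<in>K - {h}. y (m + k))" by (rule prod.cong) auto
  then show ?thesis using True prod.remove[OF K True, of "\<lambda>k. ?y (m + k)"] 
      prod.remove[OF K True, of "\<lambda>k. y (m + k)"] by simp
next
  case False
  then have "(\<Prod>k\<in>K. (y(m + h := - y (m + h))) (m + k)) = (\<Prod>k\<in>K. y (m + k))" by (intro prod.cong) auto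
  then show ?thesis using False by simp
qed

lemma parity_lapl:
  fixes G :: "(nat \<Rightarrow> real) \<Rightarrow> 'a::euclidean_space"
  assumes D: "copen n D" and G: "reg_on p n D G" and i: "i < n" and par: "parity D i e G"
  shows "parity D i e (lapl n G)"
proof -
  have "parity D i e (pd j (pd j G))" if j: "j < n" for j
  proof (cases "j = i")
    case True
    have "parity D i (- (- e)) (pd i (pd i G))"
      by (rule parity_pd_same[OF D i parity_pd_same[OF D i par]]) 
         (auto intro!: reg_on_has_pd[OF D] reg_on_pd[OF D] G i)
    then show ?thesis using True by simp
  next
    case False
    then show ?thesis
      by (intro parity_pd_other[OF D j False parity_pd_other[OF D j False par]]) 
         (auto intro!: reg_on_has_pd[OF D] reg_on_pd[OF D] G j)
  qed
  then show ?thesis using par by (auto simp: parity_def lapl_def scaleR_sum_right)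
qed

lemma lapl_cong:
  assumes D: "copen n D" and "\<And>y. y \<in> D \<Longrightarrow> G y = G' y" "y \<in> D"
  shows "lapl n G y = lapl n G' y"
  unfolding lapl_def
proof (rule sum.cong[OF refl])
  fix i assume "i \<in> {..<n}"
  then have i: "i < n" by simp
  have "pd i G z = pd i G' z" if "z \<in> D" for z by (rule pd_cong[OF D that i assms(2)])
  then show "pd i (pd i G) y = pd i (pd i G') y" by (rule pd_cong[OF D assms(3) i])
qed

section \<open>Blocks of the basis, the torus and the injectivity of the map from stem functions to
  slice functions\<close>

locale clifford_steps = steps t \<tau> \<sigma> D for t \<tau> \<sigma> D +
  fixes v :: "nat \<Rightarrow> 'a::{euclidean_space, real_algebra_1}" and N :: nat
  assumes orth: "\<And>i j. i \<le> N \<Longrightarrow> j \<le> N \<Longrightarrow> inner (v i) (v j) = (if i = j then 1 else 0)"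
    and v_sq: "\<And>s. 1 \<le> s \<Longrightarrow> s \<le> N \<Longrightarrow> v s * v s = -1"
    and v_anti: "\<And>r s. 1 \<le> r \<Longrightarrow> r \<le> N \<Longrightarrow> 1 \<le> s \<Longrightarrow> s \<le> N \<Longrightarrow> r \<noteq> s \<Longrightarrow> v r * v s = - (v s * v r)"
    and t_last: "t \<tau> = N"
begin

lemma blk_N: "1 \<le> h \<Longrightarrow> h \<le> \<tau> \<Longrightarrow> s \<in> blk h \<Longrightarrow> 1 \<le> s \<and> s \<le> N"
  using t_le[of h \<tau>] t_last by (auto simp: blk_def)

lemma t0_N: "s \<le> t 0 \<Longrightarrow> s \<le> N"
  using t_le[of 0 \<tau>] t_last by simp

lemma finite_blk: "finite (blk h)"
  by (simp add: blk_def)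

lemma span_blk:
  assumes h: "1 \<le> h" "h \<le> \<tau>" and x: "x \<in> span (v ` blk h)"
  shows "x = (\<Sum>s\<in>blk h. inner x (v s) *\<^sub>R v s)"
proof -
  have "linear (\<lambda>x::'a. x)" by (rule linear_ident)
  moreover have "linear (\<lambda>x. \<Sum>s\<in>blk h. inner x (v s) *\<^sub>R v s)"
    by (auto intro!: linearI simp: inner_add_left scaleR_add_left sum.distrib scaleR_sum_right)
  moreover have "r = (\<Sum>s\<in>blk h. inner r (v s) *\<^sub>R v s)" if r: "r \<in> v ` blk h" for r
  proof -
    obtain k where k: "k \<in> blk h" "r = v k" using r by blast
    have "(\<Sum>s\<in>blk h. inner r (v s) *\<^sub>R v s) = (\<Sum>s\<in>blk h. if s = k then v k else 0)"
      using k blk_N[OF h] by (intro sum.cong) (auto simp: orth)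
    then show ?thesis using k finite_blk by simp
  qed
  ultimately show ?thesis using x linear_eq_on_span by blast
qed

lemma inner_blk_sum:
  assumes "A \<subseteq> {..N}" "r \<le> N" 
  shows "inner (\<Sum>s\<in>A. a s *\<^sub>R v s) (v r) = (if r \<in> A then a r else 0)"
proof -
  have fA: "finite A" using assms(1) finite_subset by blast
  have "inner (\<Sum>s\<in>A. a s *\<^sub>R v s) (v r) = (\<Sum>s\<in>A. if s = r then a r else 0)"
    unfolding inner_sum_left using assms by (intro sum.cong) (auto simp: orth)
  then show ?thesis using fA by simp
qed

lemma norm_blk_sum:
  assumes "A \<subseteq> {..N}"
  shows "norm (\<Sum>s\<in>A. a s *\<^sub>R v s) = sqrt (\<Sum>s\<in>A. (a s)\<^sup>2)"
proof -
  have "inner (\<Sum>s\<in>A. a s *\<^sub>R v s) (\<Sum>s\<in>A. a s *\<^sub>R v s) = (\<Sum>r\<in>A. a r * inner (\<Sum>s\<in>A. a s *\<^sub>R v s) (v r))"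
    by (simp only: inner_sum_right inner_scaleR_right)
  also have "\<dots> = (\<Sum>r\<in>A. (a r)\<^sup>2)"
    using assms inner_blk_sum[OF assms] by (intro sum.cong) (auto simp: power2_eq_square)
  finally show ?thesis by (simp add: norm_eq_sqrt_inner)
qed

lemma blk_sub: "1 \<le> h \<Longrightarrow> h \<le> \<tau> \<Longrightarrow> blk h \<subseteq> {..N}"
  using blk_N by blast

lemma torusD:
  assumes "J \<in> torus t \<tau> v" "1 \<le> h" "h \<le> \<tau>"
  shows "J h \<in> span (v ` blk h)" "norm (J h) = 1"
  using assms by (auto simp: torus_def sph_def blk_def)

lemma blk_anticommute:
  assumes h: "1 \<le> h" "h \<le> \<tau>" "1 \<le> k" "k \<le> \<tau>" "h \<noteq> k"
    and x: "x \<in> span (v ` blk h)" and z: "z \<in> span (v ` blk k)"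
  shows "x * z = - (z * x)"
proof -
  define a b where "a = (\<lambda>s. inner x (v s))" and "b = (\<lambda>s. inner z (v s))"
  have x': "x = (\<Sum>s\<in>blk h. a s *\<^sub>R v s)" and z': "z = (\<Sum>r\<in>blk k. b r *\<^sub>R v r)"
    unfolding a_def b_def using span_blk h x z by blast+
  have "x * z = (\<Sum>s\<in>blk h. \<Sum>r\<in>blk k. (a s * b r) *\<^sub>R (v s * v r))"
    unfolding x' z' sum_product by (simp add: mult.commute)
  also have "\<dots> = (\<Sum>s\<in>blk h. \<Sum>r\<in>blk k. - ((a s * b r) *\<^sub>R (v r * v s)))"
  proof (intro sum.cong refl)
    fix s r assume s: "s \<in> blk h" "r \<in> blk k"
    then have "s \<noteq> r" using block_unique h by blast
    then have "v s * v r = - (v r * v s)" using s h blk_N by (intro v_anti) blast+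
    then show "(a s * b r) *\<^sub>R (v s * v r) = - ((a s * b r) *\<^sub>R (v r * v s))" by simp
  qed
  also have "\<dots> = - (\<Sum>r\<in>blk k. \<Sum>s\<in>blk h. (b r * a s) *\<^sub>R (v r * v s))"
    by (subst sum.swap) (simp add: sum_negf mult.commute)
  also have "\<dots> = - (z * x)"
    unfolding x' z' sum_product by (simp add: mult.commute)
  finally show ?thesis .
qed

lemma torus_sq:
  assumes J: "J \<in> torus t \<tau> v" and h: "1 \<le> h" "h \<le> \<tau>"
  shows "J h * J h = -1"
proof -
  define a where "a = (\<lambda>s. inner (J h) (v s))"
  have x: "J h = (\<Sum>s\<in>blk h. a s *\<^sub>R v s)"
    unfolding a_def using span_blk h torusD[OF J h] by blast
  have "sqrt (\<Sum>s\<in>blk h. (a s)\<^sup>2) = 1"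
    using norm_blk_sum[OF blk_sub[OF h], of a] torusD(2)[OF J h] by (simp add: x)
  then have a1: "(\<Sum>s\<in>blk h. (a s)\<^sup>2) = 1" by simp
  define X where "X = (\<Sum>s\<in>blk h. \<Sum>r\<in>blk h. (a s * a r) *\<^sub>R (v s * v r))"
  have JX: "J h * J h = X" unfolding x sum_product X_def by (simp add: mult.commute)
  \<comment> \<open>Symmetrizing the double sum leaves only the diagonal:
    \<open>v s * v r + v r * v s\<close> is 0 for different indices and -2 for equal ones.\<close>
  have "X + X = X + (\<Sum>s\<in>blk h. \<Sum>r\<in>blk h. (a s * a r) *\<^sub>R (v r * v s))"
    unfolding X_def by (subst (3) sum.swap) (simp add: mult.commute)
  also have "\<dots> = (\<Sum>s\<in>blk h. \<Sum>r\<in>blk h. (a s * a r) *\<^sub>R (v s * v r + v r * v s))"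
    unfolding X_def by (simp add: sum.distrib[symmetric] scaleR_add_right)
  also have "\<dots> = (\<Sum>s\<in>blk h. \<Sum>r\<in>blk h. if r = s then (-2 * (a s)\<^sup>2) *\<^sub>R 1 else 0)"
  proof (intro sum.cong refl)
    fix s r assume s: "s \<in> blk h" "r \<in> blk h"
    show "(a s * a r) *\<^sub>R (v s * v r + v r * v s) = (if r = s then (-2 * (a s)\<^sup>2) *\<^sub>R 1 else 0)"
    proof (cases "r = s")
      case True
      have "v s * v s = -1" using s h blk_N by (intro v_sq) blast+
      then show ?thesis using True
        by (simp add: power2_eq_square scaleR_minus_right flip: scaleR_2)
    next
      case False
      then have "v s * v r = - (v r * v s)" using s h blk_N by (intro v_anti) blast+
      then show ?thesis using False by simp
    qed
  qed
  also have "\<dots> = (\<Sum>s\<in>blk h. (-2 * (a s)\<^sup>2) *\<^sub>R 1)" by (simp add: finite_blk)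
  also have "\<dots> = (-2 * (\<Sum>s\<in>blk h. (a s)\<^sup>2)) *\<^sub>R (1::'a)"
    by (simp only: scaleR_sum_left[symmetric] sum_distrib_left)
  also have "\<dots> = (-2) *\<^sub>R 1" by (simp add: a1)
  finally have "2 *\<^sub>R X = 2 *\<^sub>R (-1)" by (simp add: scaleR_2)
  then show ?thesis unfolding JX scaleR_cancel_left by simp
qed

lemma stem_parity:
  assumes "is_stem t \<tau> D F" "K \<subseteq> {1..\<tau>}" "1 \<le> h" "h \<le> \<tau>"
  shows "parity D (t 0 + h) (if h \<in> K then -1 else 1) (F K)"
  unfolding parity_def
proof (intro ballI conjI)
  fix y assume y: "y \<in> D"
  have h: "h \<in> {1..\<tau>}" using assms by simp
  show "y(t 0 + h := - y (t 0 + h)) \<in> D"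
    using adm y h unfolding admissible_dom_def bflip_def by blast
  have "F K (bflip t h y) = (if h \<in> K then - F K y else F K y)"
    using assms(1,2) y h unfolding is_stem_def by blast
  then show "F K (y(t 0 + h := - y (t 0 + h))) = (if h \<in> K then -1 else 1) *\<^sub>R F K y"
    by (simp add: bflip_def)
qed

lemma parity_stem:
  assumes "\<And>K h. K \<subseteq> {1..\<tau>} \<Longrightarrow> 1 \<le> h \<Longrightarrow> h \<le> \<tau> \<Longrightarrow> parity D (t 0 + h) (if h \<in> K then -1 else 1) (F K)"
  shows "is_stem t \<tau> D F"
  unfolding is_stem_def
proof (intro allI impI ballI)
  fix K y h assume "K \<subseteq> {1..\<tau>}" "y \<in> D" "h \<in> {1..\<tau>}"
  then show "F K (bflip t h y) = (if h \<in> K then - F K y else F K y)"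
    using assms[of K h] by (auto simp: parity_def bflip_def)
qed

text \<open>Injectivity of \<open>\<I>\<close>: comparing the values at \<open>\<beta>\<close> and at its reflection in \<open>\<beta>\<^sub>h\<close> separates the components
  with \<open>h \<in> K\<close> from those with \<open>h \<notin> K\<close>.\<close>

lemma stem_zero_partial:
  fixes F :: "nat set \<Rightarrow> (nat \<Rightarrow> real) \<Rightarrow> 'a"
  assumes F: "is_stem t \<tau> D F" and zero: "\<And>y. y \<in> D \<Longrightarrow> (\<Sum>K\<in>Pow {1..\<tau>}. Jprod J K * F K y) = 0"
    and S: "finite S" "S \<subseteq> {1..\<tau>}"
  shows "\<forall>A y. A \<subseteq> S \<longrightarrow> y \<in> D \<longrightarrow> (\<Sum>K\<in>{K \<in> Pow {1..\<tau>}. K \<inter> S = A}. Jprod J K * F K y) = 0"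
  using S
proof (induction S rule: finite_induct)
  case empty
  have "{K \<in> Pow {1..\<tau>}. K \<inter> {} = {}} = Pow {1..\<tau>}" by auto
  then show ?case using zero by simp
next
  case (insert h S)
  have h: "1 \<le> h" "h \<le> \<tau>" using insert.prems by auto
  show ?case
  proof (intro allI impI)
    fix A y assume A: "A \<subseteq> insert h S" and y: "y \<in> D"
    define A0 where "A0 = A - {h}"
    define P where "P = {K \<in> Pow {1..\<tau>}. K \<inter> insert h S = A0}"
    define Q where "Q = {K \<in> Pow {1..\<tau>}. K \<inter> insert h S = insert h A0}"
    define y' where "y' = y(t 0 + h := - y (t 0 + h))"
    have A0: "A0 \<subseteq> S" "h \<notin> A0" using A by (auto simp: A0_def)
    have fin: "finite P" "finite Q" by (auto simp: P_def Q_def)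
    have PQ: "{K \<in> Pow {1..\<tau>}. K \<inter> S = A0} = P \<union> Q" "P \<inter> Q = {}"
      using A0 insert.hyps by (auto simp: P_def Q_def)
    have IH: "(\<Sum>K\<in>P. Jprod J K * F K z) + (\<Sum>K\<in>Q. Jprod J K * F K z) = 0" if "z \<in> D" for z
    proof -
      have "(\<Sum>K\<in>P \<union> Q. Jprod J K * F K z) = 0"
        using insert.IH insert.prems A0(1) that unfolding PQ(1)[symmetric] by blast
      then show ?thesis using sum.union_disjoint[OF fin PQ(2)] by metis
    qed
    have par: "y' \<in> D \<and> F K y' = (if h \<in> K then -1 else 1) *\<^sub>R F K y" if "K \<subseteq> {1..\<tau>}" for K
      using stem_parity[OF F that h] y by (auto simp: parity_def y'_def simp del: fun_upd_apply)
    have y': "y' \<in> D" using par[of "{}"] by simp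
    have "(\<Sum>K\<in>P. Jprod J K * F K y') = (\<Sum>K\<in>P. Jprod J K * F K y)"
      using par A0(2) by (intro sum.cong) (auto simp: P_def)
    moreover have "(\<Sum>K\<in>Q. Jprod J K * F K y') = (\<Sum>K\<in>Q. - (Jprod J K * F K y))"
      using par A0(2) by (intro sum.cong) (auto simp: Q_def)
    ultimately have 1: "(\<Sum>K\<in>P. Jprod J K * F K y) - (\<Sum>K\<in>Q. Jprod J K * F K y) = 0"
      using IH[OF y'] by (simp add: sum_negf)
    note 2 = IH[OF y]
    have "2 *\<^sub>R (\<Sum>K\<in>P. Jprod J K * F K y) = 0" using 1 2 by (simp add: scaleR_2)
    then have p: "(\<Sum>K\<in>P. Jprod J K * F K y) = 0" by simp
    then have q: "(\<Sum>K\<in>Q. Jprod J K * F K y) = 0" using 2 by simp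
    have "A = A0 \<or> A = insert h A0" using A by (auto simp: A0_def)
    then show "(\<Sum>K\<in>{K \<in> Pow {1..\<tau>}. K \<inter> insert h S = A}. Jprod J K * F K y) = 0"
      using p q by (auto simp: P_def Q_def)
  qed
qed

text \<open>With all of \<open>{1..\<tau>}\<close> separated, a single term
  \<open>J\<^sub>K F\<^sub>K\<close> remains, and \<open>J\<^sub>K\<close> cancels on the left. One
  J suffices, since D is invariant under the reflections.\<close>

lemma stem_zero:
  assumes F: "is_stem t \<tau> D F" and zero: "\<And>y. y \<in> D \<Longrightarrow> (\<Sum>K\<in>Pow {1..\<tau>}. Jprod J K * F K y) = 0"
    and J: "J \<in> torus t \<tau> v" and K: "K \<subseteq> {1..\<tau>}" and y: "y \<in> D"
  shows "F K y = 0"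
proof -
  have "(\<Sum>K\<in>{K' \<in> Pow {1..\<tau>}. K' \<inter> {1..\<tau>} = K}. Jprod J K * F K y) = 0"
    using stem_zero_partial[OF F zero, of "{1..\<tau>}"] K y by blast
  moreover have "{K' \<in> Pow {1..\<tau>}. K' \<inter> {1..\<tau>} = K} = {K}" using K by auto
  ultimately have JF: "Jprod J K * F K y = 0" by simp
  show ?thesis
  proof (rule Jprod_cancel[OF _ _ JF])
    show "finite K" using K by (rule finite_subset) simp
    show "J h * J h = -1" if "h \<in> K" for h using that K by (intro torus_sq[OF J]) auto
  qed
qed

lemma stem_unique:
  assumes F: "is_stem t \<tau> D F" "induces t \<tau> v D F f" and G: "is_stem t \<tau> D G" "induces t \<tau> v D G f"
    and J: "J \<in> torus t \<tau> v" and K: "K \<subseteq> {1..\<tau>}" and y: "y \<in> D"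
  shows "F K y = G K y"
proof -
  have "is_stem t \<tau> D (\<lambda>K y. F K y - G K y)" using F(1) G(1) by (auto simp: is_stem_def)
  moreover have "(\<Sum>K\<in>Pow {1..\<tau>}. Jprod J K * (F K z - G K z)) = 0" if "z \<in> D" for z
    using F(2) G(2) J that by (simp add: induces_def algebra_simps sum_subtractf)
  ultimately have "F K y - G K y = 0" using stem_zero[OF _ _ J K y] by blast
  then show ?thesis by simp
qed

text \<open>Inner products with the orthonormal basis recover from a point its part
  \<open>\<alpha>\<close> and the products \<open>\<beta>\<^sub>h J\<^sub>h\<close>.\<close>

lemma spt_inner:
  assumes J: "J \<in> torus t \<tau> v"
  shows "s \<le> t 0 \<Longrightarrow> inner (spt t \<tau> v y J) (v s) = y s"
    and "1 \<le> h \<Longrightarrow> h \<le> \<tau> \<Longrightarrow> s \<in> blk h \<Longrightarrow> inner (spt t \<tau> v y J) (v s) = y (t 0 + h) * inner (J h) (v s)"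
proof -
  have Jv: "inner (J k) (v s) = 0" if "k \<in> {1..\<tau>}" "s \<le> N" "s \<notin> blk k" for k s
  proof -
    have "J k = (\<Sum>r\<in>blk k. inner (J k) (v r) *\<^sub>R v r)" using that torusD[OF J] span_blk by auto
    also have "inner \<dots> (v s) = 0" using inner_blk_sum[OF blk_sub, of k s] that by auto
    finally show ?thesis by simp
  qed
  have sub: "{..t 0} \<subseteq> {..N}" using t0_N by auto
  have exp: "inner (spt t \<tau> v y J) (v s) = (if s \<le> t 0 then y s else 0) + (\<Sum>h\<in>{1..\<tau>}. y (t 0 + h) * inner (J h) (v s))" 
    if "s \<le> N" for s
    using inner_blk_sum[OF sub that, of y] by (simp add: spt_def inner_add_left inner_sum_left)
  show "inner (spt t \<tau> v y J) (v s) = y s" if s: "s \<le> t 0"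
  proof -
    have "s \<notin> blk k" if "1 \<le> k" "k \<le> \<tau>" for k
    proof -
      have "k - 1 \<le> \<tau>" using that by linarith
      then show ?thesis using s t_le[of 0 "k - 1"] by (auto simp: blk_def)
    qed
    then have "(\<Sum>h\<in>{1..\<tau>}. y (t 0 + h) * inner (J h) (v s)) = 0"
      using Jv t0_N[OF s] by (intro sum.neutral) auto
    then show ?thesis using exp t0_N[OF s] s by simp
  qed
  show "inner (spt t \<tau> v y J) (v s) = y (t 0 + h) * inner (J h) (v s)" if h: "1 \<le> h" "h \<le> \<tau>" and s: "s \<in> blk h"
  proof -
    have sN: "s \<le> N" using blk_N[OF h s] by simp
    have "h - 1 \<le> \<tau>" using h by linarith
    then have "\<not> s \<le> t 0" using s t_le[of 0 "h - 1"] by (auto simp: blk_def)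
    moreover have "(\<Sum>k\<in>{1..\<tau>}. y (t 0 + k) * inner (J k) (v s)) = (\<Sum>k\<in>{1..\<tau>}. if k = h then y (t 0 + h) * inner (J h) (v s) else 0)"
    proof (intro sum.cong refl)
      fix k assume k: "k \<in> {1..\<tau>}"
      show "y (t 0 + k) * inner (J k) (v s) = (if k = h then y (t 0 + h) * inner (J h) (v s) else 0)"
      proof (cases "k = h")
        case False
        then have "s \<notin> blk k" using block_unique[OF s] h k by auto
        then show ?thesis using Jv k sN False by simp
      qed simp
    qed
    ultimately show ?thesis using exp[OF sN] h by simp
  qed
qed

text \<open>A point determines \<open>\<beta>\<^sub>h J\<^sub>h\<close> but neither the sign of
  \<open>\<beta>\<^sub>h\<close> nor, at \<open>\<beta>\<^sub>h = 0\<close>, the unit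
  \<open>J\<^sub>h\<close>. Writing \<open>\<Phi>\<^sub>K\<close> as the product of the
  \<open>\<beta>\<^sub>h\<close>, \<open>h \<in> K\<close>, times a function even in all
  \<open>\<beta>\<^sub>h\<close> exhibits the value as depending only on the point.\<close>

lemma slice_value_unique:
  assumes \<Phi>: "is_stem t \<tau> D \<Phi>" and y: "y1 \<in> D" "y2 \<in> D" and J: "J1 \<in> torus t \<tau> v" "J2 \<in> torus t \<tau> v"
    and eq: "spt t \<tau> v y1 J1 = spt t \<tau> v y2 J2"
  shows "(\<Sum>K\<in>Pow {1..\<tau>}. Jprod J1 K * \<Phi> K y1) = (\<Sum>K\<in>Pow {1..\<tau>}. Jprod J2 K * \<Phi> K y2)"
proof (intro sum.cong refl)
  fix K assume "K \<in> Pow {1..\<tau>}"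
  then have K: "K \<subseteq> {1..\<tau>}" "finite K" by (auto intro: finite_subset)
  have bJ: "y1 (t 0 + h) *\<^sub>R J1 h = y2 (t 0 + h) *\<^sub>R J2 h" if h: "1 \<le> h" "h \<le> \<tau>" for h
  proof -
    have "y1 (t 0 + h) *\<^sub>R J1 h = (\<Sum>s\<in>blk h. (y1 (t 0 + h) * inner (J1 h) (v s)) *\<^sub>R v s)"
      by (subst span_blk[OF h torusD(1)[OF J(1) h]]) (simp add: scaleR_sum_right)
    also have "\<dots> = (\<Sum>s\<in>blk h. (y2 (t 0 + h) * inner (J2 h) (v s)) *\<^sub>R v s)"
    proof (intro sum.cong refl)
      fix s assume s: "s \<in> blk h"
      show "(y1 (t 0 + h) * inner (J1 h) (v s)) *\<^sub>R v s = (y2 (t 0 + h) * inner (J2 h) (v s)) *\<^sub>R v s"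
        using spt_inner(2)[OF J(1) h s, of y1] spt_inner(2)[OF J(2) h s, of y2] eq by simp
    qed
    also have "\<dots> = y2 (t 0 + h) *\<^sub>R J2 h"
      by (subst (2) span_blk[OF h torusD(1)[OF J(2) h]]) (simp add: scaleR_sum_right)
    finally show ?thesis .
  qed
  \<comment> \<open>No regularity is asked of this quotient: where the product is 0, its value is 0
    by the convention for \<open>inverse\<close>, in agreement with the vanishing of
    \<open>\<Phi> K\<close> there.\<close>
  define H where "H = (\<lambda>y. inverse (\<Prod>h\<in>K. y (t 0 + h)) *\<^sub>R \<Phi> K y)"
  have \<Phi>H: "\<Phi> K y = (\<Prod>h\<in>K. y (t 0 + h)) *\<^sub>R H y" if "y \<in> D" for y
  proof (cases "(\<Prod>h\<in>K. y (t 0 + h)) = 0")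
    case True
    then obtain h where "h \<in> K" "y (t 0 + h) = 0" using K by auto
    then have "\<Phi> K y = 0" using stem_parity[OF \<Phi> K(1), of h] K that parity_odd_zero by fastforce
    then show ?thesis by (simp add: H_def)
  qed (simp add: H_def)
  have summand: "Jprod J K * \<Phi> K y = Jprod (\<lambda>h. y (t 0 + h) *\<^sub>R J h) K * H y" if "y \<in> D" for y J
    by (simp add: \<Phi>H[OF that] Jprod_scaleR[OF K(2)])
  have parH: "parity D (t 0 + h) 1 H" if h: "1 \<le> h" "h \<le> \<tau>" for h
    unfolding parity_def
  proof (intro ballI conjI)
    fix y assume y: "y \<in> D"
    let ?y = "y(t 0 + h := - y (t 0 + h))"
    have p: "?y \<in> D" "\<Phi> K ?y = (if h \<in> K then -1 else 1) *\<^sub>R \<Phi> K y"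
      using stem_parity[OF \<Phi> K(1) h] y unfolding parity_def by blast+
    show "?y \<in> D" by (rule p)
    note prod_flip[OF K(2), of y "t 0" h]
    then show "H ?y = 1 *\<^sub>R H y" unfolding H_def p(2) by simp
  qed
  have "y2 \<in> D \<and> H y2 = H y1"
  proof (rule sign_change[of "(+) (t 0) ` {1..\<tau>}"])
    show "parity D i 1 H" if "i \<in> (+) (t 0) ` {1..\<tau>}" for i using that parH[of "i - t 0"] by force
    show "\<bar>y2 j\<bar> = \<bar>y1 j\<bar>" if j: "j \<in> (+) (t 0) ` {1..\<tau>}" for j
    proof -
      obtain h where "h \<in> {1..\<tau>}" and j: "j = t 0 + h" using j by blast
      then have h: "1 \<le> h" "h \<le> \<tau>" by auto
      have "norm (y1 (t 0 + h) *\<^sub>R J1 h) = norm (y2 (t 0 + h) *\<^sub>R J2 h)" using bJ h by simp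
      then show ?thesis using torusD(2)[OF J(1) h] torusD(2)[OF J(2) h] j by simp
    qed
    show "y2 j = y1 j" if j: "j \<notin> (+) (t 0) ` {1..\<tau>}" for j
    proof (cases "j \<le> t 0")
      case True
      then show ?thesis using spt_inner(1)[OF J(1) True, of y1] spt_inner(1)[OF J(2) True, of y2] eq by simp
    next
      case False
      have "n \<le> j"
      proof (rule ccontr)
        assume "\<not> n \<le> j"
        then have "j = t 0 + (j - t 0)" "j - t 0 \<in> {1..\<tau>}" using False by (auto simp: n_def)
        then show False using j by blast
      qed
      moreover have "y1 \<in> cspace n" "y2 \<in> cspace n" using y copen_D by (auto simp: copen_def)
      ultimately show ?thesis by (simp add: cspace_def)
    qed
  qed (use y in simp_all)
  moreover have "Jprod (\<lambda>h. y1 (t 0 + h) *\<^sub>R J1 h) K = Jprod (\<lambda>h. y2 (t 0 + h) *\<^sub>R J2 h) K"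
    using bJ K by (intro Jprod_cong) auto
  ultimately show "Jprod J1 K * \<Phi> K y1 = Jprod J2 K * \<Phi> K y2" using summand y by metis
qed

lemma is_stem_lapl:
  fixes F :: "nat set \<Rightarrow> (nat \<Rightarrow> real) \<Rightarrow> 'a"
  assumes "stem_reg p t \<tau> D F"
  shows "is_stem t \<tau> D (\<lambda>K. lapl n (F K))"
proof (rule parity_stem)
  fix K h assume K: "K \<subseteq> {1..\<tau>}" "1 \<le> h" "h \<le> \<tau>"
  show "parity D (t 0 + h) (if h \<in> K then -1 else 1) (lapl n (F K))"
  proof (rule parity_lapl[OF copen_D])
    show "reg_on p n D (F K)" using assms K by (simp add: stem_reg_def sdim_n)
    show "parity D (t 0 + h) (if h \<in> K then -1 else 1) (F K)"
      using assms by (intro stem_parity K) (simp add: stem_reg_def)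
  qed (rule idx_less_n[OF K(3)])
qed

text \<open>Resolves the choice in \<open>slap\<close>: another stem function agrees with F on D by
  \<open>stem_unique\<close>, hence has the same Laplacian there, and another representation of the
  point gives the same value by \<open>slice_value_unique\<close>.\<close>

lemma slap_eq:
  assumes F: "stem_reg p t \<tau> D F" "induces t \<tau> v D F f" and y: "y \<in> D" and J: "J \<in> torus t \<tau> v"
  shows "slap p t \<tau> v D f (spt t \<tau> v y J) = (\<Sum>K\<in>Pow {1..\<tau>}. Jprod J K * lapl n (F K) y)"
  unfolding slap_def sdim_n
proof (rule some_equality)
  show "\<exists>G. stem_reg p t \<tau> D G \<and> induces t \<tau> v D G f \<and>
      (\<exists>y'\<in>D. \<exists>J'\<in>torus t \<tau> v. spt t \<tau> v y J = spt t \<tau> v y' J' \<and>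
         (\<Sum>K\<in>Pow {1..\<tau>}. Jprod J K * lapl n (F K) y) = (\<Sum>K\<in>Pow {1..\<tau>}. Jprod J' K * lapl n (G K) y'))"
    using F y J by blast
next
  fix w assume "\<exists>G. stem_reg p t \<tau> D G \<and> induces t \<tau> v D G f \<and>
      (\<exists>y'\<in>D. \<exists>J'\<in>torus t \<tau> v. spt t \<tau> v y J = spt t \<tau> v y' J' \<and>
         w = (\<Sum>K\<in>Pow {1..\<tau>}. Jprod J' K * lapl n (G K) y'))"
  then obtain G y' J' where G: "stem_reg p t \<tau> D G" "induces t \<tau> v D G f" "y' \<in> D" "J' \<in> torus t \<tau> v"
    "spt t \<tau> v y J = spt t \<tau> v y' J'" and w: "w = (\<Sum>K\<in>Pow {1..\<tau>}. Jprod J' K * lapl n (G K) y')" by blast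
  have GF: "G K z = F K z" if "K \<subseteq> {1..\<tau>}" "z \<in> D" for K z
    using stem_unique[OF _ G(2) _ F(2) J that] G(1) F(1) by (auto simp: stem_reg_def)
  have "w = (\<Sum>K\<in>Pow {1..\<tau>}. Jprod J' K * lapl n (F K) y')"
    unfolding w using lapl_cong[OF copen_D GF G(3)] by (intro sum.cong) auto
  also have "\<dots> = (\<Sum>K\<in>Pow {1..\<tau>}. Jprod J K * lapl n (F K) y)"
    by (rule slice_value_unique[OF is_stem_lapl[OF F(1)] G(3) y G(4) J G(5)[symmetric]])
  finally show "w = (\<Sum>K\<in>Pow {1..\<tau>}. Jprod J K * lapl n (F K) y)" .
qed

end

section \<open>Tools for computing the two Laplacians\<close>

lemma has_pd_mult_indep:
  fixes X h :: "(nat \<Rightarrow> real) \<Rightarrow> 'a::{euclidean_space, real_algebra_1}"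
  assumes "\<And>s. X (y(i := s)) = X y" "has_pd i h d y"
  shows "has_pd i (\<lambda>y. X y * h y) (X y * d) y"
  using bounded_linear.has_vector_derivative[OF bounded_linear_mult_left_algebra assms(2)[unfolded has_pd_def], of "X y"]
  by (simp only: has_pd_def assms(1))

lemma has_pd_scaleR_indep:
  assumes "\<And>s. \<phi> (y(i := s)) = \<phi> y" "has_pd i h d y"
  shows "has_pd i (\<lambda>y. \<phi> y *\<^sub>R h y) (\<phi> y *\<^sub>R d) y"
  using bounded_linear.has_vector_derivative[OF bounded_linear_scaleR_right assms(2)[unfolded has_pd_def], of "\<phi> y"]
  by (simp only: has_pd_def assms(1))

text \<open>The product rule when X is affine in the coordinate s with slope
  \<open>\<Lambda>\<close>. The slopes met later do not depend on s, so X contributes no second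
  derivative.\<close>

lemma has_pd_affine_mult:
  fixes X \<Lambda> h :: "(nat \<Rightarrow> real) \<Rightarrow> 'a::{euclidean_space, real_algebra_1}"
  assumes X: "\<And>r. X (y(s := r)) = X y + (r - y s) *\<^sub>R \<Lambda> y" and h: "has_pd s h d y"
  shows "has_pd s (\<lambda>y. X y * h y) (X y * d + \<Lambda> y * h y) y"
proof -
  have h': "((\<lambda>r. h (y(s := r))) has_vector_derivative d) (at (y s))" using h by (simp add: has_pd_def)
  have "((\<lambda>r. r - y s) has_real_derivative 1) (at (y s))" by (auto intro!: derivative_eq_intros)
  from has_vector_derivative_scaleR[OF this bounded_linear.has_vector_derivative[OF bounded_linear_mult_left_algebra h', of "\<Lambda> y"]]
  have 1: "((\<lambda>r. (r - y s) *\<^sub>R (\<Lambda> y * h (y(s := r)))) has_vector_derivative \<Lambda> y * h y) (at (y s))" by simp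
  from has_vector_derivative_add[OF bounded_linear.has_vector_derivative[OF bounded_linear_mult_left_algebra h', of "X y"] 1]
  show ?thesis by (simp add: has_pd_def X distrib_right)
qed

lemma pd_pd_eq:
  assumes D: "copen n D" and y: "y \<in> D" and i: "i < n"
    and 1: "\<And>z. z \<in> D \<Longrightarrow> has_pd i g (g' z) z" and 2: "has_pd i g' d y"
  shows "pd i (pd i g) y = d"
proof (rule has_pd_imp_pd)
  show "has_pd i (pd i g) d y"
    by (rule has_pd_cong[OF D y i _ 2]) (use has_pd_imp_pd[OF 1] in simp)
qed

lemma lapl_sum_scaleR:
  fixes g :: "'b \<Rightarrow> (nat \<Rightarrow> real) \<Rightarrow> 'a::euclidean_space"
  assumes D: "copen n D" and y: "y \<in> D" and fin: "finite I" and g: "\<And>k. k \<in> I \<Longrightarrow> reg_on p n D (g k)"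
  shows "lapl n (\<lambda>y. \<Sum>k\<in>I. c k *\<^sub>R g k y) y = (\<Sum>k\<in>I. c k *\<^sub>R lapl n (g k) y)"
proof -
  have hp: "has_pd i (\<lambda>y. \<Sum>k\<in>I. c k *\<^sub>R h k y) (\<Sum>k\<in>I. c k *\<^sub>R pd i (h k) z) z"
    if "i < n" "z \<in> D" "\<And>k. k \<in> I \<Longrightarrow> reg_on p n D (h k)" for i z and h :: "'b \<Rightarrow> (nat \<Rightarrow> real) \<Rightarrow> 'a"
    unfolding has_pd_def
    using reg_on_has_pd[OF D that(3) that(2,1)]
    by (intro has_vector_derivative_sum bounded_linear.has_vector_derivative[OF bounded_linear_scaleR_right])
       (simp add: has_pd_def)
  have "pd i (pd i (\<lambda>y. \<Sum>k\<in>I. c k *\<^sub>R g k y)) y = (\<Sum>k\<in>I. c k *\<^sub>R pd i (pd i (g k)) y)" if i: "i < n" for i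
    by (rule pd_pd_eq[OF D y i hp[OF i _ g] hp[OF i y reg_on_pd[OF D g i]]])
  then show ?thesis unfolding lapl_def scaleR_sum_right by (subst sum.swap) simp
qed

context steps
begin

lemma sum_blocks:
  fixes g :: "nat \<Rightarrow> 'b::comm_monoid_add"
  assumes "k \<le> \<tau>"
  shows "(\<Sum>s\<le>t k. g s) = (\<Sum>s\<le>t 0. g s) + (\<Sum>u\<in>{1..k}. \<Sum>s\<in>blk u. g s)"
  using assms
proof (induction k)
  case (Suc k)
  have "{..t (Suc k)} = {..t k} \<union> blk (Suc k)" using t_step[of k] Suc.prems by (auto simp: blk_def)
  moreover have "{..t k} \<inter> blk (Suc k) = {}" by (auto simp: blk_def)
  ultimately have "(\<Sum>s\<le>t (Suc k). g s) = (\<Sum>s\<le>t k. g s) + (\<Sum>s\<in>blk (Suc k). g s)"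
    by (simp add: sum.union_disjoint blk_def)
  then show ?case using Suc by (simp add: add.assoc)
qed simp

lemma sum_tail:
  fixes g :: "nat \<Rightarrow> 'b::comm_monoid_add"
  shows "(\<Sum>i<m + 1 + k. g i) = (\<Sum>i\<le>m. g i) + (\<Sum>h\<in>{1..k}. g (m + h))"
proof (induction k)
  case 0 show ?case by (simp add: lessThan_Suc_atMost)
next
  case (Suc k) then show ?case by (simp add: add.assoc)
qed

text \<open>Together with \<open>sum_n\<close> this splits both Laplacians alike into mirror
  coordinates, the first \<open>\<sigma>\<close> steps and the remaining
  \<open>\<beta>\<^sub>h\<close>; the two operators differ only in the middle part.\<close>

lemma sum_n':
  fixes g :: "nat \<Rightarrow> 'b::comm_monoid_add"
  shows "(\<Sum>i<n'. g i) = (\<Sum>i\<le>t 0. g i) + (\<Sum>u\<in>{1..\<sigma>}. \<Sum>s\<in>blk u. g s) + (\<Sum>h\<in>{1..\<tau> - \<sigma>}. g (t \<sigma> + h))"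
  unfolding n'_def sum_tail sum_blocks[OF \<sigma>_le] by simp

lemma sum_upto_\<tau>:
  fixes g :: "nat \<Rightarrow> 'b::comm_monoid_add"
  shows "(\<Sum>h\<in>{1..\<tau>}. g h) = (\<Sum>u\<in>{1..\<sigma>}. g u) + (\<Sum>h\<in>{1..\<tau> - \<sigma>}. g (\<sigma> + h))"
proof -
  have "{1..\<tau>} = {1..\<sigma>} \<union> (+) \<sigma> ` {1..\<tau> - \<sigma>}"
    using \<sigma>_le by (auto simp: image_iff intro!: bexI[of _ "_ - \<sigma>"])
  moreover have "{1..\<sigma>} \<inter> (+) \<sigma> ` {1..\<tau> - \<sigma>} = {}" by auto
  ultimately have "(\<Sum>h\<in>{1..\<tau>}. g h) = (\<Sum>u\<in>{1..\<sigma>}. g u) + (\<Sum>h\<in>(+) \<sigma> ` {1..\<tau> - \<sigma>}. g h)"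
    by (simp only: sum.union_disjoint finite_atLeastAtMost finite_imageI)
  then show ?thesis by (simp only: sum.reindex[OF inj_on_add] o_def)
qed

lemma sum_n:
  fixes g :: "nat \<Rightarrow> 'b::comm_monoid_add"
  shows "(\<Sum>i<n. g i) = (\<Sum>i\<le>t 0. g i) + (\<Sum>u\<in>{1..\<sigma>}. g (t 0 + u)) + (\<Sum>h\<in>{1..\<tau> - \<sigma>}. g (t 0 + \<sigma> + h))"
  unfolding n_def sum_tail sum_upto_\<tau> by (simp add: add.assoc)

lemma card_blk: "1 \<le> u \<Longrightarrow> u \<le> \<tau> \<Longrightarrow> real (card (blk u)) = real (t u) - real (t (u - 1))"
  using t_less[of "u - 1" u] by (simp add: blk_def of_nat_diff)

text \<open>Differentiation of
  \<open>\<partial>\<^sub>u H = \<beta>\<^sub>u E\<^sub>u\<close>.\<close>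

lemma pd_pd_Eq:
  fixes H :: "(nat \<Rightarrow> real) \<Rightarrow> 'a::euclidean_space"
  assumes H: "reg_on p n D H" "ev H" and u: "1 \<le> u" "u \<le> \<sigma>" and y: "y \<in> D"
  shows "pd (t 0 + u) (pd (t 0 + u) H) y = Eq u H y + y (t 0 + u) *\<^sub>R pd (t 0 + u) (Eq u H) y"
proof (rule pd_pd_eq[OF copen_D y])
  show un: "t 0 + u < n" using u \<sigma>_le idx_less_n by simp
  show "has_pd (t 0 + u) H (z (t 0 + u) *\<^sub>R Eq u H z) z" if "z \<in> D" for z
    using reg_on_has_pd[OF copen_D H(1) that un] Eq_mult[OF H u that] by simp
  show "has_pd (t 0 + u) (\<lambda>z. z (t 0 + u) *\<^sub>R Eq u H z) (Eq u H y + y (t 0 + u) *\<^sub>R pd (t 0 + u) (Eq u H) y) y"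
    using has_pd_coord_scaleR[OF reg_on_has_pd[OF copen_D reg_on_Eq[OF H u] y un], of "t 0 + u"] 
    by (simp add: add.commute)
qed

lemma reg_on_prod_coord:
  fixes g :: "(nat \<Rightarrow> real) \<Rightarrow> 'a::euclidean_space"
  assumes "finite L" "L \<subseteq> {1..\<tau>}" "reg_on p n D g"
  shows "reg_on p n D (\<lambda>y. (\<Prod>h\<in>L. y (t 0 + h)) *\<^sub>R g y)"
  using assms(1,2)
proof (induction L rule: finite_induct)
  case empty
  then show ?case using assms(3) by simp
next
  case (insert h L)
  have "reg_on p n D (\<lambda>y. y (t 0 + h) *\<^sub>R ((\<Prod>h\<in>L. y (t 0 + h)) *\<^sub>R g y))"
    by (rule reg_on_coord_scaleR[OF copen_D]) (use insert idx_less_n in auto)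
  then show ?case using insert by simp
qed

lemma parity_prod_coord:
  assumes "finite L" "parity D (t 0 + h) e g"
  shows "parity D (t 0 + h) ((if h \<in> L then -1 else 1) * e) (\<lambda>y. (\<Prod>h\<in>L. y (t 0 + h)) *\<^sub>R g y)"
  using assms(2) prod_flip[OF assms(1), of _ "t 0" h]
  unfolding parity_def by (simp del: fun_upd_apply)

text \<open>One coordinate is divided out at a time. The parities \<open>e\<close> are kept general
  because each division turns one sign from -1 into 1, and the induction continues with the modified
  signs.\<close>

lemma divide_odd:
  fixes F :: "(nat \<Rightarrow> real) \<Rightarrow> 'a::euclidean_space"
  assumes "finite L" "L \<subseteq> {1..\<tau>}" "reg_on p n D F" "\<And>h. h \<in> {1..\<tau>} \<Longrightarrow> parity D (t 0 + h) (e h) F"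
    "\<And>h. h \<in> L \<Longrightarrow> e h = -1"
  shows "\<exists>H. reg_on p n D H \<and> (\<forall>y\<in>D. F y = (\<Prod>h\<in>L. y (t 0 + h)) *\<^sub>R H y) \<and>
    (\<forall>h\<in>{1..\<tau>}. parity D (t 0 + h) (if h \<in> L then 1 else e h) H)"
  using assms
proof (induction L arbitrary: F e rule: finite_induct)
  case empty
  then show ?case by (intro exI[of _ F]) auto
next
  case (insert k L)
  have k: "k \<in> {1..\<tau>}" "t 0 + k < n" using insert.prems idx_less_n by auto
  have odd: "parity D (t 0 + k) (-1) F" using insert.prems(3)[OF k(1)] insert.prems(4)[of k] by simp
  note d = reg_on_has_pd[OF copen_D insert.prems(2) _ k(2)]
  define F1 where "F1 = qdiv (t 0 + k) F"
  define e1 where "e1 = e(k := 1)"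
  have FF1: "F y = y (t 0 + k) *\<^sub>R F1 y" if "y \<in> D" for y
    unfolding F1_def using qdiv_mult[of y "t 0 + k" F] parity_odd_zero[OF odd that] by metis
  have R1: "reg_on p n D F1" unfolding F1_def
    by (rule reg_on_qdiv[OF copen_D insert.prems(2) k(2) parity_odd_zero[OF odd]])
  have P1: "parity D (t 0 + h) (e1 h) F1" if h: "h \<in> {1..\<tau>}" for h
  proof (cases "h = k")
    case True
    then show ?thesis using parity_qdiv_same[OF copen_D k(2) odd d] by (simp add: F1_def e1_def)
  next
    case False
    then show ?thesis using parity_qdiv_other[OF copen_D k(2) _ insert.prems(3)[OF h] d] by (simp add: F1_def e1_def)
  qed
  have "\<exists>H. reg_on p n D H \<and> (\<forall>y\<in>D. F1 y = (\<Prod>h\<in>L. y (t 0 + h)) *\<^sub>R H y) \<and>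
    (\<forall>h\<in>{1..\<tau>}. parity D (t 0 + h) (if h \<in> L then 1 else e1 h) H)"
  proof (rule insert.IH[OF _ R1 P1])
    show "L \<subseteq> {1..\<tau>}" using insert.prems by simp
    show "e1 h = -1" if "h \<in> L" for h using that insert by (auto simp: e1_def)
  qed
  then obtain H where H: "reg_on p n D H" "\<forall>y\<in>D. F1 y = (\<Prod>h\<in>L. y (t 0 + h)) *\<^sub>R H y"
    "\<forall>h\<in>{1..\<tau>}. parity D (t 0 + h) (if h \<in> L then 1 else e1 h) H" by (elim exE conjE)
  have "parity D (t 0 + h) (if h \<in> insert k L then 1 else e h) H" if "h \<in> {1..\<tau>}" for h
    using H(3)[THEN bspec, OF that] by (auto simp: e1_def split: if_splits)
  then show ?case using H(1,2) FF1 insert.hyps by (intro exI[of _ H]) auto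
qed

text \<open>For \<open>u \<in> L\<close> the product rule leaves an additional
  \<open>2 \<partial>\<^sub>u H = 2 \<beta>\<^sub>u E\<^sub>u\<close> with the factor
  \<open>\<beta>\<^sub>u\<close> missing from the product; the \<open>\<beta>\<^sub>u\<close> just
  produced completes it again.\<close>

lemma lapl_prod_coord:
  fixes H :: "(nat \<Rightarrow> real) \<Rightarrow> 'a::euclidean_space"
  assumes H: "reg_on p n D H" "ev H" and L: "L \<subseteq> {1..\<sigma>}" and y: "y \<in> D"
  shows "lapl n (\<lambda>y. (\<Prod>h\<in>L. y (t 0 + h)) *\<^sub>R H y) y =
    (\<Prod>h\<in>L. y (t 0 + h)) *\<^sub>R (lapl n H y + (\<Sum>u\<in>{1..\<sigma>}. (if u \<in> L then 2 else 0) *\<^sub>R Eq u H y))"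
proof -
  have fL: "finite L" using L finite_subset by blast
  define P where "P = (\<lambda>L (y::nat \<Rightarrow> real). \<Prod>h\<in>L. y (t 0 + h))"
  have P_indep: "P M (z(i := s)) = P M z" if "\<And>h. h \<in> M \<Longrightarrow> i \<noteq> t 0 + h" for M z i s
    unfolding P_def using that by (intro prod.cong) auto
  have other: "pd i (pd i (\<lambda>y. P L y *\<^sub>R H y)) y = P L y *\<^sub>R pd i (pd i H) y" 
    if i: "i < n" and iL: "\<And>h. h \<in> L \<Longrightarrow> i \<noteq> t 0 + h" for i
  proof (rule pd_pd_eq[OF copen_D y i])
    show "has_pd i (\<lambda>y. P L y *\<^sub>R H y) (P L z *\<^sub>R pd i H z) z" if "z \<in> D" for z
      by (rule has_pd_scaleR_indep[where \<phi> = "P L"], rule P_indep, erule iL)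
         (rule reg_on_has_pd[OF copen_D H(1) that i])
    show "has_pd i (\<lambda>z. P L z *\<^sub>R pd i H z) (P L y *\<^sub>R pd i (pd i H) y) y"
      by (rule has_pd_scaleR_indep[where \<phi> = "P L"], rule P_indep, erule iL)
         (rule reg_on_has_pd[OF copen_D reg_on_pd[OF copen_D H(1) i] y i])
  qed
  have block: "pd (t 0 + u) (pd (t 0 + u) (\<lambda>y. P L y *\<^sub>R H y)) y =
      P L y *\<^sub>R (pd (t 0 + u) (pd (t 0 + u) H) y + (if u \<in> L then 2 else 0) *\<^sub>R Eq u H y)" if u: "u \<in> {1..\<sigma>}" for u
  proof (cases "u \<in> L")
    case False
    then show ?thesis using other[of "t 0 + u"] u \<sigma>_le idx_less_n by auto
  next
    case True
    define k where "k = t 0 + u"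
    have k: "k < n" using u \<sigma>_le idx_less_n by (simp add: k_def)
    have u': "1 \<le> u" "u \<le> \<sigma>" using u by auto
    have PL: "P L z = P (L - {u}) z * z k" for z
      unfolding P_def k_def using prod.remove[OF fL True] by (simp add: mult.commute)
    have ind: "P (L - {u}) (z(k := s)) = P (L - {u}) z" for z s
      by (rule P_indep) (auto simp: k_def)
    note d1 = reg_on_has_pd[OF copen_D H(1) _ k] 
      and d2 = reg_on_has_pd[OF copen_D reg_on_pd[OF copen_D H(1) k] y k]
    have "pd k (pd k (\<lambda>z. P (L - {u}) z *\<^sub>R (z k *\<^sub>R H z))) y =
        P (L - {u}) y *\<^sub>R ((y k *\<^sub>R pd k (pd k H) y + pd k H y) + pd k H y)"
    proof (rule pd_pd_eq[OF copen_D y k])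
      show "has_pd k (\<lambda>z. P (L - {u}) z *\<^sub>R (z k *\<^sub>R H z)) (P (L - {u}) z *\<^sub>R (z k *\<^sub>R pd k H z + H z)) z" if "z \<in> D" for z
        using has_pd_coord_scaleR[OF d1[OF that], of k] by (intro has_pd_scaleR_indep ind) simp
      show "has_pd k (\<lambda>z. P (L - {u}) z *\<^sub>R (z k *\<^sub>R pd k H z + H z)) (P (L - {u}) y *\<^sub>R ((y k *\<^sub>R pd k (pd k H) y + pd k H y) + pd k H y)) y"
        using has_pd_coord_scaleR[OF d2, of k] d1[OF y] by (intro has_pd_scaleR_indep ind has_pd_add) simp_all
    qed
    moreover have "pd k H y = y k *\<^sub>R Eq u H y" unfolding k_def by (rule Eq_mult[OF H u' y, symmetric])
    ultimately show ?thesis using True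
      by (simp add: PL k_def scaleR_add_right scaleR_2 scaleR_add_left distrib_left add.assoc)
  qed
  have "lapl n (\<lambda>y. P L y *\<^sub>R H y) y = (\<Sum>i\<le>t 0. P L y *\<^sub>R pd i (pd i H) y) 
     + (\<Sum>u\<in>{1..\<sigma>}. P L y *\<^sub>R (pd (t 0 + u) (pd (t 0 + u) H) y + (if u \<in> L then 2 else 0) *\<^sub>R Eq u H y))
     + (\<Sum>h\<in>{1..\<tau> - \<sigma>}. P L y *\<^sub>R pd (t 0 + \<sigma> + h) (pd (t 0 + \<sigma> + h) H) y)"
    unfolding lapl_def sum_n using L \<sigma>_le
    by (intro arg_cong2[where f = "(+)"] sum.cong refl other block) (auto simp: n_def)
  also have "\<dots> = P L y *\<^sub>R (lapl n H y + (\<Sum>u\<in>{1..\<sigma>}. (if u \<in> L then 2 else 0) *\<^sub>R Eq u H y))"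
    unfolding lapl_def sum_n by (simp only: scaleR_add_right scaleR_sum_right sum.distrib add_ac)
  finally show ?thesis unfolding P_def .
qed

end

section \<open>The Laplacian for the shorter list of steps\<close>

context clifford_steps
begin

definition xb :: "(nat \<Rightarrow> real) \<Rightarrow> nat \<Rightarrow> 'a" where
  "xb y h = (\<Sum>s\<in>blk h. y s *\<^sub>R v s)"

lemma xb_span: "xb y h \<in> span (v ` blk h)"
  unfolding xb_def by (intro span_sum span_scale span_base) auto

lemma norm_xb: "1 \<le> h \<Longrightarrow> h \<le> \<tau> \<Longrightarrow> norm (xb y h) = blocknorm t h y"
  unfolding xb_def using norm_blk_sum[OF blk_sub] by (simp add: blocknorm_def blk_def)

lemma xb_upd_other: "i \<notin> blk h \<Longrightarrow> xb (y(i := r)) h = xb y h"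
  unfolding xb_def by (intro sum.cong) auto

lemma xb_upd_block: "s \<in> blk u \<Longrightarrow> xb (y(s := r)) u = xb y u + (r - y s) *\<^sub>R v s"
  unfolding xb_def by (simp add: sum.remove[OF finite_blk, of s u] algebra_simps)

text \<open>The derivative of the product of the \<open>x^h\<close>, \<open>h \<in> L\<close>, in
  the direction z of block u: the factor at u is replaced by z, and there is no such factor if u is
  not in L.\<close>

definition Lam :: "nat set \<Rightarrow> nat \<Rightarrow> (nat \<Rightarrow> real) \<Rightarrow> 'a \<Rightarrow> 'a" where
  "Lam L u y z = (if u \<in> L then Jprod ((xb y)(u := z)) L else 0)"

lemma xb_upd_fun:
  assumes L: "L \<subseteq> {1..\<sigma>}" and u: "1 \<le> u" "u \<le> \<sigma>" and s: "s \<in> blk u" and h: "h \<in> L" "h \<noteq> u"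
  shows "xb (y(s := r)) h = xb y h"
  using block_unique[OF s, of h] L u h \<sigma>_le by (intro xb_upd_other) auto

lemma Jprod_xb_upd:
  assumes L: "L \<subseteq> {1..\<sigma>}" and u: "1 \<le> u" "u \<le> \<sigma>" and s: "s \<in> blk u"
  shows "Jprod (xb (y(s := r))) L = Jprod (xb y) L + (r - y s) *\<^sub>R Lam L u y (v s)"
proof (cases "u \<in> L")
  case True
  have fL: "finite L" using L finite_subset by blast
  note lin = Jprod_linear_slot[OF fL True, of "xb y"]
  have "Jprod (xb (y(s := r))) L = Jprod ((xb y)(u := xb y u + (r - y s) *\<^sub>R v s)) L"
    using xb_upd_fun[OF assms] xb_upd_block[OF s] by (intro Jprod_cong[OF fL]) auto
  also have "\<dots> = Jprod ((xb y)(u := xb y u)) L + (r - y s) *\<^sub>R Jprod ((xb y)(u := v s)) L"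
    by (simp only: linear_add[OF lin] linear_scale[OF lin])
  finally show ?thesis using True by (simp add: Lam_def)
next
  case False
  have fL: "finite L" using L finite_subset by blast
  have "Jprod (xb (y(s := r))) L = Jprod (xb y) L"
    using xb_upd_fun[OF assms] False by (intro Jprod_cong[OF fL]) auto
  then show ?thesis using False by (simp add: Lam_def)
qed

lemma Lam_upd:
  assumes L: "L \<subseteq> {1..\<sigma>}" and u: "1 \<le> u" "u \<le> \<sigma>" and s: "s \<in> blk u"
  shows "Lam L u (y(s := r)) z = Lam L u y z"
proof -
  have fL: "finite L" using L finite_subset by blast
  have "Jprod ((xb (y(s := r)))(u := z)) L = Jprod ((xb y)(u := z)) L"
    using xb_upd_fun[OF assms] by (intro Jprod_cong[OF fL]) auto
  then show ?thesis by (simp add: Lam_def)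
qed

text \<open>Euler's identity: the product is homogeneous in \<open>x^u\<close>, of degree 1 if
  \<open>u \<in> L\<close> and of degree 0 otherwise.\<close>

lemma Lam_sum:
  assumes L: "L \<subseteq> {1..\<sigma>}"
  shows "(\<Sum>s\<in>blk u. y s *\<^sub>R Lam L u y (v s)) = (if u \<in> L then Jprod (xb y) L else 0)"
proof (cases "u \<in> L")
  case True
  have fL: "finite L" using L finite_subset by blast
  note lin = Jprod_linear_slot[OF fL True, of "xb y"]
  have "(\<Sum>s\<in>blk u. y s *\<^sub>R Jprod ((xb y)(u := v s)) L) = Jprod ((xb y)(u := xb y u)) L"
    unfolding xb_def[of y u] by (simp only: linear_sum[OF lin] linear_scale[OF lin])
  then show ?thesis using True by (simp add: Lam_def)
qed (simp add: Lam_def)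

lemma Jprod_xb_indep:
  assumes L: "L \<subseteq> {1..\<sigma>}" and i: "i \<le> t 0 \<or> t \<sigma> < i"
  shows "Jprod (xb (y(i := r))) L = Jprod (xb y) L"
proof (rule Jprod_cong)
  show "finite L" using L finite_subset by blast
  fix h assume "h \<in> L"
  then have "i \<notin> blk h" using L i blk_range(1,2)[of h i] by auto
  then show "xb (y(i := r)) h = xb y h" by (rule xb_upd_other)
qed

lemma reg_on_Jprod_xb:
  fixes g :: "(nat \<Rightarrow> real) \<Rightarrow> 'a"
  assumes L: "L \<subseteq> {1..\<sigma>}" and g: "reg_on p n' D' g"
  shows "reg_on p n' D' (\<lambda>y. Jprod (xb y) L * g y)"
proof -
  have "reg_on p n' D' (\<lambda>y. lprod (xb y) hs * g y)" if "set hs \<subseteq> {1..\<sigma>}" for hs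
    using that
  proof (induction hs)
    case (Cons h hs)
    have "reg_on p n' D' (\<lambda>y. \<Sum>s\<in>blk h. y s *\<^sub>R (v s * (lprod (xb y) hs * g y)))"
    proof (rule reg_on_sum[OF copen_D'])
      fix s assume "s \<in> blk h"
      then have "s < n'" using Cons.prems blk_range(3) by auto
      then show "reg_on p n' D' (\<lambda>y. y s *\<^sub>R (v s * (lprod (xb y) hs * g y)))"
        using Cons by (intro reg_on_coord_scaleR[OF copen_D'] reg_on_mult_left[OF copen_D']) auto
    qed
    moreover have "(\<lambda>y. \<Sum>s\<in>blk h. y s *\<^sub>R (v s * (lprod (xb y) hs * g y))) = (\<lambda>y. lprod (xb y) (h # hs) * g y)"
      by (simp add: xb_def sum_distrib_right mult.assoc fun_eq_iff)
    ultimately show ?case by simp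
  qed (simp add: g)
  moreover have "set (sorted_list_of_set L) \<subseteq> {1..\<sigma>}" using L finite_subset[OF L] by simp
  ultimately show ?thesis unfolding Jprod_lprod by blast
qed

text \<open>In block u the second derivatives add up to three contributions:
  \<open>\<beta>\<^sub>u\<^sup>2\<close> times the iterate of \<open>E\<^sub>u\<close>, that is
  \<open>\<beta>\<^sub>u \<partial>\<^sub>u E\<^sub>u\<close>; one \<open>E\<^sub>u\<close> for each
  coordinate; and the mixed terms, which Euler's identity turns into \<open>2 E\<^sub>u\<close> for
  \<open>u \<in> L\<close>. Subtracting \<open>\<partial>\<^sub>u\<^sup>2 H = E\<^sub>u +
  \<beta>\<^sub>u \<partial>\<^sub>u E\<^sub>u\<close> explains the -1.\<close>

lemma lapl_Jprod_xb:
  fixes H :: "(nat \<Rightarrow> real) \<Rightarrow> 'a"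
  assumes H: "reg_on p n D H" "ev H" and L: "L \<subseteq> {1..\<sigma>}" and y: "y \<in> D'"
  shows "lapl n' (\<lambda>y. Jprod (xb y) L * H (nu y)) y = Jprod (xb y) L *
    (lapl n H (nu y) + (\<Sum>u\<in>{1..\<sigma>}. (real (card (blk u)) - 1 + (if u \<in> L then 2 else 0)) *\<^sub>R Eq u H (nu y)))"
proof -
  define X where "X = (\<lambda>y. Jprod (xb y) L)"
  have z: "nu y \<in> D" using y by (simp add: D'_iff)
  have head: "pd i (pd i (\<lambda>y. X y * H (nu y))) y = X y * pd i (pd i H) (nu y)" if i: "i \<le> t 0" for i
  proof (rule pd_pd_eq[OF copen_D' y])
    have "i < n" using i by (simp add: n_def)
    note H' = reg_on_pd[OF copen_D H(1) this]
    have ind: "X (z(i := s)) = X z" for z s unfolding X_def by (rule Jprod_xb_indep[OF L]) (use i in blast)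
    show "i < n'" using i t_le[of 0 \<sigma>] \<sigma>_le by (simp add: n'_def)
    show "has_pd i (\<lambda>y. X y * H (nu y)) (X z * pd i H (nu z)) z" if "z \<in> D'" for z
      by (rule has_pd_mult_indep[where X = X, OF ind has_pd_nu_head[OF H(1) that i]])
    show "has_pd i (\<lambda>z. X z * pd i H (nu z)) (X y * pd i (pd i H) (nu y)) y"
      by (rule has_pd_mult_indep[where X = X, OF ind has_pd_nu_head[OF H' y i]])
  qed
  have tail: "pd (t \<sigma> + h) (pd (t \<sigma> + h) (\<lambda>y. X y * H (nu y))) y = X y * pd (t 0 + \<sigma> + h) (pd (t 0 + \<sigma> + h) H) (nu y)" 
    if h: "h \<in> {1..\<tau> - \<sigma>}" for h
  proof (rule pd_pd_eq[OF copen_D' y])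
    have "t 0 + \<sigma> + h < n" using h by (auto simp: n_def)
    note H' = reg_on_pd[OF copen_D H(1) this]
    have h': "1 \<le> h" "h \<le> \<tau> - \<sigma>" using h by auto
    have ind: "X (z(t \<sigma> + h := s)) = X z" for z s unfolding X_def by (rule Jprod_xb_indep[OF L]) (use h in auto)
    show "t \<sigma> + h < n'" using h by (auto simp: n'_def)
    show "has_pd (t \<sigma> + h) (\<lambda>y. X y * H (nu y)) (X z * pd (t 0 + \<sigma> + h) H (nu z)) z" if "z \<in> D'" for z
      by (rule has_pd_mult_indep[where X = X, OF ind has_pd_nu_tail[OF H(1) that h']])
    show "has_pd (t \<sigma> + h) (\<lambda>z. X z * pd (t 0 + \<sigma> + h) H (nu z)) (X y * pd (t 0 + \<sigma> + h) (pd (t 0 + \<sigma> + h) H) (nu y)) y"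
      by (rule has_pd_mult_indep[where X = X, OF ind has_pd_nu_tail[OF H' y h']])
  qed
  have block: "(\<Sum>s\<in>blk u. pd s (pd s (\<lambda>y. X y * H (nu y))) y) = X y * (pd (t 0 + u) (pd (t 0 + u) H) (nu y)
      + (real (card (blk u)) - 1 + (if u \<in> L then 2 else 0)) *\<^sub>R Eq u H (nu y))" if u0: "u \<in> {1..\<sigma>}" for u
  proof -
    have u: "1 \<le> u" "u \<le> \<sigma>" using u0 by auto
    define E where "E = Eq u H"
    have E: "reg_on p n D E" "ev E" unfolding E_def by (rule reg_on_Eq[OF H u], rule ev_Eq[OF H u])
    \<comment> \<open>X is affine in the coordinate s, so the mixed term is the only one in which
      its slope survives.\<close>
    have "pd s (pd s (\<lambda>y. X y * H (nu y))) y = X y * ((y s)\<^sup>2 *\<^sub>R Eq u E (nu y) + E (nu y))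
       + 2 *\<^sub>R ((y s *\<^sub>R Lam L u y (v s)) * E (nu y))" if s: "s \<in> blk u" for s
    proof (rule pd_pd_eq[OF copen_D' y])
      show "s < n'" using blk_range(3)[OF u s] .
      have aff: "X (z(s := r)) = X z + (r - z s) *\<^sub>R Lam L u z (v s)" for z r
        unfolding X_def by (rule Jprod_xb_upd[OF L u s])
      have ind: "Lam L u (z(s := r)) (v s) = Lam L u z (v s)" for z r by (rule Lam_upd[OF L u s])
      have dH: "has_pd s (\<lambda>y. H (nu y)) (z s *\<^sub>R E (nu z)) z" if "z \<in> D'" for z
        unfolding E_def by (rule has_pd_nu_block[OF H that u s])
      have dE: "has_pd s (\<lambda>y. E (nu y)) (y s *\<^sub>R Eq u E (nu y)) y"
        by (rule has_pd_nu_block[OF E y u s])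
      have dyE: "has_pd s (\<lambda>y. y s *\<^sub>R E (nu y)) (y s *\<^sub>R (y s *\<^sub>R Eq u E (nu y)) + E (nu y)) y"
        using has_pd_coord_scaleR[OF dE, of s] by simp
      show "has_pd s (\<lambda>y. X y * H (nu y)) (X z * (z s *\<^sub>R E (nu z)) + Lam L u z (v s) * H (nu z)) z" if "z \<in> D'" for z
        by (rule has_pd_affine_mult[where X = X and \<Lambda> = "\<lambda>y. Lam L u y (v s)", OF aff dH[OF that]])
      have "has_pd s (\<lambda>z. X z * (z s *\<^sub>R E (nu z)) + Lam L u z (v s) * H (nu z))
         ((X y * (y s *\<^sub>R (y s *\<^sub>R Eq u E (nu y)) + E (nu y)) + Lam L u y (v s) * (y s *\<^sub>R E (nu y)))
           + Lam L u y (v s) * (y s *\<^sub>R E (nu y))) y"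
        by (rule has_pd_add[OF has_pd_affine_mult[where X = X and \<Lambda> = "\<lambda>y. Lam L u y (v s)", OF aff dyE]
              has_pd_mult_indep[where X = "\<lambda>y. Lam L u y (v s)", OF ind dH[OF y]]])
      then show "has_pd s (\<lambda>z. X z * (z s *\<^sub>R E (nu z)) + Lam L u z (v s) * H (nu z))
         (X y * ((y s)\<^sup>2 *\<^sub>R Eq u E (nu y) + E (nu y)) + 2 *\<^sub>R ((y s *\<^sub>R Lam L u y (v s)) * E (nu y))) y"
        unfolding scaleR_2 add.assoc by (simp add: power2_eq_square)
    qed
    then have "(\<Sum>s\<in>blk u. pd s (pd s (\<lambda>y. X y * H (nu y))) y)
      = (\<Sum>s\<in>blk u. X y * ((y s)\<^sup>2 *\<^sub>R Eq u E (nu y) + E (nu y)) + 2 *\<^sub>R ((y s *\<^sub>R Lam L u y (v s)) * E (nu y)))"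
      by (rule sum.cong[OF refl])
    also have "\<dots> = X y * ((\<Sum>s\<in>blk u. (y s)\<^sup>2) *\<^sub>R Eq u E (nu y) + real (card (blk u)) *\<^sub>R E (nu y))
        + 2 *\<^sub>R ((\<Sum>s\<in>blk u. y s *\<^sub>R Lam L u y (v s)) * E (nu y))"
      by (simp only: sum.distrib sum_distrib_left[symmetric] sum_distrib_right scaleR_sum_right scaleR_sum_left sum_constant_scaleR)
    also have "(\<Sum>s\<in>blk u. y s *\<^sub>R Lam L u y (v s)) = (if u \<in> L then X y else 0)"
      unfolding X_def by (rule Lam_sum[OF L])
    also have "(\<Sum>s\<in>blk u. (y s)\<^sup>2) *\<^sub>R Eq u E (nu y) = nu y (t 0 + u) *\<^sub>R pd (t 0 + u) E (nu y)"
    proof -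
      have "(\<Sum>s\<in>blk u. (y s)\<^sup>2) = (nu y (t 0 + u))\<^sup>2"
        using u by (simp add: nu_block blocknorm_def blk_def sum_nonneg)
      then show ?thesis using Eq_mult[OF E u z] by (simp add: power2_eq_square flip: scaleR_scaleR)
    qed
    finally have *: "(\<Sum>s\<in>blk u. pd s (pd s (\<lambda>y. X y * H (nu y))) y) =
        X y * (nu y (t 0 + u) *\<^sub>R pd (t 0 + u) E (nu y) + real (card (blk u)) *\<^sub>R E (nu y))
        + 2 *\<^sub>R ((if u \<in> L then X y else 0) * E (nu y))" .
    have "(real (card (blk u)) - 1 + (if u \<in> L then 2 else 0)) *\<^sub>R w
        = real (card (blk u)) *\<^sub>R w - w + 2 *\<^sub>R (if u \<in> L then w else 0)" for w :: 'a
      by (simp add: scaleR_diff_left scaleR_add_left)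
    then show ?thesis
      unfolding * pd_pd_Eq[OF H u z] E_def[symmetric]
      by (cases "u \<in> L") (simp_all add: distrib_left right_diff_distrib)
  qed
  have "lapl n' (\<lambda>y. X y * H (nu y)) y = (\<Sum>i\<le>t 0. X y * pd i (pd i H) (nu y))
     + (\<Sum>u\<in>{1..\<sigma>}. X y * (pd (t 0 + u) (pd (t 0 + u) H) (nu y)
         + (real (card (blk u)) - 1 + (if u \<in> L then 2 else 0)) *\<^sub>R Eq u H (nu y)))
     + (\<Sum>h\<in>{1..\<tau> - \<sigma>}. X y * pd (t 0 + \<sigma> + h) (pd (t 0 + \<sigma> + h) H) (nu y))"
    unfolding lapl_def sum_n'
    by (intro arg_cong2[where f = "(+)"] sum.cong refl head block tail) auto
  also have "\<dots> = X y * (lapl n H (nu y) + (\<Sum>u\<in>{1..\<sigma>}. (real (card (blk u)) - 1 + (if u \<in> L then 2 else 0)) *\<^sub>R Eq u H (nu y)))"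
    unfolding lapl_def sum_n by (simp only: distrib_left sum_distrib_left sum.distrib add_ac)
  finally show ?thesis unfolding X_def .
qed

text \<open>\<open>corr y J y' J'\<close>: the pairs \<open>(y, J)\<close> for \<open>T\<close> and \<open>(y', J')\<close> for \<open>T\<^sub>\<sigma>\<close> represent the same point.\<close>

definition corr :: "(nat \<Rightarrow> real) \<Rightarrow> (nat \<Rightarrow> 'a) \<Rightarrow> (nat \<Rightarrow> real) \<Rightarrow> (nat \<Rightarrow> 'a) \<Rightarrow> bool" where
  "corr y J y' J' \<longleftrightarrow> (\<forall>s\<le>t 0. y' s = y s) \<and> (\<forall>u\<in>{1..\<sigma>}. xb y' u = y (t 0 + u) *\<^sub>R J u) \<and>
     (\<forall>h\<in>{1..\<tau> - \<sigma>}. y' (t \<sigma> + h) = y (t 0 + \<sigma> + h) \<and> J' h = J (\<sigma> + h))"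

lemma corr_spt:
  assumes "corr y J y' J'"
  shows "spt (tsig t \<sigma>) (\<tau> - \<sigma>) v y' J' = spt t \<tau> v y J"
proof -
  have "spt (tsig t \<sigma>) (\<tau> - \<sigma>) v y' J' = (\<Sum>s\<le>t 0. y' s *\<^sub>R v s) + (\<Sum>u\<in>{1..\<sigma>}. xb y' u) + (\<Sum>h\<in>{1..\<tau> - \<sigma>}. y' (t \<sigma> + h) *\<^sub>R J' h)"
    by (simp add: spt_def tsig_def sum_blocks[OF \<sigma>_le] xb_def)
  also have "\<dots> = (\<Sum>s\<le>t 0. y s *\<^sub>R v s) + (\<Sum>u\<in>{1..\<sigma>}. y (t 0 + u) *\<^sub>R J u) + (\<Sum>h\<in>{1..\<tau> - \<sigma>}. y (t 0 + (\<sigma> + h)) *\<^sub>R J (\<sigma> + h))"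
    using assms by (intro arg_cong2[where f = "(+)"] sum.cong refl) (auto simp: corr_def add.assoc)
  also have "\<dots> = spt t \<tau> v y J"
    unfolding spt_def sum_upto_\<tau> by (simp add: add.assoc)
  finally show ?thesis .
qed

text \<open>As \<open>J\<^sub>u\<close> has norm 1, the norm of \<open>x^u\<close> is the absolute
  value of \<open>\<beta>\<^sub>u\<close>; the lost sign is harmless for even functions.\<close>

lemma corr_nu:
  assumes c: "corr y J y' J'" and J: "J \<in> torus t \<tau> v" and y: "y \<in> D" and H: "ev H"
  shows "nu y' \<in> D \<and> H (nu y') = H y"
proof (rule sign_change[of "(+) (t 0) ` {1..\<sigma>}"])
  show "parity D i 1 H" if "i \<in> (+) (t 0) ` {1..\<sigma>}" for i
    using H that unfolding ev_def by blast
  show "\<bar>nu y' j\<bar> = \<bar>y j\<bar>" if j: "j \<in> (+) (t 0) ` {1..\<sigma>}" for j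
  proof -
    obtain u where "u \<in> {1..\<sigma>}" and j: "j = t 0 + u" using j by blast
    then have u: "1 \<le> u" "u \<le> \<sigma>" "u \<le> \<tau>" using \<sigma>_le by auto
    have "nu y' j = norm (xb y' u)" using u by (simp add: j nu_block norm_xb)
    also have "\<dots> = \<bar>y j\<bar>" using c u torusD(2)[OF J u(1,3)] by (simp add: corr_def j)
    finally show ?thesis by simp
  qed
  show "nu y' j = y j" if j: "j \<notin> (+) (t 0) ` {1..\<sigma>}" for j
  proof -
    consider "j \<le> t 0" | "t 0 < j" "j \<le> t 0 + \<sigma>" | "t 0 + \<sigma> < j" "j < n" | "n \<le> j" by linarith
    then show ?thesis
    proof cases
      case 1 then show ?thesis using c by (simp add: corr_def nu_def)
    next
      case 2
      then have "j = t 0 + (j - t 0)" "j - t 0 \<in> {1..\<sigma>}" by auto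
      then show ?thesis using j by blast
    next
      case 3
      then have "j - t 0 - \<sigma> \<in> {1..\<tau> - \<sigma>}" "t 0 + \<sigma> + (j - t 0 - \<sigma>) = j" by (auto simp: n_def)
      then have "y' (t \<sigma> + (j - t 0 - \<sigma>)) = y j" using c unfolding corr_def by metis
      then show ?thesis using 3 by (simp add: nu_def)
    next
      case 4
      moreover have "y \<in> cspace n" using y copen_D by (auto simp: copen_def)
      ultimately show ?thesis using nu_cspace[of y'] by (simp add: cspace_def)
    qed
  qed
qed (use y in simp_all)

text \<open>Lets \<open>corr_nu\<close> be used for its membership statement alone, with the zero
  function in place of H.\<close>

lemma ev_zero: "ev (\<lambda>y. 0::'a)"
proof -
  have "y(t 0 + u := - y (t 0 + u)) \<in> D" if "u \<in> {1..\<sigma>}" "y \<in> D" for u y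
    using adm that \<sigma>_le unfolding admissible_dom_def bflip_def by fastforce
  then show ?thesis by (simp add: ev_def parity_def)
qed

lemma torus_tsig:
  assumes "J \<in> torus t \<tau> v"
  shows "(\<lambda>h. if h \<in> {1..\<tau> - \<sigma>} then J (\<sigma> + h) else 0) \<in> torus (tsig t \<sigma>) (\<tau> - \<sigma>) v"
proof -
  have "J (\<sigma> + h) \<in> sph v (t (\<sigma> + (h - 1)) + 1) (t (\<sigma> + h))" if "h \<in> {1..\<tau> - \<sigma>}" for h
  proof -
    have "\<sigma> + h \<in> {1..\<tau>}" "\<sigma> + h - 1 = \<sigma> + (h - 1)" using that \<sigma>_le by auto
    then show ?thesis using assms unfolding torus_def by (metis (no_types, lifting) mem_Collect_eq)
  qed
  then show ?thesis by (simp add: torus_def tsig_def)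
qed

text \<open>Every representation for \<open>T\<close> has a partner for
  \<open>T\<^sub>\<sigma>\<close>; this evaluates the Laplacian of \<open>T\<^sub>\<sigma>\<close>
  at a given point of the domain. The block coordinates of the partner are read off by inner
  products.\<close>

lemma corr_from:
  assumes y: "y \<in> D" and J: "J \<in> torus t \<tau> v"
  shows "\<exists>y'\<in>D'. \<exists>J'\<in>torus (tsig t \<sigma>) (\<tau> - \<sigma>) v. corr y J y' J'"
proof -
  define J' where "J' = (\<lambda>h. if h \<in> {1..\<tau> - \<sigma>} then J (\<sigma> + h) else 0)"
  define y' where "y' = (\<lambda>i. if i \<le> t \<sigma> then inner (spt t \<tau> v y J) (v i)
     else if i < n' then y (t 0 + \<sigma> + (i - t \<sigma>)) else 0)"
  have t0: "t 0 \<le> t \<sigma>" using t_le \<sigma>_le by simp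
  have c: "corr y J y' J'"
    unfolding corr_def
  proof (intro conjI ballI allI impI)
    show "y' s = y s" if "s \<le> t 0" for s using that spt_inner(1)[OF J that] t0 by (simp add: y'_def)
    show "y' (t \<sigma> + h) = y (t 0 + \<sigma> + h)" if "h \<in> {1..\<tau> - \<sigma>}" for h using that by (auto simp: y'_def n'_def)
    show "J' h = J (\<sigma> + h)" if "h \<in> {1..\<tau> - \<sigma>}" for h using that by (simp add: J'_def)
    fix u assume "u \<in> {1..\<sigma>}"
    then have u: "1 \<le> u" "u \<le> \<sigma>" "u \<le> \<tau>" using \<sigma>_le by auto
    have "xb y' u = (\<Sum>s\<in>blk u. (y (t 0 + u) * inner (J u) (v s)) *\<^sub>R v s)"
      unfolding xb_def
      using blk_range(2)[OF u(1,2)] spt_inner(2)[OF J u(1,3)] by (intro sum.cong) (auto simp: y'_def)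
    also have "\<dots> = y (t 0 + u) *\<^sub>R (\<Sum>s\<in>blk u. inner (J u) (v s) *\<^sub>R v s)" by (simp add: scaleR_sum_right)
    also have "(\<Sum>s\<in>blk u. inner (J u) (v s) *\<^sub>R v s) = J u"
      by (rule span_blk[OF u(1,3) torusD(1)[OF J u(1,3)], symmetric])
    finally show "xb y' u = y (t 0 + u) *\<^sub>R J u" .
  qed
  have "y' \<in> cspace n'" by (auto simp: cspace_def y'_def n'_def)
  then have "y' \<in> D'" using corr_nu[OF c J y ev_zero] by (simp add: D'_iff)
  then show ?thesis using c torus_tsig[OF J] unfolding J'_def by blast
qed

text \<open>The converse passage, which shows that \<open>Fs\<close> induces f. The representation
  found has \<open>\<beta>\<^sub>u\<close> equal to the norm of \<open>x^u\<close>.\<close>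

lemma corr_to:
  assumes y': "y' \<in> D'" and J': "J' \<in> torus (tsig t \<sigma>) (\<tau> - \<sigma>) v"
  shows "\<exists>J\<in>torus t \<tau> v. corr (nu y') J y' J'"
proof -
  \<comment> \<open>If \<open>x^u = 0\<close>, every unit vector of the block serves; the last basis
    vector is taken.\<close>
  define J where "J = (\<lambda>h. if h \<in> {1..\<sigma>} then (if xb y' h = 0 then v (t h) else inverse (norm (xb y' h)) *\<^sub>R xb y' h)
     else if h \<in> {\<sigma> + 1..\<tau>} then J' (h - \<sigma>) else 0)"
  have "J \<in> torus t \<tau> v"
    unfolding torus_def mem_Collect_eq
  proof (intro conjI ballI allI impI)
    fix h assume h: "h \<in> {1..\<tau>}"
    show "J h \<in> sph v (t (h - 1) + 1) (t h)"
    proof (cases "h \<le> \<sigma>")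
      case True
      have "t h \<in> blk h" using t_less[of "h - 1" h] h by (auto simp: blk_def)
      then have "v (t h) \<in> span (v ` blk h)" "t h \<le> N" using blk_N[of h "t h"] h by (auto intro: span_base)
      then have "J h \<in> span (v ` blk h)" "norm (J h) = 1"
        using True h xb_span orth[of "t h" "t h"] by (auto simp: J_def norm_eq_sqrt_inner[of "v (t h)"] intro: span_scale)
      then show ?thesis by (simp add: sph_def blk_def)
    next
      case False
      then have k: "h - \<sigma> \<in> {1..\<tau> - \<sigma>}" "\<sigma> + (h - \<sigma> - 1) = h - 1" "\<sigma> + (h - \<sigma>) = h" using h by auto
      have "J' (h - \<sigma>) \<in> sph v (t (\<sigma> + (h - \<sigma> - 1)) + 1) (t (\<sigma> + (h - \<sigma>)))"
        using J' k(1) unfolding torus_def tsig_def by blast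
      then show ?thesis using False h k by (simp add: J_def)
    qed
  qed (use \<sigma>_le in \<open>auto simp: J_def\<close>)
  moreover have "corr (nu y') J y' J'"
    unfolding corr_def
  proof (intro conjI ballI allI impI)
    show "y' s = nu y' s" if "s \<le> t 0" for s using that by (simp add: nu_def)
    show "y' (t \<sigma> + h) = nu y' (t 0 + \<sigma> + h)" if "h \<in> {1..\<tau> - \<sigma>}" for h using that by (auto simp: nu_def n_def)
    show "J' h = J (\<sigma> + h)" if "h \<in> {1..\<tau> - \<sigma>}" for h using that by (auto simp: J_def)
    fix u assume u: "u \<in> {1..\<sigma>}"
    then have "nu y' (t 0 + u) = norm (xb y' u)" using \<sigma>_le by (simp add: nu_block norm_xb)
    then show "xb y' u = nu y' (t 0 + u) *\<^sub>R J u" using u by (simp add: J_def)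
  qed
  ultimately show ?thesis by blast
qed

end

section \<open>Comparison of the stem functions for the two lists of steps\<close>

context clifford_steps
begin

text \<open>Makes \<open>slap_eq\<close> and the parity criterion available for
  \<open>T\<^sub>\<sigma>\<close>; the locale's own \<open>\<sigma>\<close> is set to 0
  there.\<close>

lemma clifford_steps_tsig: "clifford_steps (tsig t \<sigma>) (\<tau> - \<sigma>) 0 D' v N"
proof unfold_locales
  show "tsig t \<sigma> h < tsig t \<sigma> (Suc h)" if "h < \<tau> - \<sigma>" for h
    using t_step[of "\<sigma> + h"] that by (simp add: tsig_def)
  show "tsig t \<sigma> (\<tau> - \<sigma>) = N" using \<sigma>_le t_last by (simp add: tsig_def)
  have "bflip (tsig t \<sigma>) h y \<in> D'" if y: "y \<in> D'" and h: "h \<in> {1..\<tau> - \<sigma>}" for y h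
  proof -
    have h': "1 \<le> h" "h \<le> \<tau> - \<sigma>" using h by auto
    have "nu y (t 0 + \<sigma> + h) = y (t \<sigma> + h)" using h by (auto simp: nu_def n_def)
    then have "nu (bflip (tsig t \<sigma>) h y) = bflip t (\<sigma> + h) (nu y)"
      by (simp add: bflip_def tsig_def nu_upd_tail[OF h'] add.assoc)
    moreover have "bflip t (\<sigma> + h) (nu y) \<in> D"
      using adm y h \<sigma>_le unfolding admissible_dom_def D'_iff by auto
    moreover have "bflip (tsig t \<sigma>) h y \<in> cspace n'"
      using y h' by (auto simp: D'_iff bflip_def tsig_def n'_def intro!: cspace_upd)
    ultimately show ?thesis by (simp add: D'_iff)
  qed
  then show "admissible_dom (tsig t \<sigma>) (\<tau> - \<sigma>) D'"
    using copen_D' unfolding admissible_dom_def sdim_n copen_iff_openin by blast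
qed (fact orth v_sq v_anti | simp)+

text \<open>\<open>Fs H\<close> is the \<open>T\<^sub>\<sigma>\<close>-stem function of the slice function with \<open>T\<close>-stem components
  \<open>(\<Prod>h\<in>K \<inter> {1..\<sigma>}. \<beta>\<^sub>h) H\<^sub>K\<close>; the sign comes from moving \<open>J\<^sub>L\<close> past \<open>J\<^bsub>K'\<^esub>\<close>.\<close>

definition Fs :: "(nat set \<Rightarrow> (nat \<Rightarrow> real) \<Rightarrow> 'a) \<Rightarrow> nat set \<Rightarrow> (nat \<Rightarrow> real) \<Rightarrow> 'a" where
  "Fs \<Psi> K' y = (\<Sum>L\<in>Pow {1..\<sigma>}. (-1) ^ (card L * card K') *\<^sub>R (Jprod (xb y) L * \<Psi> (L \<union> (+) \<sigma> ` K') (nu y)))"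

lemma union_shift:
  assumes "L \<subseteq> {1..\<sigma>}" "K' \<subseteq> {1..\<tau> - \<sigma>}"
  shows "L \<union> (+) \<sigma> ` K' \<subseteq> {1..\<tau>}" "{1..\<sigma>} \<inter> (L \<union> (+) \<sigma> ` K') = L"
proof -
  have "\<sigma> + k \<in> {1..\<tau>} \<and> \<sigma> + k \<notin> {1..\<sigma>}" if "k \<in> K'" for k
  proof -
    have "k \<in> {1..\<tau> - \<sigma>}" using assms(2) that by blast
    then show ?thesis using \<sigma>_le by auto
  qed
  moreover have "{1..\<sigma>} \<subseteq> {1..\<tau>}" using \<sigma>_le by auto
  ultimately show "L \<union> (+) \<sigma> ` K' \<subseteq> {1..\<tau>}" "{1..\<sigma>} \<inter> (L \<union> (+) \<sigma> ` K') = L"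
    using assms(1) by blast+
qed

lemma transfer_summand:
  assumes c: "corr y J y' J'" and J: "J \<in> torus t \<tau> v"
    and L: "L \<subseteq> {1..\<sigma>}" and K': "K' \<subseteq> {1..\<tau> - \<sigma>}"
  shows "(-1) ^ (card L * card K') *\<^sub>R (Jprod J' K' * (Jprod (xb y') L * w)) =
    Jprod J (L \<union> (+) \<sigma> ` K') * ((\<Prod>h\<in>L. y (t 0 + h)) *\<^sub>R w)"
proof -
  have fin: "finite L" "finite K'" using L K' finite_subset by blast+
  have J': "Jprod J' K' = Jprod J ((+) \<sigma> ` K')"
    unfolding Jprod_shift[OF fin(2)] using c K' by (intro Jprod_cong[OF fin(2)]) (auto simp: corr_def)
  have X: "Jprod (xb y') L = (\<Prod>h\<in>L. y (t 0 + h)) *\<^sub>R Jprod J L"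
    unfolding Jprod_scaleR[OF fin(1), symmetric] using c L by (intro Jprod_cong[OF fin(1)]) (auto simp: corr_def)
  have "Jprod J (L \<union> (+) \<sigma> ` K') = Jprod J L * Jprod J ((+) \<sigma> ` K')"
  proof (rule Jprod_Un_less)
    fix a b assume "a \<in> L" "b \<in> (+) \<sigma> ` K'"
    then obtain k where "k \<in> K'" "b = \<sigma> + k" by blast
    moreover have "a \<in> {1..\<sigma>}" "k \<in> {1..\<tau> - \<sigma>}" using \<open>a \<in> L\<close> \<open>k \<in> K'\<close> L K' by blast+
    ultimately show "a < b" by simp
  qed (use fin in simp_all)
  also have "\<dots> = (-1) ^ (card L * card ((+) \<sigma> ` K')) *\<^sub>R (Jprod J ((+) \<sigma> ` K') * Jprod J L)"
  proof (rule Jprod_anticommute)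
    fix x z assume x: "x \<in> L" and "z \<in> (+) \<sigma> ` K'"
    then obtain k where k: "k \<in> K'" "z = \<sigma> + k" by blast
    have "x \<in> {1..\<sigma>}" "k \<in> {1..\<tau> - \<sigma>}" using x k L K' by blast+
    then have xz: "1 \<le> x" "x \<le> \<tau>" "1 \<le> z" "z \<le> \<tau>" "x \<noteq> z" using \<sigma>_le k(2) by auto
    show "J x * J z = - (J z * J x)"
      using xz by (intro blk_anticommute[of x z] torusD(1)[OF J])
  qed (use fin in auto)
  also have "card ((+) \<sigma> ` K') = card K'" by (rule card_image) simp
  finally show ?thesis by (simp add: J' X mult.assoc)
qed

text \<open>Subsets K of \<open>{1..\<tau>}\<close> correspond to pairs of a subset L of the first
  \<open>\<sigma>\<close> indices and a shifted subset K' of the others. The family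
  \<open>\<Psi>\<close> is arbitrary because the lemma serves twice: for the even factors of f and
  for those of its Laplacian.\<close>

lemma transfer:
  fixes \<Psi> :: "nat set \<Rightarrow> (nat \<Rightarrow> real) \<Rightarrow> 'a"
  assumes c: "corr y J y' J'" and J: "J \<in> torus t \<tau> v" and y: "y \<in> D"
    and ev: "\<And>K. K \<subseteq> {1..\<tau>} \<Longrightarrow> ev (\<Psi> K)"
  shows "(\<Sum>K'\<in>Pow {1..\<tau> - \<sigma>}. Jprod J' K' * Fs \<Psi> K' y') =
    (\<Sum>K\<in>Pow {1..\<tau>}. Jprod J K * ((\<Prod>h\<in>{1..\<sigma>} \<inter> K. y (t 0 + h)) *\<^sub>R \<Psi> K y))"
proof -
  have "(\<Sum>K'\<in>Pow {1..\<tau> - \<sigma>}. Jprod J' K' * Fs \<Psi> K' y') = (\<Sum>K'\<in>Pow {1..\<tau> - \<sigma>}. \<Sum>L\<in>Pow {1..\<sigma>}.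
      (-1) ^ (card L * card K') *\<^sub>R (Jprod J' K' * (Jprod (xb y') L * \<Psi> (L \<union> (+) \<sigma> ` K') (nu y'))))"
    by (simp add: Fs_def sum_distrib_left)
  also have "\<dots> = (\<Sum>(K', L)\<in>Pow {1..\<tau> - \<sigma>} \<times> Pow {1..\<sigma>}.
      (-1) ^ (card L * card K') *\<^sub>R (Jprod J' K' * (Jprod (xb y') L * \<Psi> (L \<union> (+) \<sigma> ` K') (nu y'))))"
    by (rule sum.cartesian_product)
  also have "\<dots> = (\<Sum>K\<in>Pow {1..\<tau>}. Jprod J K * ((\<Prod>h\<in>{1..\<sigma>} \<inter> K. y (t 0 + h)) *\<^sub>R \<Psi> K y))"
  proof (rule sum.reindex_bij_witness[of _ "\<lambda>K. ({k \<in> {1..\<tau> - \<sigma>}. \<sigma> + k \<in> K}, {1..\<sigma>} \<inter> K)" "\<lambda>(K', L). L \<union> (+) \<sigma> ` K'"])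
    fix a assume "a \<in> Pow {1..\<tau> - \<sigma>} \<times> Pow {1..\<sigma>}"
    then obtain K' L where a: "a = (K', L)" and K': "K' \<subseteq> {1..\<tau> - \<sigma>}" and L: "L \<subseteq> {1..\<sigma>}" by auto
    note us = union_shift[OF L K']
    show "(\<lambda>(K', L). L \<union> (+) \<sigma> ` K') a \<in> Pow {1..\<tau>}" using us(1) by (simp add: a)
    have "{k \<in> {1..\<tau> - \<sigma>}. \<sigma> + k \<in> L \<union> (+) \<sigma> ` K'} = K'" using K' L by fastforce
    then show "({k \<in> {1..\<tau> - \<sigma>}. \<sigma> + k \<in> (\<lambda>(K', L). L \<union> (+) \<sigma> ` K') a}, {1..\<sigma>} \<inter> (\<lambda>(K', L). L \<union> (+) \<sigma> ` K') a) = a"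
      using us(2) by (simp add: a)
    have "\<Psi> (L \<union> (+) \<sigma> ` K') (nu y') = \<Psi> (L \<union> (+) \<sigma> ` K') y"
      using corr_nu[OF c J y ev[OF us(1)]] by simp
    then show "Jprod J ((\<lambda>(K', L). L \<union> (+) \<sigma> ` K') a) * ((\<Prod>h\<in>{1..\<sigma>} \<inter> (\<lambda>(K', L). L \<union> (+) \<sigma> ` K') a. y (t 0 + h)) *\<^sub>R \<Psi> ((\<lambda>(K', L). L \<union> (+) \<sigma> ` K') a) y)
      = (case a of (K', L) \<Rightarrow> (-1) ^ (card L * card K') *\<^sub>R (Jprod J' K' * (Jprod (xb y') L * \<Psi> (L \<union> (+) \<sigma> ` K') (nu y'))))"
      by (simp only: a prod.case us(2) transfer_summand[OF c J L K'])
  next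
    fix K assume K: "K \<in> Pow {1..\<tau>}"
    have "{1..\<sigma>} \<inter> K \<union> (+) \<sigma> ` {k \<in> {1..\<tau> - \<sigma>}. \<sigma> + k \<in> K} = K"
    proof (intro equalityI subsetI)
      fix k assume k: "k \<in> K"
      show "k \<in> {1..\<sigma>} \<inter> K \<union> (+) \<sigma> ` {k \<in> {1..\<tau> - \<sigma>}. \<sigma> + k \<in> K}"
      proof (cases "k \<le> \<sigma>")
        case True then show ?thesis using k K by auto
      next
        case False
        then have "k = \<sigma> + (k - \<sigma>)" "k - \<sigma> \<in> {1..\<tau> - \<sigma>}" using k K by auto
        then show ?thesis using k by (intro UnI2 image_eqI[of _ _ "k - \<sigma>"]) auto
      qed
    qed auto
    then show "(\<lambda>(K', L). L \<union> (+) \<sigma> ` K') ({k \<in> {1..\<tau> - \<sigma>}. \<sigma> + k \<in> K}, {1..\<sigma>} \<inter> K) = K" by simp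
    show "({k \<in> {1..\<tau> - \<sigma>}. \<sigma> + k \<in> K}, {1..\<sigma>} \<inter> K) \<in> Pow {1..\<tau> - \<sigma>} \<times> Pow {1..\<sigma>}" by auto
  qed
  finally show ?thesis .
qed

text \<open>The reflection of a remaining \<open>\<beta>\<^sub>h\<close> commutes with
  \<open>nu\<close> and leaves the blocks \<open>x^u\<close> alone, so the parity of the components
  passes to \<open>Fs\<close>.\<close>

lemma stem_reg_Fs:
  fixes H :: "nat set \<Rightarrow> (nat \<Rightarrow> real) \<Rightarrow> 'a"
  assumes reg: "\<And>K. K \<subseteq> {1..\<tau>} \<Longrightarrow> reg_on p n D (H K)" and ev: "\<And>K. K \<subseteq> {1..\<tau>} \<Longrightarrow> ev (H K)"
    and par: "\<And>K h. K \<subseteq> {1..\<tau>} \<Longrightarrow> \<sigma> < h \<Longrightarrow> h \<le> \<tau> \<Longrightarrow> parity D (t 0 + h) (if h \<in> K then -1 else 1) (H K)"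
  shows "stem_reg p (tsig t \<sigma>) (\<tau> - \<sigma>) D' (Fs H)"
proof -
  interpret T: clifford_steps "tsig t \<sigma>" "\<tau> - \<sigma>" 0 D' v N by (rule clifford_steps_tsig)
  have "is_stem (tsig t \<sigma>) (\<tau> - \<sigma>) D' (Fs H)"
  proof (rule T.parity_stem)
    fix K' h assume K': "K' \<subseteq> {1..\<tau> - \<sigma>}" and h: "1 \<le> h" "h \<le> \<tau> - \<sigma>"
    define e :: real where "e = (if h \<in> K' then -1 else 1)"
    have "parity D' (t \<sigma> + h) e (Fs H K')"
      unfolding parity_def
    proof (intro ballI conjI)
      fix y assume y: "y \<in> D'"
      define y2 where "y2 = y(t \<sigma> + h := - y (t \<sigma> + h))"
      have nuh: "nu y (t 0 + \<sigma> + h) = y (t \<sigma> + h)" using h by (simp add: nu_def n_def)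
      have nu2: "nu y2 = (nu y)(t 0 + (\<sigma> + h) := - nu y (t 0 + (\<sigma> + h)))"
        unfolding y2_def nu_upd_tail[OF h] using nuh by (simp add: add.assoc)
      have "y2 = bflip (tsig t \<sigma>) h y" by (simp add: y2_def bflip_def tsig_def)
      moreover have "bflip (tsig t \<sigma>) h y \<in> D'" using T.adm y h unfolding admissible_dom_def by auto
      ultimately show "y2 \<in> D'" by simp
      show "Fs H K' y2 = e *\<^sub>R Fs H K' y"
        unfolding Fs_def scaleR_sum_right
      proof (intro sum.cong refl)
        fix L assume "L \<in> Pow {1..\<sigma>}"
        then have L: "L \<subseteq> {1..\<sigma>}" by simp
        have "Jprod (xb y2) L = Jprod (xb y) L" unfolding y2_def by (rule Jprod_xb_indep[OF L]) (use h in auto)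
        moreover have "H (L \<union> (+) \<sigma> ` K') (nu y2) = e *\<^sub>R H (L \<union> (+) \<sigma> ` K') (nu y)"
        proof -
          have "(\<sigma> + h \<in> L \<union> (+) \<sigma> ` K') = (h \<in> K')" using L h by auto
          moreover have "parity D (t 0 + (\<sigma> + h)) (if \<sigma> + h \<in> L \<union> (+) \<sigma> ` K' then -1 else 1) (H (L \<union> (+) \<sigma> ` K'))"
            by (rule par[OF union_shift(1)[OF L K']]) (use h in auto)
          ultimately show ?thesis using y unfolding nu2 e_def parity_def D'_iff by simp
        qed
        ultimately show "(-1) ^ (card L * card K') *\<^sub>R (Jprod (xb y2) L * H (L \<union> (+) \<sigma> ` K') (nu y2)) =
           e *\<^sub>R (-1) ^ (card L * card K') *\<^sub>R (Jprod (xb y) L * H (L \<union> (+) \<sigma> ` K') (nu y))" by simp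
      qed
    qed
    then show "parity D' (tsig t \<sigma> 0 + h) (if h \<in> K' then -1 else 1) (Fs H K')"
      by (simp add: tsig_def e_def)
  qed
  moreover have "reg_on p n' D' (Fs H K')" if "K' \<subseteq> {1..\<tau> - \<sigma>}" for K'
    unfolding Fs_def[abs_def]
  proof (rule reg_on_sum[OF copen_D'], rule reg_on_scaleR[OF copen_D'])
    fix L assume "L \<in> Pow {1..\<sigma>}"
    then have L: "L \<subseteq> {1..\<sigma>}" by simp
    show "reg_on p n' D' (\<lambda>y. Jprod (xb y) L * H (L \<union> (+) \<sigma> ` K') (nu y))"
      using union_shift(1)[OF L that] by (intro reg_on_Jprod_xb[OF L] reg_on_nu reg ev)
  qed
  ultimately show ?thesis by (simp add: stem_reg_def sdim_n)
qed

lemma ev_lapl: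
  fixes H :: "(nat \<Rightarrow> real) \<Rightarrow> 'a"
  assumes "reg_on p n D H" "ev H"
  shows "ev (lapl n H)"
  unfolding ev_def
proof
  fix u assume u: "u \<in> {1..\<sigma>}"
  show "parity D (t 0 + u) 1 (lapl n H)"
  proof (rule parity_lapl[OF copen_D assms(1)])
    show "t 0 + u < n" using u \<sigma>_le by (intro idx_less_n) simp
    show "parity D (t 0 + u) 1 H" using assms(2) u unfolding ev_def by blast
  qed
qed

lemma parity_add: "parity D i e g \<Longrightarrow> parity D i e h \<Longrightarrow> parity D i e (\<lambda>y. g y + h y)"
  by (simp add: parity_def scaleR_add_right)

text \<open>The function h supplies the invariance of D also when I is empty.\<close>

lemma parity_sum_scaleR:
  assumes "\<And>u. u \<in> I \<Longrightarrow> parity D i e (g u)" "parity D i e h"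
  shows "parity D i e (\<lambda>y. \<Sum>u\<in>I. c u *\<^sub>R g u y)"
  unfolding parity_def
proof (intro ballI conjI)
  fix y assume y: "y \<in> D"
  show "y(i := - y i) \<in> D" using assms(2) y by (simp add: parity_def)
  show "(\<Sum>u\<in>I. c u *\<^sub>R g u (y(i := - y i))) = e *\<^sub>R (\<Sum>u\<in>I. c u *\<^sub>R g u y)"
    unfolding scaleR_sum_right
  proof (rule sum.cong[OF refl])
    fix u assume "u \<in> I"
    then have "g u (y(i := - y i)) = e *\<^sub>R g u y" using assms(1) y by (simp add: parity_def)
    then show "c u *\<^sub>R g u (y(i := - y i)) = e *\<^sub>R c u *\<^sub>R g u y" by (simp add: mult.commute)
  qed
qed

text \<open>The decisive point is that both Laplacians can be compared on the level of even factors: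
  taking the Laplacian for \<open>T\<^sub>\<sigma>\<close> replaces the family H by a family W of
  the same kind, and multiplying W by the product of the \<open>\<beta>\<^sub>h\<close> gives the
  components of the Laplacian for \<open>T\<close> plus those of G.\<close>

theorem laplacian_difference:
  fixes F :: "nat set \<Rightarrow> (nat \<Rightarrow> real) \<Rightarrow> 'a"
  assumes F: "stem_reg p t \<tau> D F" "induces t \<tau> v D F f"
  shows "\<exists>G g. stem_reg p t \<tau> D G \<and> induces t \<tau> v D G g
     \<and> (\<forall>x\<in>Omega t \<tau> v D.
          slap p (tsig t \<sigma>) (\<tau> - \<sigma>) v (Dsig t \<tau> \<sigma> D) f x = slap p t \<tau> v D f x + g x)
     \<and> slice_reg p t \<tau> v D (slap p (tsig t \<sigma>) (\<tau> - \<sigma>) v (Dsig t \<tau> \<sigma> D) f)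
     \<and> (\<forall>K. K \<subseteq> {1..\<tau>} \<longrightarrow> (\<forall>y\<in>D. (\<Prod>u\<in>{1..\<sigma>}. y (t 0 + u)) \<noteq> 0 \<longrightarrow>
          G K y = (\<Sum>u\<in>{1..\<sigma>}. ((real (t u) - real (t (u - 1)) - 1) / y (t 0 + u)) *\<^sub>R pd (t 0 + u) (F K) y)
                + (\<Sum>u\<in>{1..\<sigma>} \<inter> K. ((1 + real (t (u - 1)) - real (t u)) / (y (t 0 + u))\<^sup>2) *\<^sub>R F K y)))"
proof -
  interpret T: clifford_steps "tsig t \<sigma>" "\<tau> - \<sigma>" 0 D' v N by (rule clifford_steps_tsig)
  have stemF: "is_stem t \<tau> D F" and regF: "\<And>K. K \<subseteq> {1..\<tau>} \<Longrightarrow> reg_on p n D (F K)"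
    using F(1) unfolding stem_reg_def sdim_n by blast+
  define P where "P = (\<lambda>K (y::nat \<Rightarrow> real). \<Prod>h\<in>{1..\<sigma>} \<inter> K. y (t 0 + h))"
  have "\<forall>K. \<exists>H. K \<subseteq> {1..\<tau>} \<longrightarrow> reg_on p n D H \<and> (\<forall>y\<in>D. F K y = P K y *\<^sub>R H y) \<and>
    (\<forall>h\<in>{1..\<tau>}. parity D (t 0 + h) (if h \<in> {1..\<sigma>} \<inter> K then 1 else if h \<in> K then -1 else 1) H)"
  proof
    fix K
    show "\<exists>H. K \<subseteq> {1..\<tau>} \<longrightarrow> reg_on p n D H \<and> (\<forall>y\<in>D. F K y = P K y *\<^sub>R H y) \<and>
      (\<forall>h\<in>{1..\<tau>}. parity D (t 0 + h) (if h \<in> {1..\<sigma>} \<inter> K then 1 else if h \<in> K then -1 else 1) H)"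
    proof (cases "K \<subseteq> {1..\<tau>}")
      case True
      have "\<exists>H. reg_on p n D H \<and> (\<forall>y\<in>D. F K y = (\<Prod>h\<in>{1..\<sigma>} \<inter> K. y (t 0 + h)) *\<^sub>R H y) \<and>
        (\<forall>h\<in>{1..\<tau>}. parity D (t 0 + h) (if h \<in> {1..\<sigma>} \<inter> K then 1 else if h \<in> K then -1 else 1) H)"
        by (rule divide_odd[OF _ _ regF[OF True], of _ "\<lambda>h. if h \<in> K then -1 else 1"])
           (use stem_parity[OF stemF True] \<sigma>_le in auto)
      then show ?thesis unfolding P_def by blast
    qed simp
  qed
  from choice[OF this] obtain H where H0: "\<forall>K. K \<subseteq> {1..\<tau>} \<longrightarrow> reg_on p n D (H K) \<and> (\<forall>y\<in>D. F K y = P K y *\<^sub>R H K y) \<and>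
    (\<forall>h\<in>{1..\<tau>}. parity D (t 0 + h) (if h \<in> {1..\<sigma>} \<inter> K then 1 else if h \<in> K then -1 else 1) (H K))" ..
  have H: "reg_on p n D (H K)" "y \<in> D \<Longrightarrow> F K y = P K y *\<^sub>R H K y"
    "h \<in> {1..\<tau>} \<Longrightarrow> parity D (t 0 + h) (if h \<in> {1..\<sigma>} \<inter> K then 1 else if h \<in> K then -1 else 1) (H K)"
    if "K \<subseteq> {1..\<tau>}" for K y h
  proof -
    note h0 = H0[THEN spec, THEN mp, OF that]
    show "reg_on p n D (H K)" by (rule h0[THEN conjunct1])
    show "F K y = P K y *\<^sub>R H K y" if "y \<in> D" by (rule h0[THEN conjunct2, THEN conjunct1, THEN bspec, OF that])
    show "parity D (t 0 + h) (if h \<in> {1..\<sigma>} \<inter> K then 1 else if h \<in> K then -1 else 1) (H K)" if "h \<in> {1..\<tau>}"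
      by (rule h0[THEN conjunct2, THEN conjunct2, THEN bspec, OF that])
  qed
  have evH: "ev (H K)" if "K \<subseteq> {1..\<tau>}" for K
    unfolding ev_def
  proof
    fix u assume "u \<in> {1..\<sigma>}"
    then show "parity D (t 0 + u) 1 (H K)" using H(3)[OF that, of u] \<sigma>_le by (auto split: if_splits)
  qed
  have tailH: "parity D (t 0 + h) (if h \<in> K then -1 else 1) (H K)" if "K \<subseteq> {1..\<tau>}" "\<sigma> < h" "h \<le> \<tau>" for K h
    using H(3)[OF that(1), of h] that by (auto split: if_splits)
  note stemFs = stem_reg_Fs[OF H(1) evH tailH]

  define d where "d u = real (t u) - real (t (u - 1)) - 1" for u
  define G where "G = (\<lambda>K y. P K y *\<^sub>R (\<Sum>u\<in>{1..\<sigma>}. d u *\<^sub>R Eq u (H K) y))"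
  \<comment> \<open>The even factors of the Laplacian for \<open>T\<^sub>\<sigma>\<close>. The
    summand 2 for \<open>u \<in> K\<close> occurs for both lists, so only the part with
    \<open>d u\<close> contributes to G.\<close>
  define W where "W = (\<lambda>K y. lapl n (H K) y + (\<Sum>u\<in>{1..\<sigma>}. (d u + (if u \<in> K then 2 else 0)) *\<^sub>R Eq u (H K) y))"
  have dcard: "real (card (blk u)) - 1 = d u" if "u \<in> {1..\<sigma>}" for u
    using card_blk[of u] that \<sigma>_le by (simp add: d_def)
  have parE: "parity D i e (Eq u (H K))" if "K \<subseteq> {1..\<tau>}" "u \<in> {1..\<sigma>}" "parity D i e (H K)" for i e u K
    using parity_Eq[OF H(1)[OF that(1)] _ _ that(3)] that(2) by simp
  have evW: "ev (W K)" if K: "K \<subseteq> {1..\<tau>}" for K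
    unfolding ev_def W_def
  proof (intro ballI parity_add parity_sum_scaleR)
    fix w assume w: "w \<in> {1..\<sigma>}"
    show "parity D (t 0 + w) 1 (lapl n (H K))" using ev_lapl[OF H(1)[OF K] evH[OF K]] w by (simp add: ev_def)
    then show "parity D (t 0 + w) 1 (lapl n (H K))" .
    show "parity D (t 0 + w) 1 (Eq u (H K))" if "u \<in> {1..\<sigma>}" for u
      using parE[OF K that] evH[OF K] w by (simp add: ev_def)
  qed

  have PW: "P K y *\<^sub>R W K y = lapl n (F K) y + G K y" if K: "K \<subseteq> {1..\<tau>}" and y: "y \<in> D" for K y
  proof -
    have "lapl n (F K) y = lapl n (\<lambda>y. P K y *\<^sub>R H K y) y"
      by (rule lapl_cong[OF copen_D H(2)[OF K] y])
    also have "\<dots> = P K y *\<^sub>R (lapl n (H K) y + (\<Sum>u\<in>{1..\<sigma>}. (if u \<in> {1..\<sigma>} \<inter> K then 2 else 0) *\<^sub>R Eq u (H K) y))"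
      unfolding P_def by (rule lapl_prod_coord[OF H(1)[OF K] evH[OF K] _ y]) simp
    also have "(\<Sum>u\<in>{1..\<sigma>}. (if u \<in> {1..\<sigma>} \<inter> K then 2 else 0) *\<^sub>R Eq u (H K) y) = (\<Sum>u\<in>{1..\<sigma>}. (if u \<in> K then 2 else 0) *\<^sub>R Eq u (H K) y)"
      by (rule sum.cong) auto
    finally show ?thesis
      unfolding W_def G_def by (simp only: scaleR_add_left sum.distrib scaleR_add_right add_ac)
  qed

  have stemG: "stem_reg p t \<tau> D G"
    unfolding stem_reg_def sdim_n
  proof (intro conjI allI impI)
    fix K assume K: "K \<subseteq> {1..\<tau>}"
    show "reg_on p n D (G K)"
      unfolding G_def P_def
    proof (rule reg_on_prod_coord)
      show "reg_on p n D (\<lambda>y. \<Sum>u\<in>{1..\<sigma>}. d u *\<^sub>R Eq u (H K) y)"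
        by (rule reg_on_sum[OF copen_D], rule reg_on_scaleR[OF copen_D], rule reg_on_Eq[OF H(1)[OF K] evH[OF K]]) auto
    qed (use \<sigma>_le in auto)
  next
    show "is_stem t \<tau> D G"
    proof (rule parity_stem)
      fix K h assume K: "K \<subseteq> {1..\<tau>}" and h: "1 \<le> h" "h \<le> \<tau>"
      define e :: real where "e = (if h \<in> {1..\<sigma>} \<inter> K then 1 else if h \<in> K then -1 else 1)"
      have e: "parity D (t 0 + h) e (H K)" unfolding e_def using H(3)[OF K] h by simp
      have "parity D (t 0 + h) e (\<lambda>y. \<Sum>u\<in>{1..\<sigma>}. d u *\<^sub>R Eq u (H K) y)"
        by (rule parity_sum_scaleR[OF parE[OF K _ e] e])
      then have "parity D (t 0 + h) ((if h \<in> {1..\<sigma>} \<inter> K then -1 else 1) * e) (G K)"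
        unfolding G_def P_def by (intro parity_prod_coord) auto
      moreover have "(if h \<in> {1..\<sigma>} \<inter> K then -1 else 1) * e = (if h \<in> K then -1 else 1)"
        by (auto simp: e_def)
      ultimately show "parity D (t 0 + h) (if h \<in> K then -1 else 1) (G K)" by simp
    qed
  qed

  have indFs: "induces (tsig t \<sigma>) (\<tau> - \<sigma>) v D' (Fs H) f"
    unfolding induces_def
  proof (intro ballI)
    fix y' J' assume y': "y' \<in> D'" and J': "J' \<in> torus (tsig t \<sigma>) (\<tau> - \<sigma>) v"
    obtain J where J: "J \<in> torus t \<tau> v" and c: "corr (nu y') J y' J'" using corr_to[OF y' J'] by blast
    have z: "nu y' \<in> D" using y' by (simp add: D'_iff)
    have "f (spt (tsig t \<sigma>) (\<tau> - \<sigma>) v y' J') = (\<Sum>K\<in>Pow {1..\<tau>}. Jprod J K * F K (nu y'))"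
      using F(2) z J unfolding corr_spt[OF c] induces_def by blast
    also have "\<dots> = (\<Sum>K\<in>Pow {1..\<tau>}. Jprod J K * (P K (nu y') *\<^sub>R H K (nu y')))"
      using H(2)[OF _ z] by (intro sum.cong) auto
    also have "\<dots> = (\<Sum>K'\<in>Pow {1..\<tau> - \<sigma>}. Jprod J' K' * Fs H K' y')"
      unfolding P_def by (rule transfer[OF c J z evH, symmetric])
    finally show "f (spt (tsig t \<sigma>) (\<tau> - \<sigma>) v y' J') = (\<Sum>K'\<in>Pow {1..\<tau> - \<sigma>}. Jprod J' K' * Fs H K' y')" .
  qed

  have laplFs: "lapl n' (Fs H K') y' = Fs W K' y'" if K': "K' \<subseteq> {1..\<tau> - \<sigma>}" and y': "y' \<in> D'" for K' y'
  proof -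
    have "lapl n' (Fs H K') y' = (\<Sum>L\<in>Pow {1..\<sigma>}. (-1) ^ (card L * card K') *\<^sub>R
        lapl n' (\<lambda>y. Jprod (xb y) L * H (L \<union> (+) \<sigma> ` K') (nu y)) y')"
      unfolding Fs_def[abs_def]
    proof (rule lapl_sum_scaleR[OF copen_D' y'])
      fix L assume "L \<in> Pow {1..\<sigma>}"
      then have L: "L \<subseteq> {1..\<sigma>}" by simp
      show "reg_on p n' D' (\<lambda>y. Jprod (xb y) L * H (L \<union> (+) \<sigma> ` K') (nu y))"
        using union_shift(1)[OF L K'] by (intro reg_on_Jprod_xb[OF L] reg_on_nu H(1) evH)
    qed simp
    also have "\<dots> = Fs W K' y'"
      unfolding Fs_def
    proof (intro sum.cong refl arg_cong2[where f = scaleR])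
      fix L assume "L \<in> Pow {1..\<sigma>}"
      then have L: "L \<subseteq> {1..\<sigma>}" by simp
      note us = union_shift[OF L K']
      have "(\<Sum>u\<in>{1..\<sigma>}. (real (card (blk u)) - 1 + (if u \<in> L then 2 else 0)) *\<^sub>R Eq u (H (L \<union> (+) \<sigma> ` K')) (nu y'))
          = (\<Sum>u\<in>{1..\<sigma>}. (d u + (if u \<in> L \<union> (+) \<sigma> ` K' then 2 else 0)) *\<^sub>R Eq u (H (L \<union> (+) \<sigma> ` K')) (nu y'))"
      proof (intro sum.cong refl arg_cong2[where f = scaleR] arg_cong2[where f = "(+)"])
        fix u assume u: "u \<in> {1..\<sigma>}"
        show "real (card (blk u)) - 1 = d u" by (rule dcard[OF u])
        have "u \<in> L \<longleftrightarrow> u \<in> L \<union> (+) \<sigma> ` K'" using us(2) u by blast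
        then show "(if u \<in> L then 2 else 0) = (if u \<in> L \<union> (+) \<sigma> ` K' then 2 else (0::real))" by simp
      qed
      then show "lapl n' (\<lambda>y. Jprod (xb y) L * H (L \<union> (+) \<sigma> ` K') (nu y)) y' = Jprod (xb y') L * W (L \<union> (+) \<sigma> ` K') (nu y')"
        unfolding lapl_Jprod_xb[OF H(1)[OF us(1)] evH[OF us(1)] L y'] W_def by simp
    qed
    finally show ?thesis .
  qed

  define S where "S = slap p (tsig t \<sigma>) (\<tau> - \<sigma>) v D' f"
  have Tn: "T.n = n'" using T.sdim_n(1) sdim_n(2) by simp
  have S: "S (spt t \<tau> v y J) = (\<Sum>K\<in>Pow {1..\<tau>}. Jprod J K * (lapl n (F K) y + G K y))"
    if y: "y \<in> D" and J: "J \<in> torus t \<tau> v" for y J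
  proof -
    obtain y' J' where y': "y' \<in> D'" and J': "J' \<in> torus (tsig t \<sigma>) (\<tau> - \<sigma>) v" and c: "corr y J y' J'"
      using corr_from[OF y J] by blast
    have "S (spt t \<tau> v y J) = (\<Sum>K'\<in>Pow {1..\<tau> - \<sigma>}. Jprod J' K' * lapl n' (Fs H K') y')"
      unfolding S_def corr_spt[OF c, symmetric] using T.slap_eq[OF stemFs indFs y' J'] by (simp add: Tn)
    also have "\<dots> = (\<Sum>K'\<in>Pow {1..\<tau> - \<sigma>}. Jprod J' K' * Fs W K' y')"
      using laplFs[OF _ y'] by (intro sum.cong) auto
    also have "\<dots> = (\<Sum>K\<in>Pow {1..\<tau>}. Jprod J K * (P K y *\<^sub>R W K y))"
      unfolding P_def by (rule transfer[OF c J y evW])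
    also have "\<dots> = (\<Sum>K\<in>Pow {1..\<tau>}. Jprod J K * (lapl n (F K) y + G K y))"
      using PW[OF _ y] by (intro sum.cong) auto
    finally show ?thesis .
  qed
  \<comment> \<open>With g defined as the difference, the required equation is immediate; the
    content is that G induces it.\<close>
  define g where "g = (\<lambda>x. S x - slap p t \<tau> v D f x)"
  have indG: "induces t \<tau> v D G g"
    unfolding induces_def
  proof (intro ballI)
    fix y J assume y: "y \<in> D" and J: "J \<in> torus t \<tau> v"
    show "g (spt t \<tau> v y J) = (\<Sum>K\<in>Pow {1..\<tau>}. Jprod J K * G K y)"
      unfolding g_def S[OF y J] slap_eq[OF F y J] by (simp add: distrib_left sum.distrib)
  qed
  have regS: "slice_reg p t \<tau> v D S"
    unfolding slice_reg_def
  proof (intro exI conjI)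
    show "induces t \<tau> v D (\<lambda>K y. lapl n (F K) y + G K y) S" unfolding induces_def using S by blast
    show "stem_reg p t \<tau> D (\<lambda>K y. lapl n (F K) y + G K y)"
      unfolding stem_reg_def sdim_n
    proof (intro conjI allI impI)
      show "reg_on p n D (\<lambda>y. lapl n (F K) y + G K y)" if "K \<subseteq> {1..\<tau>}" for K
        using stemG that by (intro reg_on_add[OF copen_D] reg_on_lapl[OF copen_D] regF) (auto simp: stem_reg_def sdim_n)
      show "is_stem t \<tau> D (\<lambda>K y. lapl n (F K) y + G K y)"
        using is_stem_lapl[OF F(1)] stemG by (simp add: is_stem_def stem_reg_def)
    qed
  qed
  have formula: "G K y = (\<Sum>u\<in>{1..\<sigma>}. ((real (t u) - real (t (u - 1)) - 1) / y (t 0 + u)) *\<^sub>R pd (t 0 + u) (F K) y)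
                + (\<Sum>u\<in>{1..\<sigma>} \<inter> K. ((1 + real (t (u - 1)) - real (t u)) / (y (t 0 + u))\<^sup>2) *\<^sub>R F K y)"
    if K: "K \<subseteq> {1..\<tau>}" and y: "y \<in> D" and nz: "(\<Prod>u\<in>{1..\<sigma>}. y (t 0 + u)) \<noteq> 0" for K y
  proof -
    have A: "(\<Sum>u\<in>{1..\<sigma>} \<inter> K. ((1 + real (t (u - 1)) - real (t u)) / (y (t 0 + u))\<^sup>2) *\<^sub>R F K y)
        = (\<Sum>u\<in>{1..\<sigma>}. if u \<in> K then (- d u / (y (t 0 + u))\<^sup>2) *\<^sub>R F K y else 0)"
    proof -
      have "1 + real (t (u - 1)) - real (t u) = - d u" for u by (simp add: d_def)
      then show ?thesis by (simp only: sum.inter_restrict finite_atLeastAtMost)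
    qed
    have B: "d u *\<^sub>R P K y *\<^sub>R Eq u (H K) y = (d u / y (t 0 + u)) *\<^sub>R pd (t 0 + u) (F K) y
        + (if u \<in> K then (- d u / (y (t 0 + u))\<^sup>2) *\<^sub>R F K y else 0)" if u0: "u \<in> {1..\<sigma>}" for u
    proof -
      define k where "k = t 0 + u"
      have u: "1 \<le> u" "u \<le> \<sigma>" using u0 by auto
      have kn: "k < n" using u \<sigma>_le idx_less_n by (simp add: k_def)
      have yk: "y k \<noteq> 0" using nz u0 by (auto simp: k_def)
      have E: "pd k (H K) y = y k *\<^sub>R Eq u (H K) y"
        unfolding k_def by (rule Eq_mult[OF H(1)[OF K] evH[OF K] u y, symmetric])
      have dH: "has_pd k (H K) (pd k (H K) y) y" by (rule reg_on_has_pd[OF copen_D H(1)[OF K] y kn])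
      show ?thesis
      proof (cases "u \<in> K")
        case False
        have "P K (y(k := s)) = P K y" for s
          unfolding P_def using False by (intro prod.cong) (auto simp: k_def)
        then have "has_pd k (\<lambda>y. P K y *\<^sub>R H K y) (P K y *\<^sub>R pd k (H K) y) y"
          using dH by (rule has_pd_scaleR_indep)
        then have "has_pd k (F K) (P K y *\<^sub>R pd k (H K) y) y"
          by (rule has_pd_cong[OF copen_D y kn, rotated]) (simp add: H(2)[OF K])
        then have "pd k (F K) y = P K y *\<^sub>R pd k (H K) y" by (rule has_pd_imp_pd)
        then show ?thesis using False yk by (simp add: E flip: k_def)
      next
        case True
        \<comment> \<open>Here \<open>F\<^sub>K = Q \<beta>\<^sub>u H\<^sub>K\<close>, so
          \<open>\<beta>\<^sub>u\<inverse> \<partial>\<^sub>u F\<^sub>K\<close> contains the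
          singular term \<open>\<beta>\<^sub>u\<inverse> Q H\<^sub>K\<close>. It equals
          \<open>\<beta>\<^sub>u\<^sup>-\<^sup>2 F\<^sub>K\<close> and is cancelled by the second
          sum of the formula, leaving
          \<open>Q \<partial>\<^sub>u H\<^sub>K = Q \<beta>\<^sub>u E\<^sub>u\<close>.\<close>
        define Q where "Q = (\<lambda>y::nat \<Rightarrow> real. \<Prod>h\<in>{1..\<sigma>} \<inter> K - {u}. y (t 0 + h))"
        have PQ: "P K z = Q z * z k" for z
          unfolding P_def Q_def k_def using prod.remove[of "{1..\<sigma>} \<inter> K" u "\<lambda>h. z (t 0 + h)"] True u0
          by (simp add: mult.commute)
        have "Q (y(k := s)) = Q y" for s
          unfolding Q_def by (intro prod.cong) (auto simp: k_def)
        then have "has_pd k (\<lambda>y. Q y *\<^sub>R (y k *\<^sub>R H K y)) (Q y *\<^sub>R (y k *\<^sub>R pd k (H K) y + H K y)) y"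
          using has_pd_coord_scaleR[OF dH, of k] by (intro has_pd_scaleR_indep) simp_all
        then have "has_pd k (F K) (Q y *\<^sub>R (y k *\<^sub>R pd k (H K) y + H K y)) y"
          by (rule has_pd_cong[OF copen_D y kn, rotated]) (simp add: H(2)[OF K] PQ)
        then have 1: "pd k (F K) y = Q y *\<^sub>R (y k *\<^sub>R pd k (H K) y + H K y)" by (rule has_pd_imp_pd)
        have "(d u / y k) *\<^sub>R pd k (F K) y + (- d u / (y k)\<^sup>2) *\<^sub>R F K y = (d u * (Q y * y k)) *\<^sub>R Eq u (H K) y"
          using yk unfolding 1 E H(2)[OF K y] PQ
          by (simp add: scaleR_add_right power2_eq_square)
        then show ?thesis using True by (simp add: PQ flip: k_def)
      qed
    qed
    have "G K y = (\<Sum>u\<in>{1..\<sigma>}. P K y *\<^sub>R d u *\<^sub>R Eq u (H K) y)"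
      unfolding G_def scaleR_sum_right ..
    also have "\<dots> = (\<Sum>u\<in>{1..\<sigma>}. (d u / y (t 0 + u)) *\<^sub>R pd (t 0 + u) (F K) y
        + (if u \<in> K then (- d u / (y (t 0 + u))\<^sup>2) *\<^sub>R F K y else 0))"
    proof (rule sum.cong[OF refl])
      fix u assume "u \<in> {1..\<sigma>}"
      from B[OF this] show "P K y *\<^sub>R d u *\<^sub>R Eq u (H K) y = (d u / y (t 0 + u)) *\<^sub>R pd (t 0 + u) (F K) y
        + (if u \<in> K then (- d u / (y (t 0 + u))\<^sup>2) *\<^sub>R F K y else 0)"
        by (subst scaleR_left_commute)
    qed
    finally show ?thesis unfolding sum.distrib A d_def .
  qed
  show ?thesis
    unfolding D'_def[symmetric] S_def[symmetric]
  proof (intro exI[of _ G] exI[of _ g] conjI allI impI ballI)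
    show "S x = slap p t \<tau> v D f x + g x" for x by (simp add: g_def)
  qed (fact stemG indG regS | rule formula; assumption)+
qed

end

theorem theorem5p2:
  fixes cj :: "'a::{euclidean_space, real_algebra_1} \<Rightarrow> 'a"
    and v :: "nat \<Rightarrow> 'a" and N :: nat
    and t :: "nat \<Rightarrow> nat" and \<tau> \<sigma> :: nat
    and D :: "(nat \<Rightarrow> real) set"
    and p :: regularity
    and F :: "nat set \<Rightarrow> (nat \<Rightarrow> real) \<Rightarrow> 'a" and f :: "'a \<Rightarrow> 'a"
  assumes cj_linear: "linear cj"
    and cj_antimult: "\<And>x y. cj (x * y) = cj y * cj x"
    and cj_invol: "\<And>x. cj (cj x) = x"
    and cj_real: "\<And>r. cj (of_real r) = of_real r"
    and SA_ne: "SA cj \<noteq> {}"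
    and N_ge: "N \<ge> 1"
    and v0: "v 0 = 1"
    and v_orthonormal: "\<And>i j. i \<le> N \<Longrightarrow> j \<le> N \<Longrightarrow> inner (v i) (v j) = (if i = j then 1 else 0)"
    and v_SA: "\<And>s. 1 \<le> s \<Longrightarrow> s \<le> N \<Longrightarrow> v s \<in> SA cj"
    and v_anticomm: "\<And>r s. 1 \<le> r \<Longrightarrow> r \<le> N \<Longrightarrow> 1 \<le> s \<Longrightarrow> s \<le> N \<Longrightarrow> r \<noteq> s \<Longrightarrow> v r * v s = - (v s * v r)"
    and V_slice: "\<And>x. x \<in> span (v ` {0..N}) \<Longrightarrow> \<exists>J\<in>SA cj. \<exists>a b. x = a *\<^sub>R 1 + b *\<^sub>R J"
    and t_mono: "\<And>h. h < \<tau> \<Longrightarrow> t h < t (Suc h)"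
    and t_last: "t \<tau> = N"
    and D_adm: "admissible_dom t \<tau> D"
    and p_cases: "p = C_infinity \<or> p = C_omega"
    and \<sigma>_range: "1 \<le> \<sigma>" "\<sigma> \<le> \<tau>"
    and F_stem: "stem_reg p t \<tau> D F"
    and f_eq: "induces t \<tau> v D F f"
  shows "\<exists>G g. stem_reg p t \<tau> D G \<and> induces t \<tau> v D G g
     \<and> (\<forall>x\<in>Omega t \<tau> v D.
          slap p (tsig t \<sigma>) (\<tau> - \<sigma>) v (Dsig t \<tau> \<sigma> D) f x = slap p t \<tau> v D f x + g x)
     \<and> slice_reg p t \<tau> v D (slap p (tsig t \<sigma>) (\<tau> - \<sigma>) v (Dsig t \<tau> \<sigma> D) f)
     \<and> (\<forall>K. K \<subseteq> {1..\<tau>} \<longrightarrow> (\<forall>y\<in>D. (\<Prod>u\<in>{1..\<sigma>}. y (t 0 + u)) \<noteq> 0 \<longrightarrow>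
          G K y = (\<Sum>u\<in>{1..\<sigma>}. ((real (t u) - real (t (u - 1)) - 1) / y (t 0 + u)) *\<^sub>R pd (t 0 + u) (F K) y)
                + (\<Sum>u\<in>{1..\<sigma>} \<inter> K. ((1 + real (t (u - 1)) - real (t u)) / (y (t 0 + u))\<^sup>2) *\<^sub>R F K y)))"
proof -
  have v_sq: "v s * v s = -1" if "1 \<le> s" "s \<le> N" for s
  proof -
    have "v s + cj (v s) = 0" "v s * cj (v s) = 1" using v_SA[OF that] by (auto simp: SA_def)
    then have "cj (v s) = - v s" by (simp add: add_eq_0_iff)
    then have "- (v s * v s) = 1" using \<open>v s * cj (v s) = 1\<close> by simp
    then show ?thesis by (metis minus_minus)
  qed
  interpret clifford_steps t \<tau> \<sigma> D v N
    by unfold_locales (fact t_mono \<sigma>_range(2) D_adm v_orthonormal v_sq v_anticomm t_last)+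
  show ?thesis by (rule laplacian_difference[OF F_stem f_eq])
qed

end
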